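(* Let $n\in\mathbb{N}$, $0<\tau\le\infty$, $0<\alpha<1$, and let $\{S_1(t)\}_{t\in(0,\tau)}\subset\mathcal{B}(X)$ be a local $(g_\alpha,g_\alpha)$-regularized resolvent family generated by a closed operator $A$ on $X$. For $0<T<\tau$ let the family of operators $\{S_{n+1}(t)\}_{t\in(0,(n+1)T]}$ be defined recursively (starting from $\{S_1(t)\}_{t\in(0,T]}$) by $$S_{n+1}(t)x=S_n(t)x,\qquad x\in X,\ t\in(0,nT],$$ and $$S_{n+1}(t)x=\frac{\alpha}{\Gamma(1-\alpha)}\int_0^{t-nT}\int_0^{nT}\frac{S_n(r_1)S_1(r_2)x}{(t-r_1-r_2)^{1+\alpha}}\,dr_1\,dr_2,\qquad x\in X,\ t\in(nT,(n+1)T].$$ Then, for any $T<\tau$, $\{S_{n+1}(t)\}_{t\in(0,(n+1)T]}$ is a local $(g_\alpha,g_\alpha)$-regularized resolvent family generated by $A$. Consequently $A$ generates a global $(g_\alpha,g_\alpha)$-regularized resolvent family $\{S(t)\}_{t\in(0,\infty)}$.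
   Context: $X$ is a complex Banach space, $\mathcal{B}(X)$ the bounded linear operators on $X$. $g_\alpha(t)=t^{\alpha-1}/\Gamma(\alpha)$ for $t>0$, with $\Gamma$ the Euler Gamma function. $(f*S)(t)x=\int_0^t f(t-s)S(s)x\,ds$. Definition. Let $0<\tau\le\infty$, $a,k\in L^1_{loc}([0,\tau))$, $k\in\mathcal{C}(0,\tau)$ with $k(t)\ne0$ for all $t\in(0,\sigma)$ for some small $\sigma>0$, and let $A$ be a closed operator on $X$ with domain $D(A)$. A strongly continuous family $\{S(t)\}_{t\in(0,\tau)}\subset\mathcal{B}(X)$ is a local (global if $\tau=\infty$) $(a,k)$-regularized resolvent family generated by $A$ if: (i) $\lim_{t\to0^+}S(t)x/k(t)=x$ for all $x\in X$; (ii) $S(t)A\subset AS(t)$ for $t\in(0,\tau)$; (iii) $(a*S)(t)x\in D(A)$ and $A(a*S)(t)x=S(t)x-k(t)x$ for all $x\in X$, $t\in(0,\tau)$. The same definition is used with a half-closed interval $(0,T]$ in place of $(0,\tau)$. *)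

theory Defs
  imports "HOL-Analysis.Analysis"
begin

class complex_banach = banach +
  fixes scaleC :: "complex \<Rightarrow> 'a \<Rightarrow> 'a" (infixr "*\<^sub>C" 75)
  assumes scaleC_add_right: "c *\<^sub>C (x + y) = c *\<^sub>C x + c *\<^sub>C y"
    and scaleC_add_left: "(c + d) *\<^sub>C x = c *\<^sub>C x + d *\<^sub>C x"
    and scaleC_scaleC: "c *\<^sub>C d *\<^sub>C x = (c * d) *\<^sub>C x"
    and scaleC_of_real: "complex_of_real r *\<^sub>C x = r *\<^sub>R x"
    and norm_scaleC: "norm (c *\<^sub>C x) = cmod c * norm x"

instantiation complex :: complex_banach
begin

definition scaleC_complex :: "complex \<Rightarrow> complex \<Rightarrow> complex"
  where "scaleC_complex c x = c * x"

instance
  by standard (simp_all add: scaleC_complex_def algebra_simps norm_mult scaleR_conv_of_real)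

end

definition bounded_clinear :: "('a::complex_banach \<Rightarrow> 'a) \<Rightarrow> bool"
  where "bounded_clinear f \<longleftrightarrow> bounded_linear f \<and> (\<forall>c x. f (c *\<^sub>C x) = c *\<^sub>C f x)"

text \<open>A (possibly unbounded, not necessarily densely defined) operator is given by its domain
  \<open>D\<close> together with a map \<open>A\<close> whose values off \<open>D\<close> are irrelevant.\<close>

definition closed_operator :: "'a::complex_banach set \<Rightarrow> ('a \<Rightarrow> 'a) \<Rightarrow> bool"
  where "closed_operator D A \<longleftrightarrow>
    0 \<in> D \<and>
    (\<forall>x\<in>D. \<forall>y\<in>D. x + y \<in> D \<and> A (x + y) = A x + A y) \<and>
    (\<forall>c. \<forall>x\<in>D. c *\<^sub>C x \<in> D \<and> A (c *\<^sub>C x) = c *\<^sub>C A x) \<and>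
    closed ((\<lambda>x. (x, A x)) ` D)"

text \<open>The library's Bochner integral needs a second countable codomain, so integrals of
  vector-valued functions are gauge integrals, which extend the Bochner integral to an arbitrary
  Banach space. A product of a measurable scalar function and a norm continuous function is
  strongly measurable; for such integrands \<open>conv_integrable\<close> amounts to Bochner integrability.\<close>

definition conv_integrable :: "(real \<Rightarrow> complex) \<Rightarrow> (real \<Rightarrow> 'a::complex_banach) \<Rightarrow> real \<Rightarrow> bool"
  where "conv_integrable f u t \<longleftrightarrow>
    (\<lambda>s. f (t - s) *\<^sub>C u s) integrable_on {0..t} \<and>
    (\<lambda>s. norm (f (t - s) *\<^sub>C u s)) integrable_on {0..t}"

definition conv :: "(real \<Rightarrow> complex) \<Rightarrow> (real \<Rightarrow> 'a::complex_banach) \<Rightarrow> real \<Rightarrow> 'a"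
  where "conv f u t = integral {0..t} (\<lambda>s. f (t - s) *\<^sub>C u s)"

text \<open>The index set \<open>I\<close> is an interval \<open>(0,\<tau>)\<close> or \<open>(0,T]\<close>. In either case local integrability on
  \<open>I \<union> {0}\<close> is integrability on \<open>[0,b]\<close> for every \<open>b \<in> I\<close>.\<close>

definition regularized_resolvent_family ::
    "(real \<Rightarrow> complex) \<Rightarrow> (real \<Rightarrow> complex) \<Rightarrow> real set \<Rightarrow>
      'a::complex_banach set \<Rightarrow> ('a \<Rightarrow> 'a) \<Rightarrow> (real \<Rightarrow> 'a \<Rightarrow> 'a) \<Rightarrow> bool"
  where "regularized_resolvent_family a k I D A S \<longleftrightarrow>
    (\<forall>b\<in>I. a absolutely_integrable_on {0..b} \<and> k absolutely_integrable_on {0..b}) \<and>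
    continuous_on I k \<and>
    (\<exists>\<sigma>>0. {0<..<\<sigma>} \<subseteq> I \<and> (\<forall>t\<in>{0<..<\<sigma>}. k t \<noteq> 0)) \<and>
    closed_operator D A \<and>
    (\<forall>t\<in>I. bounded_clinear (S t)) \<and>
    (\<forall>x. continuous_on I (\<lambda>t. S t x)) \<and>
    (\<forall>x. ((\<lambda>t. inverse (k t) *\<^sub>C S t x) \<longlongrightarrow> x) (at_right 0)) \<and>
    (\<forall>t\<in>I. \<forall>x\<in>D. S t x \<in> D \<and> A (S t x) = S t (A x)) \<and>
    (\<forall>t\<in>I. \<forall>x. conv_integrable a (\<lambda>s. S s x) t \<and>
      conv a (\<lambda>s. S s x) t \<in> D \<and>
      A (conv a (\<lambda>s. S s x) t) = S t x - k t *\<^sub>C x)"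

definition open_interval :: "ereal \<Rightarrow> real set"
  where "open_interval \<tau> = {t. 0 < t \<and> ereal t < \<tau>}"

definition g :: "real \<Rightarrow> real \<Rightarrow> complex"
  where "g \<alpha> t = (if t > 0 then complex_of_real (t powr (\<alpha> - 1) / Gamma \<alpha>) else 0)"

text \<open>Starting from \<open>S\<^sub>1\<close>, the family after \<open>n\<close> extension steps is \<open>S\<^sub>n\<^sub>+\<^sub>1\<close>, so that
  \<open>extension \<alpha> T S\<^sub>1 n\<close> is the family on \<open>(0,(n+1)T]\<close>; its values outside this interval are
  irrelevant.\<close>

primrec extension ::
    "real \<Rightarrow> real \<Rightarrow> (real \<Rightarrow> 'a::complex_banach \<Rightarrow> 'a) \<Rightarrow> nat \<Rightarrow> real \<Rightarrow> 'a \<Rightarrow> 'a"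
  where
    "extension \<alpha> T S\<^sub>1 0 = S\<^sub>1"
  | "extension \<alpha> T S\<^sub>1 (Suc n) = (\<lambda>t x.
      if t \<le> real (n + 1) * T then extension \<alpha> T S\<^sub>1 n t x
      else (\<alpha> / Gamma (1 - \<alpha>)) *\<^sub>R
        integral {0..t - real (n + 1) * T} (\<lambda>r\<^sub>2.
          integral {0..real (n + 1) * T} (\<lambda>r\<^sub>1.
            (1 / (t - r\<^sub>1 - r\<^sub>2) powr (1 + \<alpha>)) *\<^sub>R extension \<alpha> T S\<^sub>1 n r\<^sub>1 (S\<^sub>1 r\<^sub>2 x))))"

end

theory Submission
  imports Defs
begin

text \<open>
  Put \<open>b = nT\<close>, \<open>g = g\<^sub>\<alpha>\<close> and, for \<open>0 < s \<le> T\<close>,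
  \<open>H(s) y = \<alpha> / \<Gamma>(1-\<alpha>) \<integral>\<^sub>0\<^sup>b (b+s-r)\<^bsup>-1-\<alpha>\<^esup> S\<^sub>n(r) y dr\<close>, so that
  \<open>S\<^sub>n\<^sub>+\<^sub>1(b+s) = (H * S\<^sub>1)(s)\<close>. The function \<open>H\<close> commutes with \<open>A\<close>, is \<open>O(s\<^bsup>-\<alpha>\<^esup>)\<close> at \<open>0\<close>, and
  \<open>s\<^bsup>\<alpha>\<^esup> H(s)\<close> tends strongly to \<open>S\<^sub>n(b) / \<Gamma>(1-\<alpha>)\<close>; since \<open>s\<^bsup>1-\<alpha>\<^esup> S\<^sub>1(s)\<close> tends to
  \<open>1 / \<Gamma>(\<alpha>)\<close> and \<open>B(1-\<alpha>,\<alpha>) = \<Gamma>(\<alpha>) \<Gamma>(1-\<alpha>)\<close>, the extension is continuous at \<open>b\<close>.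

  Associativity of convolution gives \<open>g * (H * S\<^sub>1) = H * (g * S\<^sub>1)\<close>, hence
  \<open>A (g * (H * S\<^sub>1)) = H * S\<^sub>1 - g * H\<close>, and \<open>(g * H)(s) = \<integral>\<^sub>0\<^sup>b \<kappa>\<^sub>s(b-r) S\<^sub>n(r) dr\<close> for
  \<open>\<kappa>\<^sub>s(u) = s\<^bsup>\<alpha>\<^esup> u\<^bsup>-\<alpha>\<^esup> / ((s+u) \<Gamma>(\<alpha>) \<Gamma>(1-\<alpha>))\<close>. The identity
  \<open>(\<kappa>\<^sub>s * g)(c) = g(s+c)\<close> rewrites the contribution of \<open>(0,b)\<close> to \<open>(g * S\<^sub>n\<^sub>+\<^sub>1)(b+s)\<close> as
  \<open>(\<kappa>\<^sub>s * (g * S\<^sub>n))(b)\<close>, which \<open>A\<close> maps to \<open>(\<kappa>\<^sub>s * S\<^sub>n)(b) - g(b+s)\<close>. The terms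
  \<open>(\<kappa>\<^sub>s * S\<^sub>n)(b)\<close> cancel in the sum.
\<close>

section \<open>Gauge integrals of dominated continuous functions\<close>

text \<open>The extension formula is a variation of constants. On \<open>(b, b + T]\<close> the
  unknown w(s) = S(b + s) has to solve w = A (g * w) + f, where f is the term that \<open>A\<close>
  produces from the values on (0,b) besides -g(b + s). Since S_1 = g + A (g * S_1), a right-hand
  side of the form f = g * H is answered by w = H * S_1, so H has to be the fractional derivative of
  order \<alpha> of f. Each step convolves with S_1 on (0,T] only, hence every step gains the same
  length T, and a single T leads to a global family. The obstacle is that the families are merely
  strongly continuous, take values in an arbitrary Banach space and blow up at 0. All integrals
  therefore follow one pattern: the integrand is continuous on an open interval and its norm lies
  below an integrable product of powers. The exponents do the bookkeeping: order \<alpha> for S_n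
  and order 1 - \<alpha> for H add up to order 1 for H * S_1, so there is no singularity at the
  joint.\<close>

lemma integrable_L1_approx:
  fixes f :: "real \<Rightarrow> 'a::banach"
  assumes approx: "\<And>e. e > 0 \<Longrightarrow> \<exists>g \<phi>. g integrable_on {a..b} \<and> \<phi> integrable_on {a..b} \<and>
    integral {a..b} \<phi> < e \<and> (\<forall>x\<in>{a..b}. norm (f x - g x) \<le> \<phi> x)"
  shows "f integrable_on {a..b}"
proof -
  have "\<exists>\<gamma>. gauge \<gamma> \<and> (\<forall>D1 D2. D1 tagged_division_of cbox a b \<and> \<gamma> fine D1 \<and>
            D2 tagged_division_of cbox a b \<and> \<gamma> fine D2 \<longrightarrow>
            norm ((\<Sum>(x,K)\<in>D1. measure lborel K *\<^sub>R f x) - (\<Sum>(x,K)\<in>D2. measure lborel K *\<^sub>R f x)) < e)"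
    if "e > 0" for e :: real
  proof -
    \<comment> \<open>A Riemann sum of \<open>f\<close> stays within \<open>3 * e1\<close> of
      \<open>integral {a..b} g\<close>: \<open>2 * e1\<close> for the Riemann sum of
      \<open>\<phi>\<close>, which exceeds its small integral by less than \<open>e1\<close>, and
      \<open>e1\<close> for the sum of \<open>g\<close>. Two divisions are compared, hence the
      6.\<close>
    define e1 where "e1 = e / 6"
    have e1: "e1 > 0" using that by (simp add: e1_def)
    obtain g \<phi> where g: "g integrable_on {a..b}" and p: "\<phi> integrable_on {a..b}"
      and less: "integral {a..b} \<phi> < e1"
      and le: "\<And>x. x\<in>{a..b} \<Longrightarrow> norm (f x - g x) \<le> \<phi> x"
      using approx[OF e1] by blast
    obtain \<gamma>1 where \<gamma>1: "gauge \<gamma>1" "\<And>D. D tagged_division_of {a..b} \<Longrightarrow> \<gamma>1 fine D \<Longrightarrow>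
        norm ((\<Sum>(x,K)\<in>D. measure lborel K *\<^sub>R g x) - integral {a..b} g) < e1"
      using integrable_integral[OF g] e1 unfolding has_integral_real by meson
    obtain \<gamma>2 where \<gamma>2: "gauge \<gamma>2" "\<And>D. D tagged_division_of {a..b} \<Longrightarrow> \<gamma>2 fine D \<Longrightarrow>
        norm ((\<Sum>(x,K)\<in>D. measure lborel K *\<^sub>R \<phi> x) - integral {a..b} \<phi>) < e1"
      using integrable_integral[OF p] e1 unfolding has_integral_real by meson
    have near: "norm ((\<Sum>(x,K)\<in>D. measure lborel K *\<^sub>R f x) - integral {a..b} g) < 3 * e1"
      if D: "D tagged_division_of {a..b}" and fine: "\<gamma>1 fine D" "\<gamma>2 fine D" for D
    proof -
      have "norm ((\<Sum>(x,K)\<in>D. measure lborel K *\<^sub>R f x) - (\<Sum>(x,K)\<in>D. measure lborel K *\<^sub>R g x))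
          = norm (\<Sum>(x,K)\<in>D. measure lborel K *\<^sub>R (f x - g x))"
        by (simp add: sum_subtractf[symmetric] scaleR_diff_right case_prod_unfold)
      also have "\<dots> \<le> (\<Sum>(x,K)\<in>D. measure lborel K *\<^sub>R \<phi> x)"
      proof (rule sum_norm_le)
        fix z assume z: "z \<in> D"
        obtain x K where [simp]: "z = (x, K)" by force
        have "x \<in> {a..b}" using tagged_division_ofD(2,3)[OF D] z by (metis \<open>z = (x, K)\<close> subsetD)
        then show "norm (case z of (x, K) \<Rightarrow> measure lborel K *\<^sub>R (f x - g x)) \<le>
           (case z of (x, K) \<Rightarrow> measure lborel K *\<^sub>R \<phi> x)"
          using le by (simp add: mult_left_mono)
      qed
      also have "\<dots> < 2 * e1" using \<gamma>2(2)[OF D fine(2)] less by (auto simp: abs_if split: if_splits)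
      finally have 1: "norm ((\<Sum>(x,K)\<in>D. measure lborel K *\<^sub>R f x) - (\<Sum>(x,K)\<in>D. measure lborel K *\<^sub>R g x)) < 2 * e1" .
      show ?thesis
        using norm_triangle_ineq[of "(\<Sum>(x,K)\<in>D. measure lborel K *\<^sub>R f x) - (\<Sum>(x,K)\<in>D. measure lborel K *\<^sub>R g x)"
            "(\<Sum>(x,K)\<in>D. measure lborel K *\<^sub>R g x) - integral {a..b} g"] 1 \<gamma>1(2)[OF D fine(1)]
        by simp
    qed
    have "norm ((\<Sum>(x,K)\<in>D1. measure lborel K *\<^sub>R f x) - (\<Sum>(x,K)\<in>D2. measure lborel K *\<^sub>R f x)) < e"
      if "D1 tagged_division_of cbox a b \<and> (\<lambda>x. \<gamma>1 x \<inter> \<gamma>2 x) fine D1 \<and>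
         D2 tagged_division_of cbox a b \<and> (\<lambda>x. \<gamma>1 x \<inter> \<gamma>2 x) fine D2" for D1 D2
      using near[of D1] near[of D2] that e1_def
        norm_triangle_ineq4[of "(\<Sum>(x,K)\<in>D1. measure lborel K *\<^sub>R f x) - integral {a..b} g"
          "(\<Sum>(x,K)\<in>D2. measure lborel K *\<^sub>R f x) - integral {a..b} g"]
      by (simp add: fine_Int)
    moreover have "gauge (\<lambda>x. \<gamma>1 x \<inter> \<gamma>2 x)" using \<gamma>1(1) \<gamma>2(1) by (rule gauge_Int)
    ultimately show ?thesis by blast
  qed
  then show ?thesis using integrable_Cauchy[of f a b] by simp
qed

text \<open>On compact subintervals continuity suffices. What is cut off near the endpoints is
  dominated by \<open>h\<close>, whose integral over the cut-off part tends to 0 by scalar dominated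
  convergence. This is the integrability test for all singular vector-valued integrands
  below.\<close>

lemma dominated_continuous_integrable:
  fixes f :: "real \<Rightarrow> 'a::banach"
  assumes cont: "continuous_on {a<..<b} f"
    and bd: "\<And>t. t \<in> {a<..<b} \<Longrightarrow> norm (f t) \<le> h t"
    and h: "h integrable_on {a..b}"
  shows "f integrable_on {a..b}"
proof (cases "a < b")
  case False
  then have "measure lborel (cbox a b) = 0" by simp
  then have "f integrable_on cbox a b" by (rule integrable_on_null)
  then show ?thesis by simp
next
  case True
  \<comment> \<open>Nothing is known about \<open>f\<close> at the endpoints, so \<open>f\<close>
    and its majorant are set to 0 there, which leaves the integrals unchanged.\<close>
  define f' where "f' t = (if t \<in> {a<..<b} then f t else 0)" for t
  define h' where "h' t = (if t \<in> {a<..<b} then h t else 0)" for t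
  have h': "h' integrable_on {a..b}"
    using h unfolding h'_def integrable_restrict_Int
    by (simp add: integrable_on_Icc_iff_Ioo Int_absorb2 greaterThanLessThan_subseteq_atLeastAtMost_iff)
  have h'0: "h' t \<ge> 0" for t using order_trans[OF norm_ge_zero bd[of t]] by (auto simp: h'_def)
  \<comment> \<open>The offset 3 keeps each margin at most a third of the interval, so that no
    \<open>K n\<close> is empty.\<close>
  define K where "K n = {a + (b - a) / real (n + 3) .. b - (b - a) / real (n + 3)}" for n
  define \<phi> where "\<phi> n t = (if t \<in> K n then 0 else h' t)" for n t
  have Ksub: "K n \<subseteq> {a<..<b}" for n
  proof -
    have "(b - a) / real (n + 3) > 0" using True by simp
    then show ?thesis by (auto simp: K_def)
  qed
  have \<phi>int: "\<phi> n integrable_on {a..b}" for n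
  proof -
    have "h' integrable_on K n" unfolding K_def
      by (rule integrable_on_subinterval[OF h'])
        (use Ksub[of n] in \<open>unfold K_def, meson greaterThanLessThan_subseteq_atLeastAtMost_iff order.refl subset_trans\<close>)
    then have "(\<lambda>t. if t \<in> K n then h' t else 0) integrable_on {a..b}"
      unfolding integrable_restrict_Int using Ksub[of n]
      by (metis Int_absorb2 greaterThanLessThan_subseteq_atLeastAtMost_iff order.refl subset_trans)
    from integrable_diff[OF h' this] show ?thesis
      by (rule integrable_eq) (auto simp: \<phi>_def)
  qed
  have lim: "(\<lambda>n. integral {a..b} (\<phi> n)) \<longlonglongrightarrow> integral {a..b} (\<lambda>t. 0)"
  proof (rule dominated_convergence(2)[OF \<phi>int h'])
    show "norm (\<phi> n t) \<le> h' t" for n t using h'0[of t] by (simp add: \<phi>_def)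
    show "(\<lambda>n. \<phi> n t) \<longlonglongrightarrow> 0" if "t \<in> {a..b}" for t
    proof (cases "t \<in> {a<..<b}")
      case False
      then have "\<phi> n t = 0" for n by (simp only: \<phi>_def h'_def if_False if_cancel)
      then show ?thesis by simp
    next
      case tin: True
      have "(\<lambda>n. (b - a) / real (n + 3)) \<longlonglongrightarrow> 0"
        using LIMSEQ_ignore_initial_segment[OF lim_const_over_n[of "b - a"], of 3] by simp
      then have "\<forall>\<^sub>F n in sequentially. (b - a) / real (n + 3) < min (t - a) (b - t)"
        by (rule order_tendstoD) (use tin in auto)
      then have "\<forall>\<^sub>F n in sequentially. \<phi> n t = 0"
        by eventually_elim (auto simp: \<phi>_def K_def)
      then show ?thesis by (rule tendsto_eventually)
    qed
  qed
  have "f' integrable_on {a..b}"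
  proof (rule integrable_L1_approx)
    fix e :: real assume "e > 0"
    with lim have "\<forall>\<^sub>F n in sequentially. integral {a..b} (\<phi> n) < e"
      by (intro order_tendstoD(2)[OF lim]) simp
    then obtain n where n: "integral {a..b} (\<phi> n) < e"
      unfolding eventually_sequentially by blast
    define gg where "gg t = (if t \<in> K n then f' t else 0)" for t
    have "continuous_on (K n) f'"
      using continuous_on_subset[OF cont Ksub[of n]] Ksub[of n]
      by (auto simp: f'_def subset_iff intro: continuous_on_eq)
    then have "f' integrable_on K n" unfolding K_def by (rule integrable_continuous_interval)
    then have "gg integrable_on {a..b}"
      unfolding gg_def integrable_restrict_Int using Ksub[of n]
      by (metis Int_absorb2 greaterThanLessThan_subseteq_atLeastAtMost_iff order.refl subset_trans)
    moreover have "norm (f' t - gg t) \<le> \<phi> n t" for t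
      using bd[of t] Ksub[of n] by (auto simp: f'_def gg_def \<phi>_def h'_def)
    ultimately show "\<exists>g \<phi>. g integrable_on {a..b} \<and> \<phi> integrable_on {a..b} \<and>
        integral {a..b} \<phi> < e \<and> (\<forall>x\<in>{a..b}. norm (f' x - g x) \<le> \<phi> x)"
      using \<phi>int[of n] n by blast
  qed
  then show ?thesis
    using integrable_spike_interior[of a b f f'] by (simp add: f'_def)
qed

lemma dominated_continuous_norm_integrable:
  fixes f :: "real \<Rightarrow> 'a::banach"
  assumes cont: "continuous_on {a<..<b} f"
    and bd: "\<And>t. t \<in> {a<..<b} \<Longrightarrow> norm (f t) \<le> h t"
    and h: "h integrable_on {a..b}"
  shows "(\<lambda>t. norm (f t)) integrable_on {a..b}"
  by (rule dominated_continuous_integrable[where h = h])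
    (use assms continuous_on_norm in auto)

lemma norm_integral_le_interior:
  fixes f :: "real \<Rightarrow> 'a::banach"
  assumes f: "f integrable_on {a..b}" and h: "h integrable_on {a..b}"
    and bd: "\<And>t. t \<in> {a<..<b} \<Longrightarrow> norm (f t) \<le> h t"
  shows "norm (integral {a..b} f) \<le> integral {a..b} h"
  using f h bd unfolding integrable_on_Icc_iff_Ioo integral_open_interval_real
  by (rule integral_norm_bound_integral)

text \<open>The real functions \<open>norm (f k t - l t)\<close> are bounded by
  \<open>2 * h t\<close>, so scalar dominated convergence sends their integrals to 0. Continuity of
  \<open>l\<close> on the open interval provides the integrability of the limit and of the
  differences.\<close>

lemma dominated_convergence_vec:
  fixes f :: "nat \<Rightarrow> real \<Rightarrow> 'a::banach"
  assumes f: "\<And>k. continuous_on {a<..<b} (f k)" and l: "continuous_on {a<..<b} l"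
    and bd: "\<And>k t. t \<in> {a<..<b} \<Longrightarrow> norm (f k t) \<le> h t"
    and h: "h integrable_on {a..b}"
    and lim: "\<And>t. t \<in> {a<..<b} \<Longrightarrow> (\<lambda>k. f k t) \<longlonglongrightarrow> l t"
  shows "(\<lambda>k. integral {a..b} (f k)) \<longlonglongrightarrow> integral {a..b} l"
proof -
  have bdl: "norm (l t) \<le> h t" if "t \<in> {a<..<b}" for t
    using tendsto_norm[OF lim[OF that]] bd[OF that] by (intro LIMSEQ_le_const2) auto
  have intf: "f k integrable_on {a..b}" for k
    by (rule dominated_continuous_integrable[OF f bd h])
  have intl: "l integrable_on {a..b}"
    by (rule dominated_continuous_integrable[OF l bdl h])
  have bdd: "norm (f k t - l t) \<le> 2 * h t" if "t \<in> {a<..<b}" for k t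
    using norm_triangle_ineq4[of "f k t" "l t"] bd[OF that, of k] bdl[OF that] by linarith
  have h2: "(\<lambda>t. 2 * h t) integrable_on {a..b}" using h by (rule integrable_on_mult_right)
  have intd: "(\<lambda>t. norm (f k t - l t)) integrable_on {a..b}" for k
    by (rule dominated_continuous_norm_integrable[OF _ bdd h2]) (intro continuous_on_diff f l)
  have "(\<lambda>k. integral {a<..<b} (\<lambda>t. norm (f k t - l t))) \<longlonglongrightarrow> integral {a<..<b} (\<lambda>t. 0)"
  proof (rule dominated_convergence(2))
    show "(\<lambda>t. norm (f k t - l t)) integrable_on {a<..<b}" for k
      using intd by (simp add: integrable_on_Icc_iff_Ioo)
    show "(\<lambda>t. 2 * h t) integrable_on {a<..<b}" using h2 by (simp add: integrable_on_Icc_iff_Ioo)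
    show "norm (norm (f k t - l t)) \<le> 2 * h t" if "t \<in> {a<..<b}" for k t
      using bdd[OF that] by simp
    show "(\<lambda>k. norm (f k t - l t)) \<longlonglongrightarrow> 0" if "t \<in> {a<..<b}" for t
      using tendsto_norm_zero[OF LIM_zero[OF lim[OF that]]] .
  qed
  then have "(\<lambda>k. integral {a..b} (\<lambda>t. norm (f k t - l t))) \<longlonglongrightarrow> 0"
    by (simp add: integral_open_interval_real)
  then have "(\<lambda>k. integral {a..b} (f k) - integral {a..b} l) \<longlonglongrightarrow> 0"
  proof (rule Lim_null_comparison[rotated], intro always_eventually allI)
    fix k
    have "norm (integral {a..b} (\<lambda>t. f k t - l t)) \<le> integral {a..b} (\<lambda>t. norm (f k t - l t))"
      by (rule integral_norm_bound_integral[OF integrable_diff[OF intf intl] intd]) simp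
    then show "norm (integral {a..b} (f k) - integral {a..b} l)
        \<le> integral {a..b} (\<lambda>t. norm (f k t - l t))"
      by (simp add: integral_diff[OF intf intl])
  qed
  then show ?thesis by (rule LIM_zero_cancel)
qed

lemma tendsto_integral_dominated:
  fixes f :: "'c::first_countable_topology \<Rightarrow> real \<Rightarrow> 'a::banach"
  assumes f: "\<And>z. z \<in> S \<Longrightarrow> continuous_on {a<..<b} (f z)" and l: "continuous_on {a<..<b} l"
    and bd: "\<And>z t. z \<in> S \<Longrightarrow> t \<in> {a<..<b} \<Longrightarrow> norm (f z t) \<le> h t"
    and h: "h integrable_on {a..b}"
    and lim: "\<And>t. t \<in> {a<..<b} \<Longrightarrow> ((\<lambda>z. f z t) \<longlongrightarrow> l t) (at z0 within S)"
  shows "((\<lambda>z. integral {a..b} (f z)) \<longlongrightarrow> integral {a..b} l) (at z0 within S)"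
  unfolding tendsto_at_iff_sequentially o_def
proof (intro allI impI)
  fix X :: "nat \<Rightarrow> 'c" assume X: "\<forall>i. X i \<in> S - {z0}" "X \<longlonglongrightarrow> z0"
  show "(\<lambda>k. integral {a..b} (f (X k))) \<longlonglongrightarrow> integral {a..b} l"
  proof (rule dominated_convergence_vec[OF _ l _ h])
    show "continuous_on {a<..<b} (f (X k))" for k using f X by auto
    show "norm (f (X k) t) \<le> h t" if "t \<in> {a<..<b}" for k t using bd that X by auto
    show "(\<lambda>k. f (X k) t) \<longlonglongrightarrow> l t" if "t \<in> {a<..<b}" for t
      using lim[OF that] X unfolding tendsto_at_iff_sequentially o_def by blast
  qed
qed

lemma continuous_on_integral_dominated:
  fixes f :: "'c::first_countable_topology \<Rightarrow> real \<Rightarrow> 'a::banach"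
  assumes f: "\<And>z. z \<in> S \<Longrightarrow> continuous_on {a<..<b} (f z)"
    and bd: "\<And>z t. z \<in> S \<Longrightarrow> t \<in> {a<..<b} \<Longrightarrow> norm (f z t) \<le> h t"
    and h: "h integrable_on {a..b}"
    and cont: "\<And>t. t \<in> {a<..<b} \<Longrightarrow> continuous_on S (\<lambda>z. f z t)"
  shows "continuous_on S (\<lambda>z. integral {a..b} (f z))"
  unfolding continuous_on_def
proof
  fix z0 assume z0: "z0 \<in> S"
  show "((\<lambda>z. integral {a..b} (f z)) \<longlongrightarrow> integral {a..b} (f z0)) (at z0 within S)"
    by (rule tendsto_integral_dominated[OF f f bd h])
      (use cont z0 in \<open>auto simp: continuous_on_def\<close>)
qed

section \<open>Closed operators under the integral sign\<close>

lemma has_integral_in_closed_subspace: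
  fixes f :: "real \<Rightarrow> 'a::real_normed_vector"
  assumes f: "(f has_integral I) {a..b}" and V: "closed V" "subspace V"
    and in_V: "\<And>t. t \<in> {a..b} \<Longrightarrow> f t \<in> V"
  shows "I \<in> V"
proof -
  have "\<exists>y\<in>V. dist y I < e" if "e > 0" for e
  proof -
    obtain \<gamma> where \<gamma>: "gauge \<gamma>" "\<And>D. D tagged_division_of {a..b} \<Longrightarrow> \<gamma> fine D \<Longrightarrow>
        norm ((\<Sum>(x,K)\<in>D. measure lborel K *\<^sub>R f x) - I) < e"
      using f \<open>e > 0\<close> unfolding has_integral_real by meson
    obtain D where D: "D tagged_division_of {a..b}" "\<gamma> fine D"
      using fine_division_exists_real[OF \<gamma>(1)] by blast
    have "(\<Sum>(x,K)\<in>D. measure lborel K *\<^sub>R f x) \<in> V"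
    proof (rule subspace_sum[OF V(2)])
      fix z assume z: "z \<in> D"
      obtain x K where zz: "z = (x, K)" by force
      have "x \<in> {a..b}" using tagged_division_ofD(2,3)[OF D(1)] z by (metis zz subsetD)
      then show "(case z of (x, K) \<Rightarrow> measure lborel K *\<^sub>R f x) \<in> V"
        using in_V subspace_scale[OF V(2)] by (simp add: zz)
    qed
    then show ?thesis using \<gamma>(2)[OF D] by (auto simp: dist_norm)
  qed
  then show ?thesis using V(1) closure_approachable[of I V] by simp
qed

lemma bounded_linear_scaleC: "bounded_linear ((*\<^sub>C) c :: 'a::complex_banach \<Rightarrow> 'a)"
proof (rule bounded_linear_intro)
  fix r :: real and x :: 'a
  show "c *\<^sub>C r *\<^sub>R x = r *\<^sub>R c *\<^sub>C x"
    by (metis scaleC_of_real scaleC_scaleC mult.commute)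
  show "norm (c *\<^sub>C x) \<le> norm x * cmod c" by (simp add: norm_scaleC)
qed (rule scaleC_add_right)

lemma closed_operatorD:
  assumes "closed_operator D A"
  shows "0 \<in> D" "A 0 = 0"
    and "\<And>x y. x \<in> D \<Longrightarrow> y \<in> D \<Longrightarrow> x + y \<in> D"
      "\<And>x y. x \<in> D \<Longrightarrow> y \<in> D \<Longrightarrow> A (x + y) = A x + A y"
    and "\<And>x r. x \<in> D \<Longrightarrow> r *\<^sub>R x \<in> D"
      "\<And>x r. x \<in> D \<Longrightarrow> A (r *\<^sub>R x) = r *\<^sub>R A x"
    and "closed ((\<lambda>x. (x, A x)) ` D)"
proof -
  show 0: "0 \<in> D" and add: "\<And>x y. x \<in> D \<Longrightarrow> y \<in> D \<Longrightarrow> x + y \<in> D"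
    "\<And>x y. x \<in> D \<Longrightarrow> y \<in> D \<Longrightarrow> A (x + y) = A x + A y"
    and "closed ((\<lambda>x. (x, A x)) ` D)"
    using assms by (auto simp: closed_operator_def)
  show "A 0 = 0" using add(2)[OF 0 0] by simp
  show "\<And>x r. x \<in> D \<Longrightarrow> r *\<^sub>R x \<in> D" "\<And>x r. x \<in> D \<Longrightarrow> A (r *\<^sub>R x) = r *\<^sub>R A x"
    using assms by (auto simp: closed_operator_def scaleC_of_real[symmetric])
qed

text \<open>Hille's theorem: the graph of \<open>A\<close> is a closed subspace, so it contains the
  integral of the pair \<open>(u t, v t)\<close>, whose components are the two integrals in
  question.\<close>

lemma closed_operator_integral:
  fixes u v :: "real \<Rightarrow> 'a::complex_banach"
  assumes A: "closed_operator D A"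
    and u: "u integrable_on {a..b}" and Au: "v integrable_on {a..b}"
    and D: "\<And>t. t \<in> {a<..<b} \<Longrightarrow> u t \<in> D" "\<And>t. t \<in> {a<..<b} \<Longrightarrow> A (u t) = v t"
  shows "integral {a..b} u \<in> D" "A (integral {a..b} u) = integral {a..b} v"
proof -
  let ?G = "(\<lambda>x. (x, A x)) ` D"
  note cl = closed_operatorD[OF A]
  have sub: "subspace ?G"
    unfolding subspace_def
  proof (intro conjI ballI allI)
    show "0 \<in> ?G" using cl(1,2) by (auto simp: zero_prod_def image_iff)
    show "p + q \<in> ?G" if "p \<in> ?G" "q \<in> ?G" for p q
      using that cl(3,4) by (auto simp: image_iff)
    show "c *\<^sub>R p \<in> ?G" if "p \<in> ?G" for c p
      using that cl(5,6) by (auto simp: image_iff)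
  qed
  have "((\<lambda>t. (u t, 0) + (0, v t)) has_integral
      (integral {a..b} u, 0) + (0, integral {a..b} v)) {a..b}"
    using has_integral_linear[OF integrable_integral[OF u], of "\<lambda>x. (x, 0)"]
      has_integral_linear[OF integrable_integral[OF Au], of "\<lambda>x. (0, x)"]
    by (intro has_integral_add) (auto simp: o_def bounded_linear_Pair bounded_linear_zero bounded_linear_ident)
  then have "((\<lambda>t. (u t, v t)) has_integral (integral {a..b} u, integral {a..b} v)) {a..b}"
    by simp
  \<comment> \<open>Only interior points are known to give pairs in the graph. The endpoint values
    are replaced by 0, which does not change the integral and lies in the graph.\<close>
  then have "((\<lambda>t. if t \<in> {a<..<b} then (u t, v t) else 0) has_integral
      (integral {a..b} u, integral {a..b} v)) {a..b}"
  proof (rule has_integral_spike_finite[rotated 2, of _ _ _ "{a, b}"])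
    fix t assume "t \<in> {a..b} - {a, b}"
    then have "a < t" "t < b" by auto
    then show "(if t \<in> {a<..<b} then (u t, v t) else 0) = (u t, v t)" by simp
  qed simp
  then have "(integral {a..b} u, integral {a..b} v) \<in> ?G"
    by (rule has_integral_in_closed_subspace[OF _ cl(7) sub])
      (use D cl(1,2) in \<open>auto simp: zero_prod_def image_iff\<close>)
  then show "integral {a..b} u \<in> D" "A (integral {a..b} u) = integral {a..b} v" by auto
qed

section \<open>The uniform boundedness principle\<close>

lemma uniform_boundedness:
  fixes T :: "'i \<Rightarrow> 'a::banach \<Rightarrow> 'b::real_normed_vector"
  assumes lin: "\<And>i. i \<in> I \<Longrightarrow> bounded_linear (T i)"
    and bd: "\<And>x. \<exists>c. \<forall>i\<in>I. norm (T i x) \<le> c"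
  obtains M where "M \<ge> 0" "\<And>i x. i \<in> I \<Longrightarrow> norm (T i x) \<le> M * norm x"
proof -
  define E where "E n = {x. \<forall>i\<in>I. norm (T i x) \<le> real n}" for n
  have closed: "closed (E n)" for n
  proof -
    have "E n = (\<Inter>i\<in>I. {x. norm (T i x) \<le> real n})" by (auto simp: E_def)
    moreover have "closed {x. norm (T i x) \<le> real n}" if "i \<in> I" for i
      by (intro closed_Collect_le continuous_on_norm continuous_on_const
          linear_continuous_on lin that)
    ultimately show ?thesis by auto
  qed
  have "x \<in> (\<Union>n. E n)" for x
  proof -
    obtain c where c: "\<forall>i\<in>I. norm (T i x) \<le> c" using bd by blast
    obtain n where "c \<le> real n" using real_arch_simple by blast
    with c show ?thesis unfolding E_def by (blast intro: order_trans)
  qed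
  then have U: "(\<Union>n. E n) = UNIV" by blast
  have "\<exists>n. interior (E n) \<noteq> {}"
  proof (rule ccontr)
    assume "\<not> ?thesis"
    then have int: "interior (E n) = {}" for n by blast
    have "euclidean interior_of \<Union>(range E) = {}"
    proof (rule Baire_category_alt)
      show "completely_metrizable_space (euclidean :: 'a topology) \<or>
          locally_compact_space (euclidean :: 'a topology) \<and> regular_space (euclidean :: 'a topology)"
        by (rule disjI1) (rule completely_metrizable_space_euclidean)
      show "countable (range E)" by simp
      show "closedin euclidean S \<and> euclidean interior_of S = {}" if "S \<in> range E" for S
        using that closed int by fastforce
    qed
    then show False unfolding U by simp
  qed
  then obtain n x0 where "x0 \<in> interior (E n)" by blast
  then obtain r where r: "r > 0" "cball x0 r \<subseteq> E n"
    by (meson mem_interior_cball)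
  \<comment> \<open>The ball of radius \<open>r\<close> around \<open>x0\<close> lies in
    \<open>E n\<close>. For \<open>norm y = r\<close> the difference of \<open>T i (x0 + y)\<close>
    and \<open>T i x0\<close> gives \<open>norm (T i y) \<le> 2 * n\<close>; homogeneity turns this
    into the stated constant.\<close>
  have "norm (T i x) \<le> (2 * real n / r) * norm x" if i: "i \<in> I" for i x
  proof (cases "x = 0")
    case True
    then show ?thesis using linear_0[OF bounded_linear.linear[OF lin[OF i]]] by simp
  next
    case False
    interpret bounded_linear "T i" by (rule lin[OF i])
    let ?y = "(r / norm x) *\<^sub>R x"
    have "norm ?y = r" using False r by simp
    then have "x0 + ?y \<in> E n" "x0 \<in> E n" using r by (auto simp: dist_norm subset_iff)
    then have "norm (T i (x0 + ?y)) \<le> n" "norm (T i x0) \<le> n" using i by (auto simp: E_def)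
    then have "norm (T i ?y) \<le> 2 * n"
      using norm_triangle_ineq4[of "T i (x0 + ?y)" "T i x0"] by (simp add: add)
    then have "(r / norm x) * norm (T i x) \<le> 2 * n" using r by (simp add: scaleR)
    then show ?thesis using False r by (simp add: field_simps)
  qed
  moreover have "2 * real n / r \<ge> 0" using r by simp
  ultimately show ?thesis using that by blast
qed

section \<open>Exchanging the order of integration\<close>

text \<open>The library exchanges Banach-valued gauge integrals only for integrands that are continuous on
  a closed rectangle. Cutting an integrand off near the boundary of an open region reduces the
  singular case to that one.\<close>

lemma open_cutoffs:
  fixes \<Omega> :: "'a::metric_space set"
  assumes \<Omega>: "open \<Omega>" "\<Omega> \<noteq> UNIV"
  obtains \<eta> :: "nat \<Rightarrow> 'a \<Rightarrow> real" where
    "\<And>k z. 0 \<le> \<eta> k z" "\<And>k z. \<eta> k z \<le> 1"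
    "\<And>z. z \<in> \<Omega> \<Longrightarrow> (\<lambda>k. \<eta> k z) \<longlonglongrightarrow> 1"
    "\<And>(F :: 'a \<Rightarrow> 'b::real_normed_vector) k. continuous_on \<Omega> F \<Longrightarrow>
       continuous_on UNIV (\<lambda>z. if z \<in> \<Omega> then \<eta> k z *\<^sub>R F z else 0)"
proof -
  define d where "d z = infdist z (- \<Omega>)" for z
  \<comment> \<open>For \<open>k > 0\<close> this is 0 where \<open>d z \<le> 1 / k\<close> and 1
    where \<open>d z \<ge> 2 / k\<close>. The layer along the boundary on which it vanishes absorbs
    any blow-up of \<open>F\<close>.\<close>
  define \<eta> where "\<eta> k z = max 0 (min 1 (real k * d z - 1))" for k z
  have contd: "continuous_on S d" for S
    unfolding d_def by (intro continuous_on_infdist continuous_on_id)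
  have cont\<eta>: "continuous_on S (\<eta> k)" for S k
    unfolding \<eta>_def by (intro continuous_intros contd)
  \<comment> \<open>The distance to the empty set is 0 by convention, which is why
    \<open>\<Omega>\<close> must not be the whole space.\<close>
  have pos: "d z > 0" if "z \<in> \<Omega>" for z
    unfolding d_def using \<Omega> that by (intro infdist_pos_not_in_closed) auto
  have zero: "d z = 0" if "z \<notin> \<Omega>" for z
    unfolding d_def using that by simp
  show ?thesis
  proof (rule that)
    show "0 \<le> \<eta> k z" "\<eta> k z \<le> 1" for k z by (auto simp: \<eta>_def)
    show "(\<lambda>k. \<eta> k z) \<longlonglongrightarrow> 1" if "z \<in> \<Omega>" for z
    proof (rule tendsto_eventually)
      obtain N :: nat where N: "2 / d z \<le> real N" using real_arch_simple by blast
      have "\<eta> k z = 1" if "k \<ge> N" for k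
      proof -
        have "2 / d z \<le> real k" using N that by linarith
        then have "2 \<le> real k * d z" using pos[OF \<open>z \<in> \<Omega>\<close>] by (simp add: field_simps)
        then show ?thesis by (simp add: \<eta>_def)
      qed
      then show "\<forall>\<^sub>F k in sequentially. \<eta> k z = 1" by (auto simp: eventually_sequentially)
    qed
    show "continuous_on UNIV (\<lambda>z. if z \<in> \<Omega> then \<eta> k z *\<^sub>R F z else 0)" (is "continuous_on UNIV ?G")
      if F: "continuous_on \<Omega> F" for F :: "'a \<Rightarrow> 'b" and k
    proof -
      \<comment> \<open>An open neighbourhood of the complement of \<open>\<Omega>\<close> on which
        the truncated function is 0. Continuity on two open sets that cover the space gives
        continuity everywhere.\<close>
      let ?U = "{z. real k * d z < 1}"
      have "continuous_on \<Omega> (\<lambda>z. \<eta> k z *\<^sub>R F z)" by (intro continuous_intros cont\<eta> F)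
      then have "continuous_on \<Omega> ?G" by (rule continuous_on_eq) simp
      moreover have "continuous_on ?U ?G"
        by (rule continuous_on_eq[OF continuous_on_const[of _ 0]]) (auto simp: \<eta>_def)
      moreover have "open ?U"
        by (intro open_Collect_less continuous_intros contd)
      ultimately have "continuous_on (\<Omega> \<union> ?U) ?G"
        using \<Omega>(1) by (intro continuous_on_open_Un)
      moreover have "\<Omega> \<union> ?U = UNIV" using zero by fastforce
      ultimately show ?thesis by simp
    qed
  qed
qed

text \<open>\<open>G k x\<close> vanishes outside the section \<open>(l x, u x)\<close>, so its
  integral over the side of the rectangle is the integral over the section. Dominated convergence is
  then used twice: inside with majorant \<open>h x\<close>, outside with \<open>h1\<close>, the
  integral of that majorant. The outer use asks for a continuous limit, hence the hypothesis
  \<open>cont\<close>.\<close>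

lemma integral_open_sections_limit:
  fixes F :: "real \<Rightarrow> real \<Rightarrow> 'a::banach" and G :: "nat \<Rightarrow> real \<Rightarrow> real \<Rightarrow> 'a"
  assumes \<Omega>: "\<And>x y. P x y \<Longrightarrow> a < x \<and> x < b \<and> c < y \<and> y < d"
    and sect: "\<And>x y. a < x \<Longrightarrow> x < b \<Longrightarrow> P x y \<longleftrightarrow> l x < y \<and> y < u x"
    and contF: "\<And>x. a < x \<Longrightarrow> x < b \<Longrightarrow> continuous_on {l x<..<u x} (F x)"
    and bd: "\<And>x y. P x y \<Longrightarrow> norm (F x y) \<le> h x y"
    and h: "\<And>x. a < x \<Longrightarrow> x < b \<Longrightarrow> (h x has_integral h1 x) {l x..u x}"
    and h1: "h1 integrable_on {a..b}"
    and cont: "continuous_on {a<..<b} (\<lambda>x. integral {l x..u x} (F x))"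
    and G: "\<And>k. continuous_on UNIV (\<lambda>(x, y). G k x y)"
    and G0: "\<And>k x y. \<not> P x y \<Longrightarrow> G k x y = 0"
    and GF: "\<And>k x y. P x y \<Longrightarrow> norm (G k x y) \<le> norm (F x y)"
    and lim: "\<And>x y. P x y \<Longrightarrow> (\<lambda>k. G k x y) \<longlonglongrightarrow> F x y"
  shows "(\<lambda>k. integral {a..b} (\<lambda>x. integral {c..d} (G k x)))
    \<longlonglongrightarrow> integral {a..b} (\<lambda>x. integral {l x..u x} (F x))"
proof -
  have Gx: "continuous_on S (G k x)" for S k x
    using continuous_on_compose2[OF G[of k], of S "\<lambda>y. (x, y)"]
    by (simp add: continuous_on_Pair)
  have inner: "integral {c..d} (G k x) = integral {l x..u x} (G k x)"
    if x: "a < x" "x < b" for k x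
  proof (cases "l x < u x")
    case True
    have "{l x<..<u x} \<subseteq> {c<..<d}"
    proof
      fix y assume "y \<in> {l x<..<u x}"
      then have "P x y" using sect[OF x] by simp
      then show "y \<in> {c<..<d}" using \<Omega> by simp
    qed
    then have sub: "c \<le> l x" "u x \<le> d"
      using True by (auto simp: greaterThanLessThan_subseteq_greaterThanLessThan)
    have "(G k x has_integral integral {l x..u x} (G k x)) {l x..u x}"
      by (intro integrable_integral integrable_continuous_interval Gx)
    then have "(G k x has_integral integral {l x..u x} (G k x)) {c..d}"
    proof (rule has_integral_on_superset)
      show "G k x y = 0" if "y \<notin> {l x..u x}" for y
        by (rule G0) (use that sect[OF x, of y] in auto)
      show "{l x..u x} \<subseteq> {c..d}" using sub by simp
    qed
    then show ?thesis by (rule integral_unique)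
  next
    case False
    have "G k x y = 0" for y by (rule G0) (use False sect[OF x, of y] in auto)
    then have "G k x = (\<lambda>_. 0)" by auto
    then show ?thesis by simp
  qed
  have Gbd: "norm (G k x y) \<le> h x y" if "P x y" for k x y
    using GF[OF that] bd[OF that] by (rule order_trans)
  show ?thesis
  proof (rule dominated_convergence_vec[OF _ cont _ h1])
    show "continuous_on {a<..<b} (\<lambda>x. integral {c..d} (G k x))" for k
    proof -
      have "continuous_on {a<..<b} (\<lambda>x. integral (cbox c d) (G k x))"
        by (rule integral_continuous_on_param) (rule continuous_on_subset[OF G], simp)
      then show ?thesis by simp
    qed
    show "norm (integral {c..d} (G k x)) \<le> h1 x" if "x \<in> {a<..<b}" for k x
    proof -
      have x: "a < x" "x < b" using that by auto
      have "norm (integral {l x..u x} (G k x)) \<le> integral {l x..u x} (h x)"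
      proof (rule norm_integral_le_interior)
        show "norm (G k x y) \<le> h x y" if "y \<in> {l x<..<u x}" for y
          by (rule Gbd) (use sect[OF x, of y] that in simp)
      qed (intro integrable_continuous_interval Gx has_integral_integrable[OF h[OF x]])+
      also have "\<dots> = h1 x" using h[OF x] by (rule integral_unique)
      finally show ?thesis by (simp add: inner x)
    qed
    show "(\<lambda>k. integral {c..d} (G k x)) \<longlonglongrightarrow> integral {l x..u x} (F x)" if "x \<in> {a<..<b}" for x
    proof -
      have x: "a < x" "x < b" using that by auto
      show ?thesis unfolding inner[OF x]
      proof (rule dominated_convergence_vec)
        fix y assume "y \<in> {l x<..<u x}"
        then have "P x y" using sect[OF x, of y] by simp
        then show "(\<lambda>k. G k x y) \<longlonglongrightarrow> F x y" "norm (G k x y) \<le> h x y" for k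
          by (rule lim Gbd)+
      qed (intro Gx contF x has_integral_integrable[OF h[OF x]])+
    qed
  qed
qed

text \<open>Both iterated integrals are limits of those of the same truncations \<open>G k\<close>,
  which are continuous on the closed rectangle and can be exchanged there. The section bounds may
  vary, so that the lemma serves the triangle of a double convolution as well as a
  rectangle.\<close>

lemma integral_swap_open:
  fixes F :: "real \<Rightarrow> real \<Rightarrow> 'a::banach"
  assumes P: "\<And>x y. P x y \<Longrightarrow> a < x \<and> x < b \<and> c < y \<and> y < d"
    and openP: "open {(x, y). P x y}"
    and sect1: "\<And>x y. a < x \<Longrightarrow> x < b \<Longrightarrow> P x y \<longleftrightarrow> l1 x < y \<and> y < u1 x"
    and sect2: "\<And>x y. c < y \<Longrightarrow> y < d \<Longrightarrow> P x y \<longleftrightarrow> l2 y < x \<and> x < u2 y"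
    and contF: "continuous_on {(x, y). P x y} (\<lambda>(x, y). F x y)"
    and bd: "\<And>x y. P x y \<Longrightarrow> norm (F x y) \<le> h x y"
    and h1: "\<And>x. a < x \<Longrightarrow> x < b \<Longrightarrow> (h x has_integral h1 x) {l1 x..u1 x}"
    and h1i: "h1 integrable_on {a..b}"
    and h2: "\<And>y. c < y \<Longrightarrow> y < d \<Longrightarrow> ((\<lambda>x. h x y) has_integral h2 y) {l2 y..u2 y}"
    and h2i: "h2 integrable_on {c..d}"
    and cont1: "continuous_on {a<..<b} (\<lambda>x. integral {l1 x..u1 x} (F x))"
    and cont2: "continuous_on {c<..<d} (\<lambda>y. integral {l2 y..u2 y} (\<lambda>x. F x y))"
  shows "integral {a..b} (\<lambda>x. integral {l1 x..u1 x} (F x))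
    = integral {c..d} (\<lambda>y. integral {l2 y..u2 y} (\<lambda>x. F x y))"
proof -
  let ?\<Omega> = "{(x, y). P x y}"
  have "(a, c) \<notin> ?\<Omega>" using P by blast
  then have "?\<Omega> \<noteq> UNIV" by blast
  then obtain \<eta> :: "nat \<Rightarrow> real \<times> real \<Rightarrow> real" where \<eta>: "\<And>k z. 0 \<le> \<eta> k z" "\<And>k z. \<eta> k z \<le> 1"
    "\<And>z. z \<in> ?\<Omega> \<Longrightarrow> (\<lambda>k. \<eta> k z) \<longlonglongrightarrow> 1"
    "\<And>(F :: real \<times> real \<Rightarrow> 'a) k. continuous_on ?\<Omega> F \<Longrightarrow>
       continuous_on UNIV (\<lambda>z. if z \<in> ?\<Omega> then \<eta> k z *\<^sub>R F z else 0)"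
    using open_cutoffs[OF openP, where 'b = 'a] by blast
  define G where "G k x y = (if P x y then \<eta> k (x, y) *\<^sub>R F x y else 0)" for k x y
  have G: "continuous_on UNIV (\<lambda>(x, y). G k x y)" for k
    using \<eta>(4)[OF contF, of k] by (rule continuous_on_eq) (auto simp: G_def)
  then have G': "continuous_on UNIV (\<lambda>(y, x). G k x y)" for k
    using continuous_on_compose2[OF G[of k], of UNIV "\<lambda>(y, x). (x, y)"]
    by (simp add: case_prod_unfold continuous_on_Pair continuous_on_fst continuous_on_snd)
  have GF: "norm (G k x y) \<le> norm (F x y)" for k x y
    using \<eta>(1,2)[of k "(x, y)"] by (simp add: G_def mult_left_le_one_le)
  have lim: "(\<lambda>k. G k x y) \<longlonglongrightarrow> F x y" if "P x y" for x y
    using tendsto_scaleR[OF \<eta>(3)[of "(x, y)"] tendsto_const[of "F x y"]] that by (simp add: G_def)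
  have contx: "continuous_on {l1 x<..<u1 x} (F x)" if "a < x" "x < b" for x
  proof -
    have "continuous_on {l1 x<..<u1 x} (\<lambda>y. (\<lambda>(x, y). F x y) (x, y))"
    proof (rule continuous_on_compose2[OF contF])
      show "(\<lambda>y. (x, y)) ` {l1 x<..<u1 x} \<subseteq> ?\<Omega>" using sect1[OF that] by force
    qed (intro continuous_intros)
    then show ?thesis by simp
  qed
  have conty: "continuous_on {l2 y<..<u2 y} (\<lambda>x. F x y)" if "c < y" "y < d" for y
  proof -
    have "continuous_on {l2 y<..<u2 y} (\<lambda>x. (\<lambda>(x, y). F x y) (x, y))"
    proof (rule continuous_on_compose2[OF contF])
      show "(\<lambda>x. (x, y)) ` {l2 y<..<u2 y} \<subseteq> ?\<Omega>" using sect2[OF that] by force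
    qed (intro continuous_intros)
    then show ?thesis by simp
  qed
  have 1: "(\<lambda>k. integral {a..b} (\<lambda>x. integral {c..d} (G k x)))
    \<longlonglongrightarrow> integral {a..b} (\<lambda>x. integral {l1 x..u1 x} (F x))"
    by (rule integral_open_sections_limit[where P = P, OF P sect1 contx bd h1 h1i cont1 G _ GF lim])
      (simp_all add: G_def)
  have 2: "(\<lambda>k. integral {c..d} (\<lambda>y. integral {a..b} (\<lambda>x. G k x y)))
    \<longlonglongrightarrow> integral {c..d} (\<lambda>y. integral {l2 y..u2 y} (\<lambda>x. F x y))"
  proof (rule integral_open_sections_limit[where P = "\<lambda>y x. P x y", OF _ sect2 conty _ h2 h2i cont2 G'])
    show "c < y \<and> y < d \<and> a < x \<and> x < b" if "P x y" for x y using P[OF that] by simp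
    show "norm (F x y) \<le> h x y" if "P x y" for x y by (rule bd[OF that])
    show "norm (G k x y) \<le> norm (F x y)" for k x y by (rule GF)
    show "(\<lambda>k. G k x y) \<longlonglongrightarrow> F x y" if "P x y" for x y by (rule lim[OF that])
    show "G k x y = 0" if "\<not> P x y" for k x y using that by (simp add: G_def)
  qed
  have "integral {a..b} (\<lambda>x. integral {c..d} (G k x)) = integral {c..d} (\<lambda>y. integral {a..b} (\<lambda>x. G k x y))" for k
    using integral_swap_continuous[of a c b d "G k"] continuous_on_subset[OF G[of k]] by simp
  with 1 2 show ?thesis using LIMSEQ_unique by auto
qed

section \<open>Convolution of strongly continuous operator families\<close>

lemma has_integral_flip:
  fixes f :: "real \<Rightarrow> 'a::banach"
  shows "((\<lambda>r. f (t - r)) has_integral I) {0..t} \<longleftrightarrow> (f has_integral I) {0..t}"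
    using has_integral_reflect_real[where f = "\<lambda>r. f (t + r)" and a = "-t" and b = 0]
      has_integral_shift_Icc_real[of f t I "-t" 0] by (simp add: o_def)

text \<open>The two functions have the same gauge integral values, if any; so the sides agree even
  for a non-integrable \<open>f\<close>, where both take the default value.\<close>

lemma integral_flip:
  fixes f :: "real \<Rightarrow> 'a::banach"
  shows "integral {0..t} (\<lambda>r. f (t - r)) = integral {0..t} f"
  unfolding integral_def integrable_on_def has_integral_flip ..

lemma integral_shift:
  fixes f :: "real \<Rightarrow> 'a::banach"
  shows "integral {r..t} (\<lambda>s. f (s - r)) = integral {0..t - r} f"
proof -
  have "((\<lambda>s. f (s - r)) has_integral I) {r..t} \<longleftrightarrow> (f has_integral I) {0..t - r}" for I
    using has_integral_shift_Icc_real[of f "-r" I r t] by (simp add: o_def)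
  then show ?thesis unfolding integral_def integrable_on_def by simp
qed

lemma integral_scale:
  fixes f :: "real \<Rightarrow> 'a::banach"
  assumes "t > 0"
  shows "integral {0..t} f = t *\<^sub>R integral {0..1} (\<lambda>v. f (t * v))"
proof -
  have "(\<lambda>x. x / t) ` {0..t} = {0..1}" using assms by (simp add: image_divide_atLeastAtMost)
  then show ?thesis using integral_stretch_real[of t 0 t f] assms by simp
qed

text \<open>Euler's beta integral after the substitution r = t v. It supplies the integrable
  majorant for every convolution of families with singularities of order \<open>p\<close> and
  \<open>q\<close>.\<close>

lemma has_integral_powr_convolution:
  assumes "p > 0" "q > 0" "t \<ge> (0::real)"
  shows "((\<lambda>r. (t - r) powr (p - 1) * r powr (q - 1)) has_integral
    Beta p q * t powr (p + q - 1)) {0..t}"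
proof (cases "t = 0")
  case True then show ?thesis by (simp add: has_integral_refl)
next
  case False
  with assms have t: "t > 0" by simp
  let ?f = "\<lambda>v. v powr (q - 1) * (1 - v) powr (p - 1)"
  have im: "(\<lambda>x. x / (1 / t)) ` {0..1} = {0..t}"
    using t image_mult_atLeastAtMost[of t 0 1] by (simp add: mult.commute)
  have "((\<lambda>r. ?f ((1 / t) * r)) has_integral t *\<^sub>R Beta q p) {0..t}"
    using has_integral_stretch_real[OF has_integral_Beta_real[OF assms(2,1)], of "1 / t"] t
    unfolding im by simp
  then have "((\<lambda>r. t powr (p + q - 2) * ?f ((1 / t) * r)) has_integral
      t powr (p + q - 2) * (t *\<^sub>R Beta q p)) {0..t}"
    by (rule has_integral_mult_right)
  moreover have "t powr (p + q - 2) * (t *\<^sub>R Beta q p) = Beta p q * t powr (p + q - 1)"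
  proof -
    have "t powr (p + q - 2) * t = t powr (p + q - 1)" using t powr_add[of t "p + q - 2" 1] by simp
    then show ?thesis by (simp add: Beta_commute[of q p] mult_ac)
  qed
  moreover have "t powr (p + q - 2) * ?f ((1 / t) * r) = (t - r) powr (p - 1) * r powr (q - 1)"
    if r: "r \<in> {0..t}" for r
  proof -
    have 1: "1 - (1 / t) * r = (t - r) / t" using t by (simp add: field_simps)
    have 2: "t powr (p + q - 2) = t powr (p - 1) * t powr (q - 1)" by (simp add: powr_add[symmetric])
    show ?thesis unfolding 1 2 using r t by (simp add: powr_divide)
  qed
  ultimately show ?thesis by (metis (no_types, lifting) has_integral_cong)
qed

section \<open>Operator families with a power singularity at 0\<close>

text \<open>The exponent \<open>p\<close> measures the growth at 0 on the scale of the kernels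
  \<open>g p\<close>; it is the quantity that adds up under convolution. The constant is uniform in
  \<open>t\<close> and \<open>x\<close>, a bound that strong continuity on the half-open interval
  does not give by itself.\<close>

definition op_fam :: "real \<Rightarrow> real \<Rightarrow> (real \<Rightarrow> 'a::complex_banach \<Rightarrow> 'a) \<Rightarrow> bool"
  where "op_fam p T K \<longleftrightarrow>
    (\<forall>t\<in>{0<..T}. bounded_clinear (K t)) \<and>
    (\<forall>x. continuous_on {0<..T} (\<lambda>t. K t x)) \<and>
    (\<exists>M\<ge>0. \<forall>t\<in>{0<..T}. \<forall>x. norm (K t x) \<le> M * t powr (p - 1) * norm x)"

lemma op_famD:
  assumes "op_fam p T K"
  shows "\<And>t. 0 < t \<Longrightarrow> t \<le> T \<Longrightarrow> bounded_clinear (K t)"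
    and "\<And>t. 0 < t \<Longrightarrow> t \<le> T \<Longrightarrow> bounded_linear (K t)"
    and "\<And>t x c. 0 < t \<Longrightarrow> t \<le> T \<Longrightarrow> K t (c *\<^sub>C x) = c *\<^sub>C K t x"
    and "\<And>x. continuous_on {0<..T} (\<lambda>t. K t x)"
  using assms by (auto simp: op_fam_def bounded_clinear_def)

lemma op_fam_bound:
  assumes "op_fam p T K"
  obtains M where "M \<ge> 0" "\<And>t x. 0 < t \<Longrightarrow> t \<le> T \<Longrightarrow> norm (K t x) \<le> M * t powr (p - 1) * norm x"
  using assms by (auto simp: op_fam_def)

text \<open>The difference splits into \<open>K (s z) (u z - u z0)\<close>, small by the operator
  bound, and the variation of \<open>K (s z) (u z0)\<close>, small by strong continuity.\<close>

lemma continuous_on_op_fam: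
  fixes u :: "'z::topological_space \<Rightarrow> 'a::complex_banach"
  assumes K: "op_fam p T K" and s: "continuous_on Z s" "\<And>z. z \<in> Z \<Longrightarrow> 0 < s z \<and> s z \<le> T"
    and u: "continuous_on Z u"
  shows "continuous_on Z (\<lambda>z. K (s z) (u z))"
  unfolding continuous_on_def
proof
  fix z0 assume z0: "z0 \<in> Z"
  let ?F = "at z0 within Z"
  obtain M where M: "M \<ge> 0" "\<And>t x. 0 < t \<Longrightarrow> t \<le> T \<Longrightarrow> norm (K t x) \<le> M * t powr (p - 1) * norm x"
    using op_fam_bound[OF K] by blast
  have ev: "\<forall>\<^sub>F z in ?F. z \<in> Z" by (simp add: eventually_at_filter)
  have lin: "K (s z) (x - y) = K (s z) x - K (s z) y" if "z \<in> Z" for z x y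
    using op_famD(2)[OF K] s(2)[OF that] by (simp add: linear_diff bounded_linear.linear)
  have "((\<lambda>z. M * s z powr (p - 1) * norm (u z - u z0)) \<longlongrightarrow> M * s z0 powr (p - 1) * norm (u z0 - u z0)) ?F"
    using s u z0 by (intro tendsto_intros) (auto simp: continuous_on_def dest!: s(2))
  then have "((\<lambda>z. M * s z powr (p - 1) * norm (u z - u z0)) \<longlongrightarrow> 0) ?F" by simp
  then have "((\<lambda>z. K (s z) (u z - u z0)) \<longlongrightarrow> 0) ?F"
    by (rule Lim_null_comparison[rotated]) (use ev in \<open>eventually_elim, use M(2) s(2) in auto\<close>)
  moreover have "((\<lambda>z. K (s z) (u z0)) \<longlongrightarrow> K (s z0) (u z0)) ?F"
  proof -
    have "continuous_on Z (\<lambda>z. K (s z) (u z0))"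
      by (rule continuous_on_compose2[OF op_famD(4)[OF K] s(1)]) (use s(2) in auto)
    then show ?thesis using z0 by (auto simp: continuous_on_def)
  qed
  ultimately have "((\<lambda>z. K (s z) (u z - u z0) + K (s z) (u z0)) \<longlongrightarrow> 0 + K (s z0) (u z0)) ?F"
    by (rule tendsto_add)
  then show "((\<lambda>z. K (s z) (u z)) \<longlongrightarrow> K (s z0) (u z0)) ?F"
    unfolding add_0_left by (rule Lim_transform_eventually) (use ev in \<open>eventually_elim, use lin in simp\<close>)
qed

lemma op_fam_scalar:
  assumes "continuous_on {0<..T} k" "\<And>t. 0 < t \<Longrightarrow> t \<le> T \<Longrightarrow> \<bar>k t\<bar> \<le> M * t powr (p - 1)" "M \<ge> 0"
  shows "op_fam p T (\<lambda>t x. k t *\<^sub>R (x :: 'a::complex_banach))"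
  unfolding op_fam_def
proof (intro conjI ballI allI exI[of _ M])
  show "bounded_clinear (\<lambda>x::'a. k t *\<^sub>R x)" for t
    unfolding bounded_clinear_def
    by (intro conjI bounded_linear_scaleR_right allI)
      (simp add: scaleC_of_real[symmetric] scaleC_scaleC mult.commute)
  show "norm (k t *\<^sub>R x) \<le> M * t powr (p - 1) * norm x" if "t \<in> {0<..T}" for t and x :: 'a
    using assms(2)[of t] that by (simp add: mult_right_mono)
qed (use assms in \<open>auto intro!: continuous_intros\<close>)

definition op_conv :: "(real \<Rightarrow> 'a::complex_banach \<Rightarrow> 'a) \<Rightarrow> (real \<Rightarrow> 'a \<Rightarrow> 'a) \<Rightarrow> real \<Rightarrow> 'a \<Rightarrow> 'a"
  where "op_conv K L t x = integral {0..t} (\<lambda>r. K (t - r) (L r x))"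

lemma op_conv_integrand:
  assumes K: "op_fam p T K" and L: "op_fam q T L"
  shows "\<And>t x. t \<le> T \<Longrightarrow> continuous_on {0<..<t} (\<lambda>r. K (t - r) (L r x))"
    and "\<exists>C\<ge>0. \<forall>t r x. 0 < r \<and> r < t \<and> t \<le> T \<longrightarrow>
      norm (K (t - r) (L r x)) \<le> C * norm x * ((t - r) powr (p - 1) * r powr (q - 1))"
proof -
  show "continuous_on {0<..<t} (\<lambda>r. K (t - r) (L r x))" if "t \<le> T" for t x
    by (rule continuous_on_op_fam[OF K])
      (use that in \<open>auto intro!: continuous_intros continuous_on_subset[OF op_famD(4)[OF L]]\<close>)
  obtain M where M: "M \<ge> 0" "\<And>t x. 0 < t \<Longrightarrow> t \<le> T \<Longrightarrow> norm (K t x) \<le> M * t powr (p - 1) * norm x"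
    using op_fam_bound[OF K] by blast
  obtain N where N: "N \<ge> 0" "\<And>t x. 0 < t \<Longrightarrow> t \<le> T \<Longrightarrow> norm (L t x) \<le> N * t powr (q - 1) * norm x"
    using op_fam_bound[OF L] by blast
  have "norm (K (t - r) (L r x)) \<le> M * N * norm x * ((t - r) powr (p - 1) * r powr (q - 1))"
    if "0 < r \<and> r < t \<and> t \<le> T" for t r x
  proof -
    have "norm (K (t - r) (L r x)) \<le> M * (t - r) powr (p - 1) * norm (L r x)"
      using that by (intro M(2)) auto
    also have "\<dots> \<le> M * (t - r) powr (p - 1) * (N * r powr (q - 1) * norm x)"
      using that M(1) by (intro mult_left_mono N(2)) auto
    finally show ?thesis by (simp add: mult_ac)
  qed
  moreover have "M * N \<ge> 0" using M N by simp
  ultimately show "\<exists>C\<ge>0. \<forall>t r x. 0 < r \<and> r < t \<and> t \<le> T \<longrightarrow>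
      norm (K (t - r) (L r x)) \<le> C * norm x * ((t - r) powr (p - 1) * r powr (q - 1))" by blast
qed

lemma op_conv_integrable:
  assumes K: "op_fam p T K" and L: "op_fam q T L" and pq: "p > 0" "q > 0" and t: "0 \<le> t" "t \<le> T"
  shows "(\<lambda>r. K (t - r) (L r x)) integrable_on {0..t}"
    and "(\<lambda>r. norm (K (t - r) (L r x))) integrable_on {0..t}"
proof -
  obtain C where C: "\<forall>t r x. 0 < r \<and> r < t \<and> t \<le> T \<longrightarrow>
      norm (K (t - r) (L r x)) \<le> C * norm x * ((t - r) powr (p - 1) * r powr (q - 1))"
    using op_conv_integrand(2)[OF K L] by blast
  have bd: "norm (K (t - r) (L r x)) \<le> C * norm x * ((t - r) powr (p - 1) * r powr (q - 1))"
    if "r \<in> {0<..<t}" for r using C that t by auto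
  have int: "(\<lambda>r. C * norm x * ((t - r) powr (p - 1) * r powr (q - 1))) integrable_on {0..t}"
    using has_integral_powr_convolution[OF pq t(1)]
    by (intro integrable_on_mult_right has_integral_integrable)
  note c = op_conv_integrand(1)[OF K L t(2)]
  show "(\<lambda>r. K (t - r) (L r x)) integrable_on {0..t}"
    by (rule dominated_continuous_integrable[OF c bd int])
  show "(\<lambda>r. norm (K (t - r) (L r x))) integrable_on {0..t}"
    by (rule dominated_continuous_norm_integrable[OF c bd int])
qed

text \<open>The substitution r = t v moves the integral to the fixed interval [0,1]. Its Jacobian t
  is split into two powers so that the remaining integrand has a majorant independent of
  \<open>t\<close>, while the prefactor carries the growth at 0.\<close>

lemma op_conv_scaled:
  assumes "t > 0"
  shows "op_conv K L t x = t powr (p + q - 1) *\<^sub>R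
    integral {0..1} (\<lambda>v. t powr (2 - p - q) *\<^sub>R K (t - t * v) (L (t * v) x))"
proof -
  have "t powr (p + q - 1) * t powr (2 - p - q) = t powr 1" by (simp add: powr_add[symmetric])
  then show ?thesis using assms by (simp add: op_conv_def integral_scale[OF assms])
qed

lemma op_conv_scaled_integrand:
  assumes K: "op_fam p T K" and L: "op_fam q T L"
  shows "\<And>t x. 0 < t \<Longrightarrow> t \<le> T \<Longrightarrow>
      continuous_on {0<..<1} (\<lambda>v. t powr (2 - p - q) *\<^sub>R K (t - t * v) (L (t * v) x))"
    and "\<And>v x. 0 < v \<Longrightarrow> v < 1 \<Longrightarrow>
      continuous_on {0<..T} (\<lambda>t. t powr (2 - p - q) *\<^sub>R K (t - t * v) (L (t * v) x))"
    and "\<exists>C\<ge>0. \<forall>t v x. 0 < t \<and> t \<le> T \<and> 0 < v \<and> v < 1 \<longrightarrow>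
      norm (t powr (2 - p - q) *\<^sub>R K (t - t * v) (L (t * v) x))
        \<le> C * norm x * ((1 - v) powr (p - 1) * v powr (q - 1))"
proof -
  have rng: "0 < t * v \<and> t * v < t \<and> t * v \<le> T \<and> 0 < t - t * v \<and> t - t * v \<le> T"
    if "0 < t" "t \<le> T" "0 < v" "v < 1" for t v
  proof -
    have "0 < t * v" "t * v < t * 1" using that by (auto intro: mult_strict_left_mono)
    with that show ?thesis by auto
  qed
  show "continuous_on {0<..<1} (\<lambda>v. t powr (2 - p - q) *\<^sub>R K (t - t * v) (L (t * v) x))"
    if t: "0 < t" "t \<le> T" for t x
    using rng[OF t]
    by (intro continuous_intros continuous_on_op_fam[OF K]
        continuous_on_compose2[OF op_famD(4)[OF L]]) auto
  show "continuous_on {0<..T} (\<lambda>t. t powr (2 - p - q) *\<^sub>R K (t - t * v) (L (t * v) x))"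
    if v: "0 < v" "v < 1" for v x
    using rng v
    by (intro continuous_intros continuous_on_op_fam[OF K]
        continuous_on_compose2[OF op_famD(4)[OF L]]) auto
  obtain C where C: "C \<ge> 0" "\<And>t r x. 0 < r \<and> r < t \<and> t \<le> T \<Longrightarrow>
      norm (K (t - r) (L r x)) \<le> C * norm x * ((t - r) powr (p - 1) * r powr (q - 1))"
    using op_conv_integrand(2)[OF K L] by blast
  have "norm (t powr (2 - p - q) *\<^sub>R K (t - t * v) (L (t * v) x))
        \<le> C * norm x * ((1 - v) powr (p - 1) * v powr (q - 1))"
    if "0 < t \<and> t \<le> T \<and> 0 < v \<and> v < 1" for t v x
  proof -
    have 1: "(t - t * v) powr (p - 1) = t powr (p - 1) * (1 - v) powr (p - 1)"
      using that powr_mult[of t "1 - v" "p - 1"] by (simp add: algebra_simps)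
    have 2: "(t * v) powr (q - 1) = t powr (q - 1) * v powr (q - 1)"
      using that by (simp add: powr_mult)
    have 3: "t powr (2 - p - q) * (t powr (p - 1) * t powr (q - 1)) = 1"
      using that by (simp add: powr_add[symmetric])
    have "norm (t powr (2 - p - q) *\<^sub>R K (t - t * v) (L (t * v) x))
      \<le> t powr (2 - p - q) * (C * norm x * ((t - t * v) powr (p - 1) * (t * v) powr (q - 1)))"
      using C(2)[of "t * v" t x] rng[of t v] that by (simp add: mult_left_mono)
    also have "\<dots> = (t powr (2 - p - q) * (t powr (p - 1) * t powr (q - 1))) * 
        (C * norm x * ((1 - v) powr (p - 1) * v powr (q - 1)))"
      unfolding 1 2 by (simp add: mult_ac)
    finally show ?thesis unfolding 3 by simp
  qed
  with C(1) show "\<exists>C\<ge>0. \<forall>t v x. 0 < t \<and> t \<le> T \<and> 0 < v \<and> v < 1 \<longrightarrow>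
      norm (t powr (2 - p - q) *\<^sub>R K (t - t * v) (L (t * v) x))
        \<le> C * norm x * ((1 - v) powr (p - 1) * v powr (q - 1))" by blast
qed

text \<open>In the scaled form the majorant is a beta density that does not depend on
  \<open>t\<close>. It yields at once the bound, with constant \<open>C * Beta p q\<close>, and the
  continuity in \<open>t\<close>.\<close>

lemma op_fam_op_conv:
  assumes K: "op_fam p T K" and L: "op_fam q T L" and pq: "p > 0" "q > 0"
  shows "op_fam (p + q) T (op_conv K L)"
proof -
  obtain C where C0: "C \<ge> 0" and C: "\<forall>t v x. 0 < t \<and> t \<le> T \<and> 0 < v \<and> v < 1 \<longrightarrow>
      norm (t powr (2 - p - q) *\<^sub>R K (t - t * v) (L (t * v) x))
        \<le> C * norm x * ((1 - v) powr (p - 1) * v powr (q - 1))"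
    using op_conv_scaled_integrand(3)[OF K L] by blast
  have hi: "((\<lambda>v. C * norm x * ((1 - v) powr (p - 1) * v powr (q - 1))) has_integral C * norm x * Beta p q) {0..1}" for x :: 'a
    using has_integral_mult_right[OF has_integral_powr_convolution[OF pq, of 1], of "C * norm x"] by simp
  have bd: "norm (op_conv K L t x) \<le> C * Beta p q * t powr (p + q - 1) * norm x"
    if t: "0 < t" "t \<le> T" for t x
  proof -
    have "norm (integral {0..1} (\<lambda>v. t powr (2 - p - q) *\<^sub>R K (t - t * v) (L (t * v) x))) \<le>
      integral {0..1} (\<lambda>v. C * norm x * ((1 - v) powr (p - 1) * v powr (q - 1)))"
      by (intro norm_integral_le_interior has_integral_integrable[OF hi]
          dominated_continuous_integrable[OF op_conv_scaled_integrand(1)[OF K L t] _ has_integral_integrable[OF hi]])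
        (use C t in auto)
    also have "\<dots> = C * norm x * Beta p q" using hi by (rule integral_unique)
    finally have "norm (integral {0..1} (\<lambda>v. t powr (2 - p - q) *\<^sub>R K (t - t * v) (L (t * v) x)))
      \<le> C * norm x * Beta p q" .
    from mult_left_mono[OF this, of "t powr (p + q - 1)"]
    show ?thesis unfolding op_conv_scaled[OF t(1), of K L x p q] norm_scaleR by (simp add: mult_ac)
  qed
  have "Beta p q \<ge> 0" using pq by (simp add: Beta_def)
  then have bound: "\<exists>M\<ge>0. \<forall>t\<in>{0<..T}. \<forall>x. norm (op_conv K L t x) \<le> M * t powr (p + q - 1) * norm x"
    using bd C0 by (intro exI[of _ "C * Beta p q"]) auto
  have cont: "continuous_on {0<..T} (\<lambda>t. op_conv K L t x)" for x
  proof -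
    have "continuous_on {0<..T} (\<lambda>t. integral {0..1} (\<lambda>v. t powr (2 - p - q) *\<^sub>R K (t - t * v) (L (t * v) x)))"
      by (rule continuous_on_integral_dominated[OF _ _ has_integral_integrable[OF hi[of x]]])
        (use C op_conv_scaled_integrand(1,2)[OF K L] in auto)
    then have "continuous_on {0<..T} (\<lambda>t. t powr (p + q - 1) *\<^sub>R
        integral {0..1} (\<lambda>v. t powr (2 - p - q) *\<^sub>R K (t - t * v) (L (t * v) x)))"
      by (intro continuous_intros) auto
    then show ?thesis
      by (rule continuous_on_eq) (simp add: op_conv_scaled[of _ K L x p q])
  qed
  have lin: "bounded_clinear (op_conv K L t)" if t: "0 < t" "t \<le> T" for t
  proof -
    note int = op_conv_integrable(1)[OF K L pq less_imp_le[OF t(1)] t(2)]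
    \<comment> \<open>Nothing is known about \<open>K 0\<close> and \<open>L 0\<close>, so linearity
      is available only for \<open>0 < r < t\<close>; the endpoints are discarded as a negligible
      set.\<close>
    have lin: "K (t - r) (L r (x + y)) = K (t - r) (L r x) + K (t - r) (L r y)"
      "K (t - r) (L r (c *\<^sub>C x)) = c *\<^sub>C K (t - r) (L r x)"
      if r: "r \<in> {0..t} - {0, t}" for r x y c
    proof -
      have "0 < t - r" "t - r \<le> T" "0 < r" "r \<le> T" using r t by auto
      note k = op_famD(2,3)[OF K this(1,2)] and l = op_famD(2,3)[OF L this(3,4)]
      show "K (t - r) (L r (x + y)) = K (t - r) (L r x) + K (t - r) (L r y)"
        using k(1) l(1) by (simp add: bounded_linear.linear linear_add)
      show "K (t - r) (L r (c *\<^sub>C x)) = c *\<^sub>C K (t - r) (L r x)" by (simp add: k(2) l(2))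
    qed
    have add: "op_conv K L t (x + y) = op_conv K L t x + op_conv K L t y" for x y
    proof -
      have "op_conv K L t (x + y) = integral {0..t} (\<lambda>r. K (t - r) (L r x) + K (t - r) (L r y))"
        unfolding op_conv_def by (rule integral_spike[of "{0, t}"]) (use lin(1) in auto)
      then show ?thesis unfolding op_conv_def by (simp add: integral_add[OF int int])
    qed
    have scaleC: "op_conv K L t (c *\<^sub>C x) = c *\<^sub>C op_conv K L t x" for c x
    proof -
      have "op_conv K L t (c *\<^sub>C x) = integral {0..t} ((\<lambda>y. c *\<^sub>C y) \<circ> (\<lambda>r. K (t - r) (L r x)))"
        unfolding op_conv_def by (rule integral_spike[of "{0, t}"]) (use lin(2) in auto)
      then show ?thesis unfolding op_conv_def by (simp only: integral_linear[OF int bounded_linear_scaleC])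
    qed
    have "bounded_linear (op_conv K L t)"
    proof (rule bounded_linear_intro[OF add])
      show "op_conv K L t (r *\<^sub>R x) = r *\<^sub>R op_conv K L t x" for r x
        using scaleC[of "complex_of_real r" x] by (simp only: scaleC_of_real)
      show "norm (op_conv K L t x) \<le> norm x * (C * Beta p q * t powr (p + q - 1))" for x
        using bd[OF t, of x] by (simp add: mult_ac)
    qed
    then show ?thesis using scaleC by (simp add: bounded_clinear_def)
  qed
  show ?thesis unfolding op_fam_def using bound cont lin by auto
qed

text \<open>The normalized operators are bounded by \<open>M\<close>, so replacing the moving
  argument \<open>u t\<close> by its limit \<open>y\<close> costs at most
  \<open>M * norm (u t - y)\<close>. The moving argument is what allows two such limits to be
  nested.\<close>

lemma tendsto_op_fam_normalized:
  fixes K :: "real \<Rightarrow> 'a::complex_banach \<Rightarrow> 'a"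
  assumes K: "op_fam p T K" and T: "T > 0"
    and lim: "\<And>y. ((\<lambda>t. t powr (1 - p) *\<^sub>R K t y) \<longlongrightarrow> K0 y) (at_right 0)"
    and u: "(u \<longlongrightarrow> y) (at_right 0)"
    and v: "v > 0" "v \<le> 1"
  shows "((\<lambda>t. (t * v) powr (1 - p) *\<^sub>R K (t * v) (u t)) \<longlongrightarrow> K0 y) (at_right 0)"
proof -
  obtain M where M: "M \<ge> 0" "\<And>t x. 0 < t \<Longrightarrow> t \<le> T \<Longrightarrow> norm (K t x) \<le> M * t powr (p - 1) * norm x"
    using op_fam_bound[OF K] by blast
  have tv: "filterlim (\<lambda>t. t * v) (at_right 0) (at_right 0)"
    unfolding filterlim_at
  proof
    show "\<forall>\<^sub>F t in at_right 0. t * v \<in> {0<..} \<and> t * v \<noteq> 0"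
      using eventually_at_right_less[of 0] by eventually_elim (use v in auto)
    have "((\<lambda>t. t * v) \<longlongrightarrow> 0 * v) (at_right 0)" by (intro tendsto_intros)
    then show "((\<lambda>t. t * v) \<longlongrightarrow> 0) (at_right 0)" by simp
  qed
  have ev: "\<forall>\<^sub>F t in at_right 0. 0 < t * v \<and> t * v \<le> T"
  proof -
    have "\<forall>\<^sub>F t in at_right 0. t \<in> {0<..<T}" using T by (rule eventually_at_right_real)
    then show ?thesis
    proof eventually_elim
      case (elim t)
      then have "t * v \<le> t" using v by (intro mult_left_le) auto
      moreover have "0 < t * v" using elim v by simp
      ultimately show ?case using elim by simp
    qed
  qed
  have "((\<lambda>t. M * norm (u t - y)) \<longlongrightarrow> M * norm (y - y)) (at_right 0)"
    by (intro tendsto_intros u)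
  then have "((\<lambda>t. M * norm (u t - y)) \<longlongrightarrow> 0) (at_right 0)" by simp
  then have "((\<lambda>t. (t * v) powr (1 - p) *\<^sub>R K (t * v) (u t - y)) \<longlongrightarrow> 0) (at_right 0)"
  proof (rule Lim_null_comparison[rotated])
    show "\<forall>\<^sub>F t in at_right 0. norm ((t * v) powr (1 - p) *\<^sub>R K (t * v) (u t - y)) \<le> M * norm (u t - y)"
      using ev
    proof eventually_elim
      case (elim t)
      have "(t * v) powr (1 - p) * (t * v) powr (p - 1) = 1" using elim by (auto simp: powr_add[symmetric])
      moreover have "(t * v) powr (1 - p) * norm (K (t * v) (u t - y))
        \<le> (t * v) powr (1 - p) * (M * (t * v) powr (p - 1) * norm (u t - y))"
        using elim by (intro mult_left_mono M(2)) auto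
      ultimately show ?case by (simp add: mult_ac)
    qed
  qed
  moreover have "((\<lambda>t. (t * v) powr (1 - p) *\<^sub>R K (t * v) y) \<longlongrightarrow> K0 y) (at_right 0)"
    by (rule filterlim_compose[OF lim tv])
  ultimately have "((\<lambda>t. (t * v) powr (1 - p) *\<^sub>R K (t * v) (u t - y)
      + (t * v) powr (1 - p) *\<^sub>R K (t * v) y) \<longlongrightarrow> 0 + K0 y) (at_right 0)"
    by (rule tendsto_add)
  then show ?thesis unfolding add_0_left
  proof (rule Lim_transform_eventually)
    show "\<forall>\<^sub>F t in at_right 0. (t * v) powr (1 - p) *\<^sub>R K (t * v) (u t - y)
      + (t * v) powr (1 - p) *\<^sub>R K (t * v) y = (t * v) powr (1 - p) *\<^sub>R K (t * v) (u t)"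
      using ev
    proof eventually_elim
      case (elim t)
      then have "linear (K (t * v))" using op_famD(2)[OF K] by (simp add: bounded_linear.linear)
      then show ?case by (simp add: linear_diff scaleR_diff_right)
    qed
  qed
qed

text \<open>For fixed \<open>v\<close> the scaled integrand converges to the beta density times
  \<open>K0 (L0 x)\<close>. Dominated convergence on [0,1] then leaves the factor
  \<open>Beta p q\<close>.\<close>

lemma op_conv_tendsto:
  assumes K: "op_fam p T K" and L: "op_fam q T L" and pq: "p > 0" "q > 0" and T: "T > 0"
    and limK: "\<And>y. ((\<lambda>t. t powr (1 - p) *\<^sub>R K t y) \<longlongrightarrow> K0 y) (at_right 0)"
    and limL: "\<And>y. ((\<lambda>t. t powr (1 - q) *\<^sub>R L t y) \<longlongrightarrow> L0 y) (at_right 0)"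
  shows "((\<lambda>t. t powr (1 - p - q) *\<^sub>R op_conv K L t x) \<longlongrightarrow> Beta p q *\<^sub>R K0 (L0 x)) (at_right 0)"
proof -
  let ?f = "\<lambda>t v. t powr (2 - p - q) *\<^sub>R K (t - t * v) (L (t * v) x)"
  let ?l = "\<lambda>v. ((1 - v) powr (p - 1) * v powr (q - 1)) *\<^sub>R K0 (L0 x)"
  obtain C where C: "\<forall>t v x. 0 < t \<and> t \<le> T \<and> 0 < v \<and> v < 1 \<longrightarrow>
      norm (t powr (2 - p - q) *\<^sub>R K (t - t * v) (L (t * v) x))
        \<le> C * norm x * ((1 - v) powr (p - 1) * v powr (q - 1))"
    using op_conv_scaled_integrand(3)[OF K L] by blast
  have beta: "((\<lambda>v. (1 - v) powr (p - 1) * v powr (q - 1)) has_integral Beta p q) {0..1}"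
    using has_integral_powr_convolution[OF pq, of 1] by simp
  have at0: "at_right 0 = at 0 within {0<..T}"
    by (rule at_within_nhd[of _ "{..<T}"]) (use T in auto)
  have "((\<lambda>t. integral {0..1} (?f t)) \<longlongrightarrow> integral {0..1} ?l) (at 0 within {0<..T})"
  proof (rule tendsto_integral_dominated)
    show "continuous_on {0<..<1} (?f t)" if "t \<in> {0<..T}" for t
      using op_conv_scaled_integrand(1)[OF K L] that by auto
    show "norm (?f t v) \<le> C * norm x * ((1 - v) powr (p - 1) * v powr (q - 1))"
      if "t \<in> {0<..T}" "v \<in> {0<..<1}" for t v
      using C that by auto
    show "(\<lambda>v. C * norm x * ((1 - v) powr (p - 1) * v powr (q - 1))) integrable_on {0..1}"
      by (intro integrable_on_mult_right has_integral_integrable[OF beta])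
    show "continuous_on {0<..<1} ?l" by (intro continuous_intros) auto
    show "((\<lambda>t. ?f t v) \<longlongrightarrow> ?l v) (at 0 within {0<..T})" if "v \<in> {0<..<1}" for v
    proof -
      have v: "0 < v" "v < 1" using that by auto
      have "((\<lambda>t. (t * v) powr (1 - q) *\<^sub>R L (t * v) x) \<longlongrightarrow> L0 x) (at_right 0)"
        by (rule tendsto_op_fam_normalized[OF L T limL tendsto_const]) (use v in auto)
      \<comment> \<open>The normalized value of \<open>L\<close> is fed into \<open>K\<close> as the
        moving argument, so the limits are composed and not merely taken separately.\<close>
      then have "((\<lambda>t. (t * (1 - v)) powr (1 - p) *\<^sub>R K (t * (1 - v)) ((t * v) powr (1 - q) *\<^sub>R L (t * v) x))
          \<longlongrightarrow> K0 (L0 x)) (at_right 0)"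
        by (rule tendsto_op_fam_normalized[OF K T limK]) (use v in auto)
      then have "((\<lambda>t. ((1 - v) powr (p - 1) * v powr (q - 1)) *\<^sub>R
          ((t * (1 - v)) powr (1 - p) *\<^sub>R K (t * (1 - v)) ((t * v) powr (1 - q) *\<^sub>R L (t * v) x)))
          \<longlongrightarrow> ?l v) (at_right 0)"
        by (intro tendsto_intros)
      then have "((\<lambda>t. ?f t v) \<longlongrightarrow> ?l v) (at_right 0)"
      proof (rule Lim_transform_eventually)
        have "\<forall>\<^sub>F t in at_right 0. t \<in> {0<..<T}" using T by (rule eventually_at_right_real)
        then show "\<forall>\<^sub>F t in at_right 0. ((1 - v) powr (p - 1) * v powr (q - 1)) *\<^sub>R
          ((t * (1 - v)) powr (1 - p) *\<^sub>R K (t * (1 - v)) ((t * v) powr (1 - q) *\<^sub>R L (t * v) x)) = ?f t v"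
        proof eventually_elim
          case (elim t)
          have "t * (1 - v) \<le> t" using elim v by (intro mult_left_le) auto
          moreover have "t \<le> T" using elim by simp
          ultimately have "t * (1 - v) \<le> T" by (rule order_trans)
          moreover have "0 < t * (1 - v)" using elim v by simp
          ultimately have lin: "linear (K (t * (1 - v)))"
            using op_famD(2)[OF K] by (simp only: bounded_linear.linear)
          have 1: "t - t * v = t * (1 - v)" by (simp add: algebra_simps)
          have 2: "(1 - v) powr (p - 1) * (1 - v) powr (1 - p) = 1" "v powr (q - 1) * v powr (1 - q) = 1"
            using v by (simp_all add: powr_add[symmetric])
          have 3: "t powr (1 - p) * t powr (1 - q) = t powr (2 - p - q)"
            unfolding powr_add[symmetric] by (rule arg_cong2[where f = "(powr)"]) auto
          have "(1 - v) powr (p - 1) * v powr (q - 1) * ((t * (1 - v)) powr (1 - p) * (t * v) powr (1 - q))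
            = ((1 - v) powr (p - 1) * (1 - v) powr (1 - p)) * (v powr (q - 1) * v powr (1 - q)) * (t powr (1 - p) * t powr (1 - q))"
            using elim v by (simp add: powr_mult mult_ac)
          then have "(1 - v) powr (p - 1) * v powr (q - 1) * ((t * (1 - v)) powr (1 - p) * (t * v) powr (1 - q))
            = t powr (2 - p - q)" unfolding 2 3 by simp
          then show ?case by (simp add: 1 linear_scale[OF lin] mult_ac)
        qed
      qed
      then show ?thesis unfolding at0 .
    qed
  qed
  moreover have "integral {0..1} ?l = Beta p q *\<^sub>R K0 (L0 x)"
    by (rule integral_unique[OF has_integral_scaleR_left[OF beta]])
  ultimately have "((\<lambda>t. integral {0..1} (?f t)) \<longlongrightarrow> Beta p q *\<^sub>R K0 (L0 x)) (at_right 0)"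
    by (simp add: at0)
  then show ?thesis
  proof (rule Lim_transform_eventually)
    show "\<forall>\<^sub>F t in at_right 0. integral {0..1} (?f t) = t powr (1 - p - q) *\<^sub>R op_conv K L t x"
      using eventually_at_right_less[of 0]
    proof eventually_elim
      case (elim t)
      have "t powr (1 - p - q) * t powr (p + q - 1) = 1" using elim by (simp add: powr_add[symmetric])
      then show ?case using elim by (simp add: op_conv_scaled[of t K L x p q])
    qed
  qed
qed

text \<open>An exchange of integrals over the triangle 0 < r < s < t, with the product of the three
  power bounds as majorant \<open>h\<close>. Its inner integrals are beta integrals in both orders,
  and the results are integrable for the same reason.\<close>

lemma op_conv_assoc:
  assumes K: "op_fam p T K" and L: "op_fam q T L" and M: "op_fam l T M"
    and pql: "p > 0" "q > 0" "l > 0" and t: "0 < t" "t \<le> T"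
  shows "op_conv K (op_conv L M) t x = op_conv (op_conv K L) M t x"
proof -
  define F where "F s r = K (t - s) (L (s - r) (M r x))" for s r
  obtain a where a: "a \<ge> 0" "\<And>t x. 0 < t \<Longrightarrow> t \<le> T \<Longrightarrow> norm (K t x) \<le> a * t powr (p - 1) * norm x"
    using op_fam_bound[OF K] by blast
  obtain b where b: "b \<ge> 0" "\<And>t x. 0 < t \<Longrightarrow> t \<le> T \<Longrightarrow> norm (L t x) \<le> b * t powr (q - 1) * norm x"
    using op_fam_bound[OF L] by blast
  obtain c where c: "c \<ge> 0" "\<And>t x. 0 < t \<Longrightarrow> t \<le> T \<Longrightarrow> norm (M t x) \<le> c * t powr (l - 1) * norm x"
    using op_fam_bound[OF M] by blast
  define C where "C = a * b * c * norm x"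
  define h where "h s r = C * ((t - s) powr (p - 1) * ((s - r) powr (q - 1) * r powr (l - 1)))" for s r
  \<comment> \<open>The bounded operator \<open>K (t - s)\<close> is pulled out of the inner
    integral.\<close>
  have I1: "integral {0..s} (F s) = K (t - s) (op_conv L M s x)" if s: "0 < s" "s < t" for s
  proof -
    have "bounded_linear (K (t - s))" using op_famD(2)[OF K] s t by simp
    moreover have "(\<lambda>r. L (s - r) (M r x)) integrable_on {0..s}"
      using op_conv_integrable(1)[OF L M pql(2,3)] s t by simp
    ultimately show ?thesis
      unfolding op_conv_def F_def by (simp add: integral_linear[symmetric] o_def)
  qed
  have I2: "integral {r..t} (\<lambda>s. F s r) = op_conv K L (t - r) (M r x)" for r
    using integral_shift[of r t "\<lambda>s. K (t - r - s) (L s (M r x))"]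
    by (simp add: op_conv_def F_def)
  have "integral {0..t} (\<lambda>s. integral {0..s} (F s)) = integral {0..t} (\<lambda>r. integral {r..t} (\<lambda>s. F s r))"
  proof (rule integral_swap_open[where P = "\<lambda>s r. 0 < r \<and> r < s \<and> s < t" and h = h
        and ?h1.0 = "\<lambda>s. C * (t - s) powr (p - 1) * (Beta q l * s powr (q + l - 1))"
        and ?h2.0 = "\<lambda>r. C * r powr (l - 1) * (Beta p q * (t - r) powr (p + q - 1))"])
    show "open {(s, r). 0 < r \<and> r < s \<and> s < t}"
      unfolding case_prod_unfold
      by (intro open_Collect_conj open_Collect_less continuous_intros)
    show "continuous_on {(s, r). 0 < r \<and> r < s \<and> s < t} (\<lambda>(s, r). F s r)"
      unfolding F_def case_prod_unfold
      by (intro continuous_on_op_fam[OF K] continuous_on_op_fam[OF L]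
          continuous_on_compose2[OF op_famD(4)[OF M]] continuous_intros)
        (use t in auto)
    show "norm (F s r) \<le> h s r" if "0 < r \<and> r < s \<and> s < t" for s r
    proof -
      have "norm (F s r) \<le> a * (t - s) powr (p - 1) * norm (L (s - r) (M r x))"
        unfolding F_def using that t by (intro a(2)) auto
      also have "\<dots> \<le> a * (t - s) powr (p - 1) * (b * (s - r) powr (q - 1) * norm (M r x))"
        using that t a(1) by (intro mult_left_mono b(2)) auto
      also have "\<dots> \<le> a * (t - s) powr (p - 1) * (b * (s - r) powr (q - 1) * (c * r powr (l - 1) * norm x))"
        using that t a(1) b(1) by (intro mult_left_mono c(2)) auto
      finally show ?thesis by (simp add: h_def C_def mult_ac)
    qed
    show "(h s has_integral C * (t - s) powr (p - 1) * (Beta q l * s powr (q + l - 1))) {0..s}"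
      if "0 < s" for s
      using has_integral_mult_right[OF has_integral_powr_convolution[OF pql(2,3), of s], of "C * (t - s) powr (p - 1)"] that
      by (simp add: h_def[abs_def] mult_ac)
    show "(\<lambda>s. C * (t - s) powr (p - 1) * (Beta q l * s powr (q + l - 1))) integrable_on {0..t}"
      using has_integral_integrable[OF has_integral_mult_right[OF
          has_integral_powr_convolution[of p "q + l" t], of "C * Beta q l"]] pql t
      by (simp add: mult_ac)
    show "((\<lambda>s. h s r) has_integral C * r powr (l - 1) * (Beta p q * (t - r) powr (p + q - 1))) {r..t}"
      if "0 < r" "r < t" for r
    proof -
      have "((\<lambda>s. (t - r - s) powr (p - 1) * s powr (q - 1)) has_integral
          Beta p q * (t - r) powr (p + q - 1)) {0..t - r}"
        using has_integral_powr_convolution[OF pql(1,2), of "t - r"] that by simp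
      then have "((\<lambda>s. (t - s) powr (p - 1) * (s - r) powr (q - 1)) has_integral
          Beta p q * (t - r) powr (p + q - 1)) {r..t}"
        using has_integral_shift_Icc_real[of "\<lambda>s. (t - r - s) powr (p - 1) * s powr (q - 1)" "-r" _ r t]
        by (simp add: o_def)
      from has_integral_mult_right[OF this, of "C * r powr (l - 1)"] show ?thesis
        by (simp add: h_def[abs_def] mult_ac)
    qed
    show "(\<lambda>r. C * r powr (l - 1) * (Beta p q * (t - r) powr (p + q - 1))) integrable_on {0..t}"
      using has_integral_integrable[OF has_integral_mult_right[OF
          has_integral_powr_convolution[of "p + q" l t], of "C * Beta p q"]] pql t
      by (simp add: mult_ac)
    have "continuous_on {0<..<t} (\<lambda>s. K (t - s) (op_conv L M s x))"
      by (intro continuous_on_op_fam[OF K] continuous_intros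
          continuous_on_subset[OF op_famD(4)[OF op_fam_op_conv[OF L M pql(2,3)]]]) (use t in auto)
    then show "continuous_on {0<..<t} (\<lambda>s. integral {0..s} (F s))"
      by (rule continuous_on_eq) (simp add: I1)
    have "continuous_on {0<..<t} (\<lambda>r. op_conv K L (t - r) (M r x))"
      by (intro continuous_on_op_fam[OF op_fam_op_conv[OF K L pql(1,2)]] continuous_intros
          continuous_on_subset[OF op_famD(4)[OF M]]) (use t in auto)
    then show "continuous_on {0<..<t} (\<lambda>r. integral {r..t} (\<lambda>s. F s r))"
      by (rule continuous_on_eq) (simp add: I2)
  qed auto
  moreover have "integral {0..t} (\<lambda>s. integral {0..s} (F s)) = op_conv K (op_conv L M) t x"
    unfolding op_conv_def[of K "op_conv L M"]
    by (rule integral_spike[of "{0, t}"]) (auto simp: I1)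
  ultimately show ?thesis by (simp add: I2 op_conv_def[of "op_conv K L"])
qed

lemma op_conv_scalar_commute:
  fixes L :: "real \<Rightarrow> 'a::complex_banach \<Rightarrow> 'a"
  assumes L: "op_fam q T L" and t: "0 < t" "t \<le> T"
  shows "op_conv (\<lambda>t x. k t *\<^sub>R x) L t x = op_conv L (\<lambda>t x. k t *\<^sub>R x) t x"
proof -
  have "op_conv (\<lambda>t x. k t *\<^sub>R x) L t x = integral {0..t} (\<lambda>r. k r *\<^sub>R L (t - r) x)"
    using integral_flip[of t "\<lambda>r. k r *\<^sub>R L (t - r) x"] by (simp add: op_conv_def)
  also have "\<dots> = op_conv L (\<lambda>t x. k t *\<^sub>R x) t x"
    unfolding op_conv_def
  proof (rule integral_spike[of "{0, t}"])
    fix r assume "r \<in> {0..t} - {0, t}"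
    then have "linear (L (t - r))"
      using t op_famD(2)[OF L, of "t - r"] by (auto simp: bounded_linear.linear)
    then show "L (t - r) (k r *\<^sub>R x) = k r *\<^sub>R L (t - r) x" by (rule linear_scale)
  qed simp
  finally show ?thesis .
qed

definition commutes_with :: "'a set \<Rightarrow> ('a \<Rightarrow> 'a) \<Rightarrow> real \<Rightarrow> (real \<Rightarrow> 'a \<Rightarrow> 'a) \<Rightarrow> bool"
  where "commutes_with D A T K \<longleftrightarrow> (\<forall>t\<in>{0<..T}. \<forall>x\<in>D. K t x \<in> D \<and> A (K t x) = K t (A x))"

lemma op_conv_commutes_with:
  assumes A: "closed_operator D A" and K: "op_fam p T K" and L: "op_fam q T L"
    and pq: "p > 0" "q > 0" and "commutes_with D A T K" "commutes_with D A T L"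
  shows "commutes_with D A T (op_conv K L)"
  unfolding commutes_with_def
proof (intro ballI)
  fix t x assume "t \<in> {0<..T}" and x: "x \<in> D"
  then have t: "0 < t" "t \<le> T" by auto
  note int = op_conv_integrable(1)[OF K L pq less_imp_le[OF t(1)] t(2)]
  have "K (t - r) (L r x) \<in> D" "A (K (t - r) (L r x)) = K (t - r) (L r (A x))"
    if "r \<in> {0<..<t}" for r
    using assms(6,7) x t that by (auto simp: commutes_with_def)
  with closed_operator_integral[OF A int int] show "op_conv K L t x \<in> D \<and> A (op_conv K L t x) = op_conv K L t (A x)"
    unfolding op_conv_def by simp
qed

section \<open>Fractional kernels\<close>

text \<open>The integrand has an explicit primitive: the derivative of ((s - \<sigma>) / (u +
  \<sigma>))^\<alpha> is the integrand times -\<alpha> (s + u), whence the constant \<open>c\<close>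
  in \<open>Q\<close>.\<close>

lemma has_integral_abel_kernel:
  fixes s u \<alpha> :: real
  assumes "s > 0" "u > 0" "0 < \<alpha>"
  shows "((\<lambda>\<sigma>. (s - \<sigma>) powr (\<alpha> - 1) * (u + \<sigma>) powr (-1 - \<alpha>)) has_integral
    s powr \<alpha> * u powr (-\<alpha>) / (\<alpha> * (s + u))) {0..s}"
proof -
  define c where "c = - 1 / (\<alpha> * (s + u))"
  have c: "c * (\<alpha> * (s + u)) = -1" using assms by (simp add: c_def)
  define Q where "Q \<sigma> = c * ((s - \<sigma>) powr \<alpha> * (u + \<sigma>) powr (-\<alpha>))" for \<sigma>
  \<comment> \<open>For \<alpha> < 1 the derivative blows up at \<sigma> = s, but \<open>Q\<close>
    stays continuous there because \<alpha> > 0; so differentiability is required only in the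
    interior.\<close>
  have "((\<lambda>\<sigma>. (s - \<sigma>) powr (\<alpha> - 1) * (u + \<sigma>) powr (-1 - \<alpha>)) has_integral Q s - Q 0) {0..s}"
  proof (rule fundamental_theorem_of_calculus_interior)
    show "continuous_on {0..s} Q"
      unfolding Q_def using assms by (intro continuous_intros continuous_on_powr') auto
    fix \<sigma> assume "\<sigma> \<in> {0<..<s}"
    then have \<sigma>: "0 < \<sigma>" "\<sigma> < s" by auto
    let ?P = "(s - \<sigma>) powr (\<alpha> - 1)" and ?R = "(u + \<sigma>) powr (-1 - \<alpha>)"
    have 1: "(s - \<sigma>) powr \<alpha> = ?P * (s - \<sigma>)"
      using powr_add[of "s - \<sigma>" "\<alpha> - 1" 1] \<sigma> by simp
    have 2: "(u + \<sigma>) powr (-\<alpha>) = ?R * (u + \<sigma>)"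
      using powr_add[of "u + \<sigma>" "-1 - \<alpha>" 1] \<sigma> assms by simp
    have d1: "((\<lambda>\<sigma>. (s - \<sigma>) powr \<alpha>) has_real_derivative - \<alpha> * ?P) (at \<sigma>)"
      using \<sigma> by (auto intro!: derivative_eq_intros)
    have e: "- \<alpha> - 1 = - 1 - \<alpha>" by simp
    have d2: "((\<lambda>\<sigma>. (u + \<sigma>) powr (-\<alpha>)) has_real_derivative - \<alpha> * ?R) (at \<sigma>)"
      using \<sigma> assms by (auto intro!: derivative_eq_intros simp: e)
    have "(Q has_real_derivative c * (- \<alpha> * ?P * (u + \<sigma>) powr (-\<alpha>) + - \<alpha> * ?R * (s - \<sigma>) powr \<alpha>)) (at \<sigma>)"
      unfolding Q_def by (rule DERIV_cmult[OF DERIV_mult[OF d1 d2]])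
    moreover have "c * (- \<alpha> * ?P * (u + \<sigma>) powr (-\<alpha>) + - \<alpha> * ?R * (s - \<sigma>) powr \<alpha>)
        = - (c * (\<alpha> * (s + u))) * (?P * ?R)"
      unfolding 1 2 by (simp add: algebra_simps)
    ultimately show "(Q has_vector_derivative ?P * ?R) (at \<sigma>)"
      unfolding c by (simp add: has_real_derivative_iff_has_vector_derivative)
  qed (use assms in simp)
  moreover have "Q s - Q 0 = s powr \<alpha> * u powr (-\<alpha>) / (\<alpha> * (s + u))" by (simp add: Q_def c_def)
  ultimately show ?thesis by simp
qed

lemma has_integral_stieltjes_kernel:
  fixes s c \<alpha> :: real
  assumes s: "s > 0" and c: "c > 0" and \<alpha>: "0 < \<alpha>" "\<alpha> < 1"
  shows "((\<lambda>r. (c - r) powr (-\<alpha>) * r powr (\<alpha> - 1) / (s + c - r)) has_integral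
    Gamma \<alpha> * Gamma (1 - \<alpha>) * s powr (-\<alpha>) * (s + c) powr (\<alpha> - 1)) {0..c}"
proof -
  \<comment> \<open>the Moebius substitution that maps \<open>(0,c)\<close> onto \<open>(0,1)\<close> and turns the integrand into that of \<open>Beta \<alpha> (1 - \<alpha>)\<close>\<close>
  define y where "y r = s * r / (c * (s + c - r))" for r
  define y' where "y' r = s * (s + c) / (c * (s + c - r)^2)" for r
  let ?f = "\<lambda>t. t powr (\<alpha> - 1) * (1 - t) powr (-\<alpha>)"
  have beta: "(?f has_integral Gamma \<alpha> * Gamma (1 - \<alpha>)) {0..1}"
    using has_integral_Beta_real[of \<alpha> "1 - \<alpha>"] \<alpha> by (simp add: Beta_def)
  have img: "y ` {0<..<c} = {0<..<1}"
  proof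
    show "y ` {0<..<c} \<subseteq> {0<..<1}"
    proof clarsimp
      fix r assume r: "0 < r" "r < c"
      have "s * r < c * (s + c - r)"
      proof -
        \<comment> \<open>This product is the difference of the two sides, and later the numerator
          of \<open>1 - y r\<close>.\<close>
        have "0 < (s + c) * (c - r)" using r s c by simp
        then show ?thesis by (simp add: algebra_simps)
      qed
      then show "0 < y r \<and> y r < 1" using r s c by (simp add: y_def)
    qed
    show "{0<..<1} \<subseteq> y ` {0<..<c}"
    proof
      fix z :: real assume "z \<in> {0<..<1}"
      then have z: "0 < z" "z < 1" by auto
      \<comment> \<open>The solution of \<open>y r = z\<close> for \<open>r\<close>, that is, the
        inverse Moebius map.\<close>
      let ?r = "c * (s + c) * z / (s + c * z)"
      have d: "s + c * z > 0" using s c z by (simp add: add_pos_pos)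
      have "(s + c) * z < s + c * z" using s z by (simp add: algebra_simps)
      then have "c * ((s + c) * z) < c * (s + c * z)" using c by (rule mult_strict_left_mono)
      then have "?r < c" using d by (simp add: pos_divide_less_eq mult.assoc)
      moreover have "0 < ?r" using d c s z by simp
      moreover have "y ?r = z"
      proof -
        have "s + c - ?r = s * (s + c) / (s + c * z)" using d by (simp add: field_simps)
        then show ?thesis unfolding y_def using d s c by (simp add: divide_simps)
      qed
      ultimately show "z \<in> y ` {0<..<c}" by force
    qed
  qed
  have inj: "inj_on y {0<..<c}"
  proof (rule inj_onI)
    fix r r' assume r: "r \<in> {0<..<c}" "r' \<in> {0<..<c}" and eq: "y r = y r'"
    then have "s + c - r > 0" "s + c - r' > 0" using s by auto
    then have "s * r * (c * (s + c - r')) = s * r' * (c * (s + c - r))"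
      using eq c unfolding y_def by (simp add: divide_simps)
    then have "s * c * (s + c) * (r - r') = 0" by (simp add: algebra_simps)
    then show "r = r'" using s c by simp
  qed
  have der: "(y has_field_derivative y' r) (at r within {0<..<c})" if "r \<in> {0<..<c}" for r
  proof -
    have "s + c - r > 0" using that s by auto
    then show ?thesis unfolding y_def y'_def using c
      by (auto intro!: derivative_eq_intros simp: divide_simps power2_eq_square) (simp add: algebra_simps)
  qed
  \<comment> \<open>The change of variables asks for absolute integrability on the image; the
    integrand is nonnegative, so the beta integral provides it.\<close>
  have "?f absolutely_integrable_on {0<..<1} \<and> integral {0<..<1} ?f = Gamma \<alpha> * Gamma (1 - \<alpha>)"
  proof
    have "?f integrable_on {0<..<1}"
      using beta by (auto simp: has_integral_Icc_iff_Ioo)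
    then show "?f absolutely_integrable_on {0<..<1}"
      by (rule nonnegative_absolutely_integrable_1) auto
    show "integral {0<..<1} ?f = Gamma \<alpha> * Gamma (1 - \<alpha>)"
      using beta by (simp add: has_integral_Icc_iff_Ioo integral_unique)
  qed
  then have "(\<lambda>r. \<bar>y' r\<bar> * ?f (y r)) absolutely_integrable_on {0<..<c} \<and>
      integral {0<..<c} (\<lambda>r. \<bar>y' r\<bar> * ?f (y r)) = Gamma \<alpha> * Gamma (1 - \<alpha>)"
    using has_absolute_integral_change_of_variables_1'[OF _ der inj, of ?f "Gamma \<alpha> * Gamma (1 - \<alpha>)"]
    unfolding img by simp
  then have "((\<lambda>r. \<bar>y' r\<bar> * ?f (y r)) has_integral Gamma \<alpha> * Gamma (1 - \<alpha>)) {0<..<c}"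
    using set_lebesgue_integral_eq_integral(1) has_integral_iff by blast
  \<comment> \<open>The powers of \<open>s\<close> and \<open>s + c\<close> in the result are
    constants with respect to \<open>r\<close>; they compensate what the substitution leaves in
    front of the integrand.\<close>
  then have "((\<lambda>r. (s powr (-\<alpha>) * (s + c) powr (\<alpha> - 1)) * (\<bar>y' r\<bar> * ?f (y r))) has_integral
      (s powr (-\<alpha>) * (s + c) powr (\<alpha> - 1)) * (Gamma \<alpha> * Gamma (1 - \<alpha>))) {0<..<c}"
    by (rule has_integral_mult_right)
  moreover have "(s powr (-\<alpha>) * (s + c) powr (\<alpha> - 1)) * (\<bar>y' r\<bar> * ?f (y r))
      = (c - r) powr (-\<alpha>) * r powr (\<alpha> - 1) / (s + c - r)" if "r \<in> {0<..<c}" for r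
  proof -
    define w where "w = s + c - r"
    have r: "0 < r" "r < c" "w > 0" using that s by (auto simp: w_def)
    have "1 - y r = (s + c) * (c - r) / (c * w)"
      using r c unfolding y_def w_def[symmetric] by (simp add: divide_simps) (simp add: w_def algebra_simps)
    then have "(1 - y r) powr (-\<alpha>)
        = (s + c) powr (-\<alpha>) * (c - r) powr (-\<alpha>) / (c powr (-\<alpha>) * w powr (-\<alpha>))"
      using r s c by (simp add: powr_mult powr_divide)
    then have 1: "(1 - y r) powr (-\<alpha>) = (s + c) powr (-\<alpha>) * (c - r) powr (-\<alpha>) * (c powr \<alpha> * w powr \<alpha>)"
      using powr_minus_divide[of c "-\<alpha>"] powr_minus_divide[of w "-\<alpha>"] by simp
    have 2: "y r powr (\<alpha> - 1) = s powr (\<alpha> - 1) * r powr (\<alpha> - 1) * (c powr (1 - \<alpha>) * w powr (1 - \<alpha>))"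
    proof -
      have "y r powr (\<alpha> - 1) = s powr (\<alpha> - 1) * r powr (\<alpha> - 1) / (c powr (\<alpha> - 1) * w powr (\<alpha> - 1))"
        unfolding y_def w_def[symmetric] using r s c by (simp add: powr_mult powr_divide)
      then show ?thesis using powr_minus_divide[of c "\<alpha> - 1"] powr_minus_divide[of w "\<alpha> - 1"] by simp
    qed
    have 3: "\<bar>y' r\<bar> = s * (s + c) / (c * w * w)"
      unfolding y'_def w_def[symmetric] using r s c by (simp add: power2_eq_square mult_ac)
    have q: "z powr (-\<alpha>) * z powr (\<alpha> - 1) * z = 1" if "z > 0" for z :: real
      using that by (simp add: powr_add[symmetric] powr_neg_one)
    have p: "s powr (-\<alpha>) * s powr (\<alpha> - 1) * s = 1" "(s + c) powr (\<alpha> - 1) * (s + c) powr (-\<alpha>) * (s + c) = 1"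
      "c powr \<alpha> * c powr (1 - \<alpha>) = c" "w powr \<alpha> * w powr (1 - \<alpha>) = w"
      using s c r q[of s] q[of "s + c"] by (simp_all add: powr_add[symmetric] add.commute)
    have "(s powr (-\<alpha>) * (s + c) powr (\<alpha> - 1)) * (\<bar>y' r\<bar> * ?f (y r)) =
        (s powr (-\<alpha>) * s powr (\<alpha> - 1) * s) * ((s + c) powr (\<alpha> - 1) * (s + c) powr (-\<alpha>) * (s + c)) *
        ((c powr \<alpha> * c powr (1 - \<alpha>)) * (w powr \<alpha> * w powr (1 - \<alpha>)) / (c * w * w)) *
        ((c - r) powr (-\<alpha>) * r powr (\<alpha> - 1))"
      unfolding 1 2 3 by (simp add: mult_ac)
    also have "\<dots> = (c - r) powr (-\<alpha>) * r powr (\<alpha> - 1) / w"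
      unfolding p using r c by simp
    finally show ?thesis by (simp add: w_def)
  qed
  ultimately have "((\<lambda>r. (c - r) powr (-\<alpha>) * r powr (\<alpha> - 1) / (s + c - r)) has_integral
      (s powr (-\<alpha>) * (s + c) powr (\<alpha> - 1)) * (Gamma \<alpha> * Gamma (1 - \<alpha>))) {0<..<c}"
    by (metis (no_types, lifting) has_integral_cong)
  then show ?thesis by (simp add: has_integral_Icc_iff_Ioo mult_ac)
qed


text \<open>The Riemann-Liouville kernel as a multiple of the identity, so that convolution with the
  scalar function takes part in \<open>op_conv\<close> and its associativity.\<close>

definition rl_kernel :: "real \<Rightarrow> real \<Rightarrow> 'a::complex_banach \<Rightarrow> 'a"
  where "rl_kernel \<alpha> t x = (t powr (\<alpha> - 1) / Gamma \<alpha>) *\<^sub>R x"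

text \<open>The convolution of \<open>g\<^sub>\<alpha>\<close> with \<open>\<sigma> \<mapsto> \<alpha> (u + \<sigma>)\<^bsup>-1-\<alpha>\<^esup> / \<Gamma>(1-\<alpha>)\<close>, evaluated at \<open>s\<close>.\<close>

definition stieltjes_kernel :: "real \<Rightarrow> real \<Rightarrow> real \<Rightarrow> 'a::complex_banach \<Rightarrow> 'a"
  where "stieltjes_kernel \<alpha> s u x =
    (s powr \<alpha> * u powr (-\<alpha>) / ((s + u) * (Gamma \<alpha> * Gamma (1 - \<alpha>)))) *\<^sub>R x"

text \<open>The inner integral of the extension formula, with \<open>s = t - b - r\<^sub>2\<close>; the formula itself is then
  the convolution of \<open>marchaud \<alpha> b S\<close> with \<open>S\<^sub>1\<close>, evaluated at \<open>t - b\<close>.\<close>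

definition marchaud :: "real \<Rightarrow> real \<Rightarrow> (real \<Rightarrow> 'a::complex_banach \<Rightarrow> 'a) \<Rightarrow> real \<Rightarrow> 'a \<Rightarrow> 'a"
  where "marchaud \<alpha> b S s x = (\<alpha> / Gamma (1 - \<alpha>)) *\<^sub>R
    integral {0..b} (\<lambda>r. (b + s - r) powr (-1 - \<alpha>) *\<^sub>R S r x)"

lemma op_fam_rl:
  assumes "0 < \<alpha>"
  shows "op_fam \<alpha> T (rl_kernel \<alpha> :: real \<Rightarrow> 'a \<Rightarrow> 'a::complex_banach)"
  unfolding rl_kernel_def[abs_def]
proof (rule op_fam_scalar[where M = "1 / Gamma \<alpha>"])
  show "continuous_on {0<..T} (\<lambda>t. t powr (\<alpha> - 1) / Gamma \<alpha>)"
    by (intro continuous_intros) (use Gamma_real_pos[OF assms] in auto)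
qed (use Gamma_real_pos[OF assms] in auto)

lemma op_fam_stieltjes:
  assumes "0 < \<alpha>" "\<alpha> < 1" "s > 0"
  shows "op_fam (1 - \<alpha>) T (stieltjes_kernel \<alpha> s :: real \<Rightarrow> 'a \<Rightarrow> 'a::complex_banach)"
  unfolding stieltjes_kernel_def[abs_def]
proof (rule op_fam_scalar[where M = "s powr \<alpha> / (s * (Gamma \<alpha> * Gamma (1 - \<alpha>)))"])
  have G: "Gamma \<alpha> * Gamma (1 - \<alpha>) > 0" using assms by simp
  show "continuous_on {0<..T} (\<lambda>u. s powr \<alpha> * u powr (-\<alpha>) / ((s + u) * (Gamma \<alpha> * Gamma (1 - \<alpha>))))"
  proof (intro continuous_intros ballI)
    fix u assume "u \<in> {0<..T}"
    then have "(s + u) * (Gamma \<alpha> * Gamma (1 - \<alpha>)) > 0" using G assms by simp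
    then show "(s + u) * (Gamma \<alpha> * Gamma (1 - \<alpha>)) \<noteq> 0" by linarith
  qed auto
  show "0 \<le> s powr \<alpha> / (s * (Gamma \<alpha> * Gamma (1 - \<alpha>)))" using G assms by simp
  fix u :: real assume u: "0 < u"
  have "s powr \<alpha> * u powr (-\<alpha>) / ((s + u) * (Gamma \<alpha> * Gamma (1 - \<alpha>)))
      \<le> s powr \<alpha> * u powr (-\<alpha>) / (s * (Gamma \<alpha> * Gamma (1 - \<alpha>)))"
    using u G assms by (intro divide_left_mono mult_right_mono) auto
  then show "\<bar>s powr \<alpha> * u powr (-\<alpha>) / ((s + u) * (Gamma \<alpha> * Gamma (1 - \<alpha>)))\<bar>
      \<le> s powr \<alpha> / (s * (Gamma \<alpha> * Gamma (1 - \<alpha>))) * u powr (1 - \<alpha> - 1)"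
    using u G assms by (simp add: abs_mult)
qed

lemma op_conv_stieltjes_rl:
  assumes \<alpha>: "0 < \<alpha>" "\<alpha> < 1" and s: "s > 0" and c: "c > 0"
  shows "op_conv (stieltjes_kernel \<alpha> s) (rl_kernel \<alpha>) c x = rl_kernel \<alpha> (s + c) x"
proof -
  have G: "Gamma \<alpha> > 0" "Gamma (1 - \<alpha>) > 0" using \<alpha> by simp_all
  let ?f = "\<lambda>r. (c - r) powr (-\<alpha>) * r powr (\<alpha> - 1) / (s + c - r)"
  let ?k = "s powr \<alpha> / (Gamma \<alpha> * Gamma (1 - \<alpha>) * Gamma \<alpha>)"
  have "((\<lambda>r. (?k * ?f r) *\<^sub>R x) has_integral
      (?k * (Gamma \<alpha> * Gamma (1 - \<alpha>) * s powr (-\<alpha>) * (s + c) powr (\<alpha> - 1))) *\<^sub>R x) {0..c}"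
    by (intro has_integral_scaleR_left has_integral_mult_right has_integral_stieltjes_kernel assms)
  moreover have "?k * (Gamma \<alpha> * Gamma (1 - \<alpha>) * s powr (-\<alpha>) * (s + c) powr (\<alpha> - 1))
      = (s powr \<alpha> * s powr (-\<alpha>)) * (s + c) powr (\<alpha> - 1) / Gamma \<alpha>"
    using G by simp
  moreover have "s powr \<alpha> * s powr (-\<alpha>) = 1" using s by (simp add: powr_add[symmetric])
  moreover have "stieltjes_kernel \<alpha> s (c - r) (rl_kernel \<alpha> r x) = (?k * ?f r) *\<^sub>R x" for r
    unfolding stieltjes_kernel_def rl_kernel_def by (simp add: mult_ac add_diff_eq)
  ultimately show ?thesis unfolding op_conv_def by (simp add: rl_kernel_def integral_unique)
qed

section \<open>The kernel built from the history on (0,b]\<close>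

text \<open>The integral of the majorant is known exactly: after reflection it is the Abel integral
  with \<open>b\<close> and \<open>s\<close> in the places of \<open>s\<close> and \<open>u\<close>.
  Its factor \<open>s powr (-\<alpha>)\<close> is the singularity of \<open>marchaud\<close> at
  0.\<close>

lemma marchaud_integrand:
  assumes S: "op_fam \<alpha> b S" and b: "b > 0" and \<alpha>: "0 < \<alpha>"
  shows "\<And>s x. s > 0 \<Longrightarrow> continuous_on {0<..<b} (\<lambda>r. (b + s - r) powr (-1 - \<alpha>) *\<^sub>R S r x)"
    and "\<exists>M\<ge>0. \<forall>s r x. 0 < s \<and> 0 < r \<and> r < b \<longrightarrow>
      norm ((b + s - r) powr (-1 - \<alpha>) *\<^sub>R S r x) \<le> M * norm x * (r powr (\<alpha> - 1) * (b + s - r) powr (-1 - \<alpha>))"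
    and "\<And>s. s > 0 \<Longrightarrow> ((\<lambda>r. r powr (\<alpha> - 1) * (b + s - r) powr (-1 - \<alpha>)) has_integral
      b powr \<alpha> * s powr (-\<alpha>) / (\<alpha> * (b + s))) {0..b}"
    and "\<And>s x. s > 0 \<Longrightarrow> (\<lambda>r. (b + s - r) powr (-1 - \<alpha>) *\<^sub>R S r x) integrable_on {0..b}"
proof -
  show cont: "continuous_on {0<..<b} (\<lambda>r. (b + s - r) powr (-1 - \<alpha>) *\<^sub>R S r x)" if "s > 0" for s x
    by (intro continuous_intros continuous_on_subset[OF op_famD(4)[OF S]]) (use that in auto)
  obtain M where M: "M \<ge> 0" "\<And>t x. 0 < t \<Longrightarrow> t \<le> b \<Longrightarrow> norm (S t x) \<le> M * t powr (\<alpha> - 1) * norm x"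
    using op_fam_bound[OF S] by blast
  have bd: "norm ((b + s - r) powr (-1 - \<alpha>) *\<^sub>R S r x) \<le> M * norm x * (r powr (\<alpha> - 1) * (b + s - r) powr (-1 - \<alpha>))"
    if "0 < r" "r < b" for r s x
    using mult_left_mono[OF M(2)[of r x], of "(b + s - r) powr (-1 - \<alpha>)"] that by (simp add: mult_ac)
  then show "\<exists>M\<ge>0. \<forall>s r x. 0 < s \<and> 0 < r \<and> r < b \<longrightarrow>
      norm ((b + s - r) powr (-1 - \<alpha>) *\<^sub>R S r x) \<le> M * norm x * (r powr (\<alpha> - 1) * (b + s - r) powr (-1 - \<alpha>))"
    using M(1) by blast
  show hi: "((\<lambda>r. r powr (\<alpha> - 1) * (b + s - r) powr (-1 - \<alpha>)) has_integral
      b powr \<alpha> * s powr (-\<alpha>) / (\<alpha> * (b + s))) {0..b}" if "s > 0" for s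
  proof -
    have "((\<lambda>r. (\<lambda>q. (b - q) powr (\<alpha> - 1) * (s + q) powr (-1 - \<alpha>)) (b - r)) has_integral
        b powr \<alpha> * s powr (-\<alpha>) / (\<alpha> * (b + s))) {0..b}"
      by (rule has_integral_flip[THEN iffD2, OF has_integral_abel_kernel[OF b that \<alpha>]])
    then show ?thesis by (simp add: algebra_simps)
  qed
  show "(\<lambda>r. (b + s - r) powr (-1 - \<alpha>) *\<^sub>R S r x) integrable_on {0..b}" if "s > 0" for s x
  proof (rule dominated_continuous_integrable[OF cont[OF that]])
    show "(\<lambda>r. M * norm x * (r powr (\<alpha> - 1) * (b + s - r) powr (-1 - \<alpha>))) integrable_on {0..b}"
      by (intro integrable_on_mult_right has_integral_integrable[OF hi[OF that]])
  qed (use bd in auto)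
qed

lemma op_fam_marchaud:
  assumes S: "op_fam \<alpha> b S" and b: "b > 0" and \<alpha>: "0 < \<alpha>" "\<alpha> < 1"
  shows "op_fam (1 - \<alpha>) T (marchaud \<alpha> b S)"
proof -
  note m = marchaud_integrand[OF S b \<alpha>(1)]
  obtain M where M: "M \<ge> 0" "\<And>s r x. 0 < s \<and> 0 < r \<and> r < b \<Longrightarrow>
      norm ((b + s - r) powr (-1 - \<alpha>) *\<^sub>R S r x) \<le> M * norm x * (r powr (\<alpha> - 1) * (b + s - r) powr (-1 - \<alpha>))"
    using m(2) by blast
  define c where "c = \<alpha> / Gamma (1 - \<alpha>)"
  have c: "c \<ge> 0" using \<alpha> by (simp add: c_def less_imp_le)
  let ?I = "\<lambda>s x. integral {0..b} (\<lambda>r. (b + s - r) powr (-1 - \<alpha>) *\<^sub>R S r x)"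
  \<comment> \<open>Dropping \<open>s\<close> from the denominator \<open>\<alpha> * (b + s)\<close>
    of that exact integral makes the constant independent of \<open>s\<close>.\<close>
  define N where "N = c * M * (b powr \<alpha> / (\<alpha> * b))"
  have N: "N \<ge> 0" using c M(1) \<alpha> b by (simp add: N_def)
  have bd: "norm (marchaud \<alpha> b S s x) \<le> N * s powr (-\<alpha>) * norm x" if s: "s > 0" for s x
  proof -
    have "norm (?I s x) \<le> integral {0..b} (\<lambda>r. M * norm x * (r powr (\<alpha> - 1) * (b + s - r) powr (-1 - \<alpha>)))"
      by (intro norm_integral_le_interior m(4)[OF s] integrable_on_mult_right has_integral_integrable[OF m(3)[OF s]])
        (use M(2) s in auto)
    also have "\<dots> = M * norm x * (b powr \<alpha> * s powr (-\<alpha>) / (\<alpha> * (b + s)))"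
      by (intro integral_unique has_integral_mult_right m(3)[OF s])
    also have "\<dots> \<le> M * norm x * (b powr \<alpha> * s powr (-\<alpha>) / (\<alpha> * b))"
      using M(1) s b \<alpha> by (intro mult_left_mono divide_left_mono) auto
    finally have "c * norm (?I s x) \<le> c * (M * norm x * (b powr \<alpha> * s powr (-\<alpha>) / (\<alpha> * b)))"
      by (rule mult_left_mono[OF _ c])
    then show ?thesis using c unfolding marchaud_def c_def[symmetric] N_def by (simp add: mult_ac)
  qed
  have cont: "continuous_on {0<..T} (\<lambda>s. marchaud \<alpha> b S s x)" for x
  proof -
    obtain M where M: "M \<ge> 0" "\<And>t x. 0 < t \<Longrightarrow> t \<le> b \<Longrightarrow> norm (S t x) \<le> M * t powr (\<alpha> - 1) * norm x"
      using op_fam_bound[OF S] by blast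
  \<comment> \<open>the factor \<open>s powr (1 + \<alpha>)\<close> makes the dominating function independent of \<open>s\<close>\<close>
    have "continuous_on {0<..T} (\<lambda>s. integral {0..b} (\<lambda>r. s powr (1 + \<alpha>) *\<^sub>R (b + s - r) powr (-1 - \<alpha>) *\<^sub>R S r x))"
    proof (rule continuous_on_integral_dominated[where h = "\<lambda>r. M * norm x * r powr (\<alpha> - 1)"])
      show "continuous_on {0<..<b} (\<lambda>r. s powr (1 + \<alpha>) *\<^sub>R (b + s - r) powr (-1 - \<alpha>) *\<^sub>R S r x)"
        if "s \<in> {0<..T}" for s
        by (intro continuous_intros m(1)) (use that in auto)
      show "norm (s powr (1 + \<alpha>) *\<^sub>R (b + s - r) powr (-1 - \<alpha>) *\<^sub>R S r x) \<le> M * norm x * r powr (\<alpha> - 1)"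
        if "s \<in> {0<..T}" "r \<in> {0<..<b}" for s r
      proof -
        have "(b + s - r) powr (-1 - \<alpha>) \<le> s powr (-1 - \<alpha>)"
          using that \<alpha> by (intro powr_mono2') auto
        then have "s powr (1 + \<alpha>) * (b + s - r) powr (-1 - \<alpha>) \<le> s powr (1 + \<alpha>) * s powr (-1 - \<alpha>)"
          by (rule mult_left_mono) simp
        also have "\<dots> = 1" using that by (simp add: powr_add[symmetric])
        finally have "s powr (1 + \<alpha>) * (b + s - r) powr (-1 - \<alpha>) * norm (S r x) \<le> 1 * norm (S r x)"
          by (rule mult_right_mono) simp
        then show ?thesis using M(2)[of r x] that by (simp add: mult_ac)
      qed
      show "(\<lambda>r. M * norm x * r powr (\<alpha> - 1)) integrable_on {0..b}"
        using \<alpha> b by (intro integrable_on_mult_right integrable_on_powr_from_0) auto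
      show "continuous_on {0<..T} (\<lambda>s. s powr (1 + \<alpha>) *\<^sub>R (b + s - r) powr (-1 - \<alpha>) *\<^sub>R S r x)"
        if "r \<in> {0<..<b}" for r
        by (intro continuous_intros) (use that in auto)
    qed
    then have I: "continuous_on {0<..T} (\<lambda>s. s powr (1 + \<alpha>) *\<^sub>R ?I s x)"
      by (simp only: integral_cmul)
    have "continuous_on {0<..T} (\<lambda>s. c *\<^sub>R s powr (-1 - \<alpha>) *\<^sub>R s powr (1 + \<alpha>) *\<^sub>R ?I s x)"
      by (intro continuous_on_scaleR[OF continuous_on_const continuous_on_scaleR[OF _ I]]
          continuous_intros) auto
    then show ?thesis
    proof (rule continuous_on_eq)
      fix s assume "s \<in> {0<..T}"
      then have "s powr (-1 - \<alpha>) * s powr (1 + \<alpha>) = 1" by (simp add: powr_add[symmetric])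
      then show "c *\<^sub>R s powr (-1 - \<alpha>) *\<^sub>R s powr (1 + \<alpha>) *\<^sub>R ?I s x = marchaud \<alpha> b S s x"
        by (simp add: marchaud_def c_def)
    qed
  qed
  have lin: "bounded_clinear (marchaud \<alpha> b S s)" if s: "s > 0" for s
  proof -
    have add: "?I s (x + y) = ?I s x + ?I s y" for x y
    proof -
      have "?I s (x + y) = integral {0..b} (\<lambda>r. (b + s - r) powr (-1 - \<alpha>) *\<^sub>R S r x + (b + s - r) powr (-1 - \<alpha>) *\<^sub>R S r y)"
      proof (rule integral_spike[of "{0}"])
        fix r assume "r \<in> {0..b} - {0}"
        then have "linear (S r)" using op_famD(2)[OF S, of r] by (simp add: bounded_linear.linear)
        then show "(b + s - r) powr (-1 - \<alpha>) *\<^sub>R S r x + (b + s - r) powr (-1 - \<alpha>) *\<^sub>R S r y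
          = (b + s - r) powr (-1 - \<alpha>) *\<^sub>R S r (x + y)" by (simp add: linear_add scaleR_add_right)
      qed simp
      then show ?thesis by (simp add: integral_add[OF m(4)[OF s] m(4)[OF s]])
    qed
    have scale: "marchaud \<alpha> b S s (d *\<^sub>C x) = d *\<^sub>C marchaud \<alpha> b S s x" for d x
    proof -
      have comm: "a *\<^sub>R d *\<^sub>C y = d *\<^sub>C a *\<^sub>R y" for a and y :: 'a
        by (simp only: scaleC_of_real[symmetric] scaleC_scaleC mult.commute)
      have "?I s (d *\<^sub>C x) = integral {0..b} ((*\<^sub>C) d \<circ> (\<lambda>r. (b + s - r) powr (-1 - \<alpha>) *\<^sub>R S r x))"
        by (rule integral_spike[of "{0}"]) (use op_famD(3)[OF S] in \<open>auto simp: comm\<close>)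
      then have "?I s (d *\<^sub>C x) = d *\<^sub>C ?I s x"
        by (simp only: integral_linear[OF m(4)[OF s] bounded_linear_scaleC])
      then show ?thesis by (simp add: marchaud_def comm)
    qed
    have "bounded_linear (marchaud \<alpha> b S s)"
    proof (rule bounded_linear_intro)
      show "marchaud \<alpha> b S s (x + y) = marchaud \<alpha> b S s x + marchaud \<alpha> b S s y" for x y
        by (simp add: marchaud_def add scaleR_add_right)
      show "marchaud \<alpha> b S s (r *\<^sub>R x) = r *\<^sub>R marchaud \<alpha> b S s x" for r x
        using scale[of "complex_of_real r" x] by (simp only: scaleC_of_real)
      show "norm (marchaud \<alpha> b S s x) \<le> norm x * (N * s powr (-\<alpha>))" for x
        using bd[OF s, of x] by (simp add: mult_ac)
    qed
    then show ?thesis using scale by (simp add: bounded_clinear_def)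
  qed
  show ?thesis unfolding op_fam_def using bd cont lin N by auto
qed

text \<open>The kernel acts as an approximate identity at the endpoint r = b: its mass
  \<open>J s\<close> grows like \<open>s powr (-\<alpha>) / \<alpha>\<close> and concentrates there.
  Freezing \<open>S r x\<close> at \<open>S b x\<close> leaves the error \<open>E s\<close>, which
  is negligible against that mass.\<close>

lemma marchaud_tendsto:
  assumes S: "op_fam \<alpha> b S" and b: "b > 0" and \<alpha>: "0 < \<alpha>" "\<alpha> < 1"
  shows "((\<lambda>s. s powr \<alpha> *\<^sub>R marchaud \<alpha> b S s x) \<longlongrightarrow> (1 / Gamma (1 - \<alpha>)) *\<^sub>R S b x) (at_right 0)"
proof -
  note m = marchaud_integrand[OF S b \<alpha>(1)]
  let ?k = "\<lambda>s r. (b + s - r) powr (-1 - \<alpha>)"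
  define J where "J s = (s powr (-\<alpha>) - (b + s) powr (-\<alpha>)) / \<alpha>" for s
  define E where "E s = integral {0..b} (\<lambda>r. ?k s r *\<^sub>R (S r x - S b x))" for s
  have J: "(?k s has_integral J s) {0..b}" if s: "s > 0" for s
  proof -
    have "((\<lambda>r. ?k s r) has_integral (b + s - b) powr (-\<alpha>) / \<alpha> - (b + s - 0) powr (-\<alpha>) / \<alpha>) {0..b}"
    proof (rule fundamental_theorem_of_calculus)
      fix r assume r: "r \<in> {0..b}"
      have e: "- \<alpha> - 1 = - 1 - \<alpha>" by simp
      have "((\<lambda>r. (b + s - r) powr (-\<alpha>) / \<alpha>) has_real_derivative ?k s r) (at r within {0..b})"
        using r s \<alpha> by (auto intro!: derivative_eq_intros simp: e)
      then show "((\<lambda>r. (b + s - r) powr (-\<alpha>) / \<alpha>) has_vector_derivative ?k s r) (at r within {0..b})"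
        by (simp add: has_real_derivative_iff_has_vector_derivative)
    qed (use b in simp)
    then show ?thesis by (simp add: J_def diff_divide_distrib)
  qed
  obtain M where M: "M \<ge> 0" "\<And>t x. 0 < t \<Longrightarrow> t \<le> b \<Longrightarrow> norm (S t x) \<le> M * t powr (\<alpha> - 1) * norm x"
    using op_fam_bound[OF S] by blast
  have intE: "(\<lambda>r. ?k s r *\<^sub>R (S r x - S b x)) integrable_on {0..b}" if "s > 0" for s
    using integrable_diff[OF m(4)[OF that, of x] has_integral_integrable[OF has_integral_scaleR_left[OF J[OF that], of "S b x"]]]
    by (simp add: scaleR_diff_right)
  have split: "s powr \<alpha> *\<^sub>R marchaud \<alpha> b S s x
      = (\<alpha> / Gamma (1 - \<alpha>)) *\<^sub>R (s powr \<alpha> *\<^sub>R E s + (s powr \<alpha> * J s) *\<^sub>R S b x)" if "s > 0" for s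
  proof -
    have "integral {0..b} (\<lambda>r. ?k s r *\<^sub>R S r x) = E s + J s *\<^sub>R S b x"
      using integral_add[OF intE[OF that] has_integral_integrable[OF has_integral_scaleR_left[OF J[OF that], of "S b x"]]]
        integral_unique[OF has_integral_scaleR_left[OF J[OF that], of "S b x"]]
      by (simp add: E_def scaleR_diff_right)
    then show ?thesis by (simp add: marchaud_def scaleR_add_right mult_ac)
  qed
  have limE: "((\<lambda>s. s powr \<alpha> *\<^sub>R E s) \<longlongrightarrow> 0) (at_right 0)"
    unfolding tendsto_iff
  proof (intro allI impI)
    fix e :: real assume e: "e > 0"
    \<comment> \<open>Chosen for \<open>s powr \<alpha> * J s \<le> 1 / \<alpha>\<close>: the part
      near \<open>b\<close> contributes at most \<open>e / 2\<close>, and the other half is left for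
      \<open>Q\<close>.\<close>
    define e' where "e' = e * \<alpha> / 2"
    have e': "e' > 0" using e \<alpha> by (simp add: e'_def)
    have "((\<lambda>r. S r x) \<longlongrightarrow> S b x) (at b within {0<..b})"
      using op_famD(4)[OF S] b by (simp add: continuous_on_def)
    then have "\<forall>\<^sub>F r in at b within {0<..b}. dist (S r x) (S b x) < e'"
      using e' by (rule tendstoD)
    then obtain d0 where d0: "d0 > 0" "\<And>r. r \<in> {0<..b} \<Longrightarrow> r \<noteq> b \<Longrightarrow> dist r b < d0 \<Longrightarrow> norm (S r x - S b x) < e'"
      unfolding eventually_at by (auto simp: dist_norm)
    \<comment> \<open>Away from \<open>b\<close> one has \<open>b + s - r \<ge> d0\<close>, so the
      kernel is bounded uniformly in \<open>s\<close>. The fixed bound \<open>Q\<close> is killed by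
      the factor \<open>s powr \<alpha>\<close>.\<close>
    define Q where "Q = d0 powr (-1 - \<alpha>) * integral {0..b} (\<lambda>r. M * norm x * r powr (\<alpha> - 1) + norm (S b x))"
    have int2: "(\<lambda>r. M * norm x * r powr (\<alpha> - 1) + norm (S b x)) integrable_on {0..b}"
      using \<alpha> b by (intro integrable_add integrable_on_mult_right integrable_on_powr_from_0 integrable_const_ivl) auto
    have bound: "norm (E s) \<le> e' * J s + Q" if s: "s > 0" for s
    proof -
      let ?h = "\<lambda>r. e' * ?k s r + d0 powr (-1 - \<alpha>) * (M * norm x * r powr (\<alpha> - 1) + norm (S b x))"
      have h: "(?h has_integral (e' * J s + Q)) {0..b}"
        unfolding Q_def by (intro has_integral_add has_integral_mult_right J s integrable_integral int2)
      have "norm (?k s r *\<^sub>R (S r x - S b x)) \<le> ?h r" if r: "r \<in> {0<..<b}" for r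
      proof (cases "dist r b < d0")
        case True
        then have "norm (S r x - S b x) \<le> e'" using d0(2)[of r] r by auto
        then have "?k s r * norm (S r x - S b x) \<le> ?k s r * e'" by (rule mult_left_mono) simp
        moreover have "0 \<le> d0 powr (-1 - \<alpha>) * (M * norm x * r powr (\<alpha> - 1) + norm (S b x))"
          using M(1) by simp
        ultimately show ?thesis by (simp add: mult_ac)
      next
        case False
        then have "d0 \<le> b + s - r" using r s by (auto simp: dist_real_def)
        then have "?k s r \<le> d0 powr (-1 - \<alpha>)" using d0(1) \<alpha> by (intro powr_mono2') auto
        moreover have "norm (S r x - S b x) \<le> M * norm x * r powr (\<alpha> - 1) + norm (S b x)"
          using norm_triangle_ineq4[of "S r x" "S b x"] M(2)[of r x] r by (simp add: mult_ac)
        ultimately have "?k s r * norm (S r x - S b x)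
            \<le> d0 powr (-1 - \<alpha>) * (M * norm x * r powr (\<alpha> - 1) + norm (S b x))"
          by (intro mult_mono) auto
        moreover have "0 \<le> e' * ?k s r" using e' by simp
        ultimately show ?thesis by simp
      qed
      then have "norm (E s) \<le> integral {0..b} ?h"
        unfolding E_def by (intro norm_integral_le_interior intE[OF s] has_integral_integrable[OF h])
      then show ?thesis using integral_unique[OF h] by simp
    qed
    have "((\<lambda>s. s powr \<alpha> * Q) \<longlongrightarrow> 0) (at_right 0)"
    proof -
      have "((\<lambda>s. s powr \<alpha> * Q) \<longlongrightarrow> 0 powr \<alpha> * Q) (at_right 0)"
        using \<alpha> by (intro tendsto_intros tendsto_powr') (auto simp: eventually_at_right_less intro: eventually_mono[OF eventually_at_right_less])
      then show ?thesis by simp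
    qed
    then have "\<forall>\<^sub>F s in at_right 0. s powr \<alpha> * Q < e / 2"
      by (rule order_tendstoD) (use e in simp)
    then show "\<forall>\<^sub>F s in at_right 0. dist (s powr \<alpha> *\<^sub>R E s) 0 < e"
      using eventually_at_right_less[of 0]
    proof eventually_elim
      case (elim s)
      then have s: "s > 0" by simp
      have "s powr \<alpha> * J s = (1 - s powr \<alpha> * (b + s) powr (-\<alpha>)) / \<alpha>"
        using s by (simp add: J_def right_diff_distrib powr_add[symmetric])
      also have "\<dots> \<le> 1 / \<alpha>" using \<alpha> by (intro divide_right_mono) auto
      finally have "e' * (s powr \<alpha> * J s) \<le> e' * (1 / \<alpha>)" by (rule mult_left_mono) (use e' in simp)
      also have "\<dots> = e / 2" using \<alpha> by (simp add: e'_def)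
      finally have 1: "e' * (s powr \<alpha> * J s) \<le> e / 2" .
      have "s powr \<alpha> * norm (E s) \<le> s powr \<alpha> * (e' * J s + Q)"
        by (rule mult_left_mono[OF bound[OF s]]) simp
      with 1 elim show ?case by (simp add: algebra_simps)
    qed
  qed
  have limJ: "((\<lambda>s. s powr \<alpha> * J s) \<longlongrightarrow> 1 / \<alpha>) (at_right 0)"
  proof -
    have "((\<lambda>s. (1 - s powr \<alpha> * (b + s) powr (-\<alpha>)) / \<alpha>) \<longlongrightarrow> (1 - 0 powr \<alpha> * (b + 0) powr (-\<alpha>)) / \<alpha>) (at_right 0)"
      using \<alpha> b by (intro tendsto_intros tendsto_powr') (auto intro: eventually_mono[OF eventually_at_right_less])
    then have "((\<lambda>s. (1 - s powr \<alpha> * (b + s) powr (-\<alpha>)) / \<alpha>) \<longlongrightarrow> 1 / \<alpha>) (at_right 0)" by simp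
    then show ?thesis
      by (rule Lim_transform_eventually)
        (use eventually_at_right_less[of 0] in \<open>eventually_elim,
          simp add: J_def right_diff_distrib powr_add[symmetric]\<close>)
  qed
  have "((\<lambda>s. (\<alpha> / Gamma (1 - \<alpha>)) *\<^sub>R (s powr \<alpha> *\<^sub>R E s + (s powr \<alpha> * J s) *\<^sub>R S b x))
      \<longlongrightarrow> (\<alpha> / Gamma (1 - \<alpha>)) *\<^sub>R (0 + (1 / \<alpha>) *\<^sub>R S b x)) (at_right 0)"
    by (intro tendsto_intros limE limJ)
  then have "((\<lambda>s. (\<alpha> / Gamma (1 - \<alpha>)) *\<^sub>R (s powr \<alpha> *\<^sub>R E s + (s powr \<alpha> * J s) *\<^sub>R S b x))
      \<longlongrightarrow> (1 / Gamma (1 - \<alpha>)) *\<^sub>R S b x) (at_right 0)"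
    using \<alpha> by simp
  then show ?thesis
    by (rule Lim_transform_eventually)
      (use eventually_at_right_less[of 0] in \<open>eventually_elim, simp only: split\<close>)
qed

lemma marchaud_commutes_with:
  assumes A: "closed_operator D A" and S: "op_fam \<alpha> b S" and b: "b > 0" and \<alpha>: "0 < \<alpha>"
    and comm: "commutes_with D A b S"
  shows "commutes_with D A T (marchaud \<alpha> b S)"
  unfolding commutes_with_def
proof (intro ballI)
  fix s x assume s: "s \<in> {0<..T}" and x: "x \<in> D"
  note int = marchaud_integrand(4)[OF S b \<alpha>, of s]
  note cl = closed_operatorD[OF A]
  have "(b + s - r) powr (-1 - \<alpha>) *\<^sub>R S r x \<in> D"
    "A ((b + s - r) powr (-1 - \<alpha>) *\<^sub>R S r x) = (b + s - r) powr (-1 - \<alpha>) *\<^sub>R S r (A x)"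
    if "r \<in> {0<..<b}" for r
    using comm x that cl(5,6) by (auto simp: commutes_with_def)
  from closed_operator_integral[OF A int int this] s
  show "marchaud \<alpha> b S s x \<in> D \<and> A (marchaud \<alpha> b S s x) = marchaud \<alpha> b S s (A x)"
    unfolding marchaud_def using cl(5,6) by auto
qed

text \<open>After exchanging the integrals over the rectangle, the integral in
  \<open>\<sigma>\<close> is the Abel integral with \<open>u = b - r\<close>; it turns the kernel of
  \<open>marchaud\<close> into \<open>stieltjes_kernel\<close>.\<close>

lemma rl_marchaud:
  assumes S: "op_fam \<alpha> b S" and b: "b > 0" and \<alpha>: "0 < \<alpha>" "\<alpha> < 1" and s: "s > 0"
  shows "op_conv (rl_kernel \<alpha>) (marchaud \<alpha> b S) s x = op_conv (stieltjes_kernel \<alpha> s) S b x"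
proof -
  define c where "c = \<alpha> / Gamma (1 - \<alpha>)"
  have G: "Gamma \<alpha> > 0" "Gamma (1 - \<alpha>) > 0" using \<alpha> by simp_all
  have c: "c > 0" using G \<alpha> by (simp add: c_def)
  define F where "F \<sigma> r = ((s - \<sigma>) powr (\<alpha> - 1) / Gamma \<alpha> * c * (b + \<sigma> - r) powr (-1 - \<alpha>)) *\<^sub>R S r x" for \<sigma> r
  obtain M where M: "M \<ge> 0" "\<And>t x. 0 < t \<Longrightarrow> t \<le> b \<Longrightarrow> norm (S t x) \<le> M * t powr (\<alpha> - 1) * norm x"
    using op_fam_bound[OF S] by blast
  \<comment> \<open>\<open>(b + \<sigma> - r)\<^bsup>-1-\<alpha>\<^esup> \<le> (b - r)\<^bsup>\<theta>-1\<^esup> \<sigma>\<^bsup>\<theta>-1\<^esup>\<close> separates the variables and leaves both singularities integrable\<close>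
  define \<theta> where "\<theta> = (1 - \<alpha>) / 2"
  have \<theta>: "\<theta> > 0" "-1 - \<alpha> = (\<theta> - 1) + (\<theta> - 1)" using \<alpha> by (simp_all add: \<theta>_def)
  define C where "C = c * M * norm x / Gamma \<alpha>"
  define h where "h \<sigma> r = C * (((s - \<sigma>) powr (\<alpha> - 1) * \<sigma> powr (\<theta> - 1)) * ((b - r) powr (\<theta> - 1) * r powr (\<alpha> - 1)))" for \<sigma> r
  have I1: "integral {0..b} (F \<sigma>) = rl_kernel \<alpha> (s - \<sigma>) (marchaud \<alpha> b S \<sigma> x)" for \<sigma>
    using integral_cmul[of "{0..b}" "(s - \<sigma>) powr (\<alpha> - 1) / Gamma \<alpha> * c" "\<lambda>r. (b + \<sigma> - r) powr (-1 - \<alpha>) *\<^sub>R S r x"]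
    by (simp add: F_def[abs_def] rl_kernel_def marchaud_def c_def mult_ac)
  have I2: "integral {0..s} (\<lambda>\<sigma>. F \<sigma> r) = stieltjes_kernel \<alpha> s (b - r) (S r x)" if r: "0 < r" "r < b" for r
  proof -
    have "((\<lambda>\<sigma>. ((c / Gamma \<alpha>) * ((s - \<sigma>) powr (\<alpha> - 1) * (b - r + \<sigma>) powr (-1 - \<alpha>))) *\<^sub>R S r x) has_integral
        ((c / Gamma \<alpha>) * (s powr \<alpha> * (b - r) powr (-\<alpha>) / (\<alpha> * (s + (b - r))))) *\<^sub>R S r x) {0..s}"
      by (intro has_integral_scaleR_left has_integral_mult_right has_integral_abel_kernel) (use s r \<alpha> in auto)
    moreover have "(c / Gamma \<alpha>) * (s powr \<alpha> * (b - r) powr (-\<alpha>) / (\<alpha> * (s + (b - r))))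
      = s powr \<alpha> * (b - r) powr (-\<alpha>) / ((s + (b - r)) * (Gamma \<alpha> * Gamma (1 - \<alpha>)))"
      using \<alpha> by (simp add: c_def mult_ac)
    moreover have "((c / Gamma \<alpha>) * ((s - \<sigma>) powr (\<alpha> - 1) * (b - r + \<sigma>) powr (-1 - \<alpha>))) *\<^sub>R S r x = F \<sigma> r" for \<sigma>
    proof -
      have "b - r + \<sigma> = b + \<sigma> - r" by simp
      then show ?thesis unfolding F_def by (simp only: mult_ac) simp
    qed
    ultimately show ?thesis unfolding stieltjes_kernel_def by (simp add: integral_unique)
  qed
  have "integral {0..s} (\<lambda>\<sigma>. integral {0..b} (F \<sigma>)) = integral {0..b} (\<lambda>r. integral {0..s} (\<lambda>\<sigma>. F \<sigma> r))"
  proof (rule integral_swap_open[where P = "\<lambda>\<sigma> r. 0 < \<sigma> \<and> \<sigma> < s \<and> 0 < r \<and> r < b" and h = h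
        and ?h1.0 = "\<lambda>\<sigma>. C * ((s - \<sigma>) powr (\<alpha> - 1) * \<sigma> powr (\<theta> - 1)) * (Beta \<theta> \<alpha> * b powr (\<theta> + \<alpha> - 1))"
        and ?h2.0 = "\<lambda>r. C * ((b - r) powr (\<theta> - 1) * r powr (\<alpha> - 1)) * (Beta \<alpha> \<theta> * s powr (\<alpha> + \<theta> - 1))"])
    show "open {(\<sigma>, r). 0 < \<sigma> \<and> \<sigma> < s \<and> 0 < r \<and> r < b}"
      unfolding case_prod_unfold
      by (intro open_Collect_conj open_Collect_less continuous_intros)
    show "continuous_on {(\<sigma>, r). 0 < \<sigma> \<and> \<sigma> < s \<and> 0 < r \<and> r < b} (\<lambda>(\<sigma>, r). F \<sigma> r)"
      unfolding F_def case_prod_unfold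
      by (intro continuous_on_compose2[OF op_famD(4)[OF S]] continuous_intros) (use G in auto)
    show "norm (F \<sigma> r) \<le> h \<sigma> r" if "0 < \<sigma> \<and> \<sigma> < s \<and> 0 < r \<and> r < b" for \<sigma> r
    proof -
      have "(b + \<sigma> - r) powr (-1 - \<alpha>) \<le> (b - r) powr (\<theta> - 1) * \<sigma> powr (\<theta> - 1)"
        unfolding \<theta>(2) powr_add using that \<alpha> by (intro mult_mono powr_mono2') (auto simp: \<theta>_def)
      then have "(b + \<sigma> - r) powr (-1 - \<alpha>) * norm (S r x)
        \<le> ((b - r) powr (\<theta> - 1) * \<sigma> powr (\<theta> - 1)) * (M * r powr (\<alpha> - 1) * norm x)"
        using M that by (intro mult_mono) auto
      then have "((s - \<sigma>) powr (\<alpha> - 1) / Gamma \<alpha> * c) * ((b + \<sigma> - r) powr (-1 - \<alpha>) * norm (S r x))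
        \<le> ((s - \<sigma>) powr (\<alpha> - 1) / Gamma \<alpha> * c) * (((b - r) powr (\<theta> - 1) * \<sigma> powr (\<theta> - 1)) * (M * r powr (\<alpha> - 1) * norm x))"
        using G c by (intro mult_left_mono) auto
      then show ?thesis using G c by (simp add: F_def h_def C_def abs_mult mult_ac)
    qed
    show "(h \<sigma> has_integral C * ((s - \<sigma>) powr (\<alpha> - 1) * \<sigma> powr (\<theta> - 1)) * (Beta \<theta> \<alpha> * b powr (\<theta> + \<alpha> - 1))) {0..b}" for \<sigma>
      using has_integral_mult_right[OF has_integral_powr_convolution[OF \<theta>(1) \<alpha>(1), of b], of "C * ((s - \<sigma>) powr (\<alpha> - 1) * \<sigma> powr (\<theta> - 1))"] b
      by (simp add: h_def[abs_def] mult_ac)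
    show "((\<lambda>\<sigma>. h \<sigma> r) has_integral C * ((b - r) powr (\<theta> - 1) * r powr (\<alpha> - 1)) * (Beta \<alpha> \<theta> * s powr (\<alpha> + \<theta> - 1))) {0..s}" for r
      using has_integral_mult_right[OF has_integral_powr_convolution[OF \<alpha>(1) \<theta>(1), of s], of "C * ((b - r) powr (\<theta> - 1) * r powr (\<alpha> - 1))"] s
      by (simp add: h_def[abs_def] mult_ac)
    show "(\<lambda>\<sigma>. C * ((s - \<sigma>) powr (\<alpha> - 1) * \<sigma> powr (\<theta> - 1)) * (Beta \<theta> \<alpha> * b powr (\<theta> + \<alpha> - 1))) integrable_on {0..s}"
      by (intro integrable_on_mult_right integrable_on_mult_left
          has_integral_integrable[OF has_integral_powr_convolution[OF \<alpha>(1) \<theta>(1)]]) (use s in simp)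
    show "(\<lambda>r. C * ((b - r) powr (\<theta> - 1) * r powr (\<alpha> - 1)) * (Beta \<alpha> \<theta> * s powr (\<alpha> + \<theta> - 1))) integrable_on {0..b}"
      by (intro integrable_on_mult_right integrable_on_mult_left
          has_integral_integrable[OF has_integral_powr_convolution[OF \<theta>(1) \<alpha>(1)]]) (use b in simp)
    show "continuous_on {0<..<s} (\<lambda>\<sigma>. integral {0..b} (F \<sigma>))"
      unfolding I1 by (rule op_conv_integrand(1)[OF op_fam_rl[OF \<alpha>(1)] op_fam_marchaud[OF S b \<alpha>] order_refl])
    have "continuous_on {0<..<b} (\<lambda>r. stieltjes_kernel \<alpha> s (b - r) (S r x))"
      by (rule op_conv_integrand(1)[OF op_fam_stieltjes[OF \<alpha> s] S order_refl])
    then show "continuous_on {0<..<b} (\<lambda>r. integral {0..s} (\<lambda>\<sigma>. F \<sigma> r))"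
      by (rule continuous_on_eq) (simp add: I2)
  qed auto
  also have "\<dots> = op_conv (stieltjes_kernel \<alpha> s) S b x"
    unfolding op_conv_def by (rule integral_spike[of "{0, b}"]) (auto simp: I2)
  finally show ?thesis unfolding op_conv_def I1 .
qed

section \<open>The extension step\<close>

text \<open>Condition (iii) for a = k = \<open>g \<alpha>\<close> on (0,T], without its
  integrability clause, which \<open>op_fam\<close> provides.\<close>

definition resolvent_eq where
  "resolvent_eq \<alpha> D A T S \<longleftrightarrow> (\<forall>t\<in>{0<..T}. \<forall>x.
    op_conv (rl_kernel \<alpha>) S t x \<in> D \<and> A (op_conv (rl_kernel \<alpha>) S t x) = S t x - rl_kernel \<alpha> t x)"

text \<open>The resolvent equation is applied under the integral sign: \<open>K\<close> commutes
  with \<open>A\<close>, and closedness lets \<open>A\<close> pass through the outer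
  convolution.\<close>

lemma op_conv_resolvent:
  assumes A: "closed_operator D A" and K: "op_fam p T K" and S: "op_fam \<alpha> T S"
    and p: "p > 0" and \<alpha>: "\<alpha> > 0" and t: "0 < t" "t \<le> T"
    and eq: "resolvent_eq \<alpha> D A T S" and comm: "commutes_with D A T K"
  shows "op_conv K (op_conv (rl_kernel \<alpha>) S) t x \<in> D"
    and "A (op_conv K (op_conv (rl_kernel \<alpha>) S) t x) = op_conv K S t x - op_conv K (rl_kernel \<alpha>) t x"
proof -
  have GS: "op_fam (\<alpha> + \<alpha>) T (op_conv (rl_kernel \<alpha>) S)" using \<alpha> by (intro op_fam_op_conv op_fam_rl S)
  have t0: "0 \<le> t" using t by simp
  have int1: "(\<lambda>r. K (t - r) (op_conv (rl_kernel \<alpha>) S r x)) integrable_on {0..t}"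
    using op_conv_integrable(1)[OF K GS p _ t0 t(2)] \<alpha> by simp
  note int2 = op_conv_integrable(1)[OF K S p \<alpha> t0 t(2)]
    and int3 = op_conv_integrable(1)[OF K op_fam_rl[OF \<alpha>] p \<alpha> t0 t(2)]
  have "K (t - r) (op_conv (rl_kernel \<alpha>) S r x) \<in> D"
    "A (K (t - r) (op_conv (rl_kernel \<alpha>) S r x)) = K (t - r) (S r x) - K (t - r) (rl_kernel \<alpha> r x)"
    if r: "r \<in> {0<..<t}" for r
  proof -
    have 1: "op_conv (rl_kernel \<alpha>) S r x \<in> D" "A (op_conv (rl_kernel \<alpha>) S r x) = S r x - rl_kernel \<alpha> r x"
      using eq r t by (auto simp: resolvent_eq_def)
    have rng: "t - r \<in> {0<..T}" using r t by auto
    have "linear (K (t - r))" using op_famD(2)[OF K] rng by (simp add: bounded_linear.linear)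
    then show "K (t - r) (op_conv (rl_kernel \<alpha>) S r x) \<in> D"
      "A (K (t - r) (op_conv (rl_kernel \<alpha>) S r x)) = K (t - r) (S r x) - K (t - r) (rl_kernel \<alpha> r x)"
      using comm rng 1 by (auto simp: commutes_with_def linear_diff)
  qed
  from closed_operator_integral[OF A int1 integrable_diff[OF int2 int3] this]
  show "op_conv K (op_conv (rl_kernel \<alpha>) S) t x \<in> D"
    "A (op_conv K (op_conv (rl_kernel \<alpha>) S) t x) = op_conv K S t x - op_conv K (rl_kernel \<alpha>) t x"
    unfolding op_conv_def[of K] by (simp_all add: integral_diff[OF int2 int3])
qed

text \<open>Filling in the limit at 0 yields a continuous function on a compact interval. This
  serves both the continuity at the joint and the pointwise bounds fed to the uniform boundedness
  principle.\<close>

lemma continuous_on_Icc_extend: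
  fixes f :: "real \<Rightarrow> 'a::topological_space"
  assumes T: "T > 0" and f: "continuous_on {0<..T} f" and lim: "(f \<longlongrightarrow> l) (at_right 0)"
  shows "continuous_on {0..T} (\<lambda>s. if s = 0 then l else f s)" (is "continuous_on _ ?v")
  unfolding continuous_on_def
proof
  fix s0 assume s0: "s0 \<in> {0..T}"
  show "(?v \<longlongrightarrow> ?v s0) (at s0 within {0..T})"
  proof (cases "s0 = 0")
    case True
    have "at 0 within {0..T} = at_right 0" using T by (rule at_within_Icc_at_right)
    moreover have "(?v \<longlongrightarrow> l) (at_right 0)"
      by (rule Lim_transform_eventually[OF lim])
        (use eventually_at_right_less[of 0] in \<open>eventually_elim, simp\<close>)
    ultimately show ?thesis using True by simp
  next
    case False
    have "(f \<longlongrightarrow> f s0) (at s0 within {0<..T})"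
      using f s0 False by (simp add: continuous_on_def)
    moreover have "at s0 within {0<..T} = at s0 within {0..T}"
      by (rule at_within_nhd[of _ "{0<..}"]) (use s0 False in auto)
    ultimately have "(f \<longlongrightarrow> ?v s0) (at s0 within {0..T})" using False by simp
    then show ?thesis
    proof (rule Lim_transform_eventually)
      have "\<forall>\<^sub>F s in at s0 within {0..T}. s \<noteq> 0"
        using False by (intro tendsto_imp_eventually_ne[OF tendsto_ident_at])
      then show "\<forall>\<^sub>F s in at s0 within {0..T}. f s = ?v s"
        by eventually_elim simp
    qed
  qed
qed

text \<open>One step of \<open>extension\<close>, with \<open>b\<close> and \<open>S\<close>
  abstracted from the recursion; \<open>b\<close> and the step length \<open>T\<close> become
  independent.\<close>

definition glued :: "real \<Rightarrow> real \<Rightarrow> (real \<Rightarrow> 'a \<Rightarrow> 'a) \<Rightarrow> (real \<Rightarrow> 'a \<Rightarrow> 'a) \<Rightarrow>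
    real \<Rightarrow> 'a \<Rightarrow> 'a::complex_banach"
  where "glued \<alpha> b S L t x = (if t \<le> b then S t x else op_conv (marchaud \<alpha> b S) L (t - b) x)"

section \<open>One step from (0,b] to (0,b+T]\<close>

context
  fixes D :: "'a::complex_banach set" and A :: "'a \<Rightarrow> 'a" and \<alpha> b T :: real
    and S L :: "real \<Rightarrow> 'a \<Rightarrow> 'a"
  assumes A: "closed_operator D A" and \<alpha>: "0 < \<alpha>" "\<alpha> < 1" and b: "0 < b" and T: "0 < T"
    and S: "op_fam \<alpha> b S" "commutes_with D A b S" "resolvent_eq \<alpha> D A b S"
    and L: "op_fam \<alpha> T L" "commutes_with D A T L" "resolvent_eq \<alpha> D A T L"
    and L0: "\<And>x. ((\<lambda>t. t powr (1 - \<alpha>) *\<^sub>R L t x) \<longlongrightarrow> (1 / Gamma \<alpha>) *\<^sub>R x) (at_right 0)"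
begin

lemma op_fam_step: "op_fam 1 T (op_conv (marchaud \<alpha> b S) L)"
  using op_fam_op_conv[OF op_fam_marchaud[OF S(1) b \<alpha>] L(1)] \<alpha> by simp

lemma step_tendsto: "((\<lambda>s. op_conv (marchaud \<alpha> b S) L s x) \<longlongrightarrow> S b x) (at_right 0)"
proof -
  have G: "Gamma \<alpha> > 0" "Gamma (1 - \<alpha>) > 0" using \<alpha> by simp_all
  have lin: "linear (S b)" using op_famD(2)[OF S(1) b] by (simp add: bounded_linear.linear)
  have "((\<lambda>s. s powr (1 - (1 - \<alpha>) - \<alpha>) *\<^sub>R op_conv (marchaud \<alpha> b S) L s x) \<longlongrightarrow>
      Beta (1 - \<alpha>) \<alpha> *\<^sub>R (1 / Gamma (1 - \<alpha>)) *\<^sub>R S b ((1 / Gamma \<alpha>) *\<^sub>R x)) (at_right 0)"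
    by (rule op_conv_tendsto[OF op_fam_marchaud[OF S(1) b \<alpha>] L(1) _ \<alpha>(1) T _ L0])
      (use \<alpha> marchaud_tendsto[OF S(1) b \<alpha>] in auto)
  moreover have "Beta (1 - \<alpha>) \<alpha> *\<^sub>R (1 / Gamma (1 - \<alpha>)) *\<^sub>R S b ((1 / Gamma \<alpha>) *\<^sub>R x) = S b x"
    using G by (simp add: Beta_def linear_scale[OF lin])
  ultimately have "((\<lambda>s. s powr 0 *\<^sub>R op_conv (marchaud \<alpha> b S) L s x) \<longlongrightarrow> S b x) (at_right 0)"
    by simp
  then show ?thesis
    by (rule Lim_transform_eventually)
      (use eventually_at_right_less[of 0] in \<open>eventually_elim, simp\<close>)
qed

lemma op_fam_glued: "op_fam \<alpha> (b + T) (glued \<alpha> b S L)"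
proof -
  let ?w = "op_conv (marchaud \<alpha> b S) L"
  obtain M where M: "M \<ge> 0" "\<And>t x. 0 < t \<Longrightarrow> t \<le> b \<Longrightarrow> norm (S t x) \<le> M * t powr (\<alpha> - 1) * norm x"
    using op_fam_bound[OF S(1)] by blast
  obtain N where N: "N \<ge> 0" "\<And>t x. 0 < t \<Longrightarrow> t \<le> T \<Longrightarrow> norm (?w t x) \<le> N * t powr (1 - 1) * norm x"
    using op_fam_bound[OF op_fam_step] by blast
  \<comment> \<open>The new piece is bounded by \<open>N\<close>. As
    \<open>t powr (\<alpha> - 1)\<close> is at least \<open>(b + T) powr (\<alpha> - 1)\<close> on
    the whole interval, the second entry turns \<open>N\<close> into a bound of the required
    shape.\<close>
  define C where "C = max M (N * (b + T) powr (1 - \<alpha>))"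
  have bd: "norm (glued \<alpha> b S L t x) \<le> C * t powr (\<alpha> - 1) * norm x" if t: "t \<in> {0<..b + T}" for t x
  proof (cases "t \<le> b")
    case True
    have "norm (S t x) \<le> M * t powr (\<alpha> - 1) * norm x" using M(2) t True by auto
    also have "\<dots> \<le> C * t powr (\<alpha> - 1) * norm x" by (intro mult_right_mono) (auto simp: C_def)
    finally show ?thesis using True by (simp add: glued_def)
  next
    case False
    have "norm (?w (t - b) x) \<le> N * (t - b) powr (1 - 1) * norm x" using False t by (intro N(2)) auto
    also have "\<dots> = N * 1 * norm x" using False by simp
    also have "\<dots> \<le> N * ((b + T) powr (1 - \<alpha>) * t powr (\<alpha> - 1)) * norm x"
    proof -
      have "(b + T) powr (1 - \<alpha>) * (b + T) powr (\<alpha> - 1) = 1" using b T by (simp add: powr_add[symmetric])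
      moreover have "(b + T) powr (\<alpha> - 1) \<le> t powr (\<alpha> - 1)" using t \<alpha> by (intro powr_mono2') auto
      ultimately have "1 \<le> (b + T) powr (1 - \<alpha>) * t powr (\<alpha> - 1)"
        by (metis mult_left_mono powr_ge_zero)
      then show ?thesis using N(1) by (intro mult_right_mono mult_left_mono) auto
    qed
    also have "\<dots> = (N * (b + T) powr (1 - \<alpha>)) * t powr (\<alpha> - 1) * norm x" by simp
    also have "\<dots> \<le> C * t powr (\<alpha> - 1) * norm x" by (intro mult_right_mono) (auto simp: C_def)
    finally show ?thesis using False by (simp add: glued_def)
  qed
  have lin: "bounded_clinear (glued \<alpha> b S L t)" if t: "t \<in> {0<..b + T}" for t
  proof (cases "t \<le> b")
    case True
    then have "glued \<alpha> b S L t = S t" by (auto simp: glued_def)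
    then show ?thesis using op_famD(1)[OF S(1)] True t by auto
  next
    case False
    then have "glued \<alpha> b S L t = ?w (t - b)" by (auto simp: glued_def)
    then show ?thesis using op_famD(1)[OF op_fam_step, of "t - b"] False t by auto
  qed
  have cont: "continuous_on {0<..b + T} (\<lambda>t. glued \<alpha> b S L t x)" for x
  proof -
    \<comment> \<open>\<open>?w 0 x\<close> is an integral over a single point, hence 0. The limit
      \<open>S b x\<close> has to replace it for the two pieces to agree at
      \<open>b\<close>.\<close>
    define v where "v s = (if s = 0 then S b x else ?w s x)" for s
    have v: "continuous_on {0..T} v"
      unfolding v_def by (rule continuous_on_Icc_extend[OF T op_famD(4)[OF op_fam_step] step_tendsto])
    have "continuous_on {0<..b + T} (\<lambda>t. if t \<le> b then S t x else v (t - b))"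
    proof (rule continuous_on_cases_le)
      show "continuous_on {t \<in> {0<..b + T}. t \<le> b} (\<lambda>t. S t x)"
        by (rule continuous_on_subset[OF op_famD(4)[OF S(1)]]) auto
      show "continuous_on {t \<in> {0<..b + T}. b \<le> t} (\<lambda>t. v (t - b))"
        by (rule continuous_on_compose2[OF v]) (auto intro!: continuous_intros)
    qed (auto simp: v_def)
    then show ?thesis by (rule continuous_on_eq) (auto simp: glued_def v_def)
  qed
  show ?thesis unfolding op_fam_def using bd cont lin M(1) by (auto simp: C_def intro!: exI[of _ C])
qed

lemma glued_commutes_with: "commutes_with D A (b + T) (glued \<alpha> b S L)"
proof -
  have "commutes_with D A T (op_conv (marchaud \<alpha> b S) L)"
    by (rule op_conv_commutes_with[OF A op_fam_marchaud[OF S(1) b \<alpha>] L(1) _ \<alpha>(1)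
          marchaud_commutes_with[OF A S(1) b \<alpha>(1) S(2)] L(2)]) (use \<alpha> in simp)
  then show ?thesis using S(2) by (auto simp: commutes_with_def glued_def)
qed

text \<open>The kernel \<open>g\<close> must be moved past \<open>marchaud\<close> to reach
  \<open>L\<close>, whose resolvent equation is known: regroup, commute the scalar kernel, regroup
  again.\<close>

lemma op_conv_rl_step:
  assumes s: "0 < s" "s \<le> T"
  shows "op_conv (rl_kernel \<alpha>) (op_conv (marchaud \<alpha> b S) L) s x \<in> D"
    and "A (op_conv (rl_kernel \<alpha>) (op_conv (marchaud \<alpha> b S) L) s x)
      = op_conv (marchaud \<alpha> b S) L s x - op_conv (stieltjes_kernel \<alpha> s) S b x"
proof -
  let ?H = "marchaud \<alpha> b S"
  have H: "op_fam (1 - \<alpha>) T ?H" by (rule op_fam_marchaud[OF S(1) b \<alpha>])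
  have G: "op_fam \<alpha> T (rl_kernel \<alpha> :: real \<Rightarrow> 'a \<Rightarrow> 'a)" by (rule op_fam_rl[OF \<alpha>(1)])
  have \<alpha>': "1 - \<alpha> > 0" using \<alpha> by simp
  have comm: "op_conv (rl_kernel \<alpha>) ?H t y = op_conv ?H (rl_kernel \<alpha>) t y" if "0 < t" "t \<le> T" for t y
    unfolding rl_kernel_def[abs_def] by (rule op_conv_scalar_commute[OF H that])
  have "op_conv (rl_kernel \<alpha>) (op_conv ?H L) s x = op_conv (op_conv (rl_kernel \<alpha>) ?H) L s x"
    by (rule op_conv_assoc[OF G H L(1) \<alpha>(1) \<alpha>' \<alpha>(1) s])
  also have "\<dots> = op_conv (op_conv ?H (rl_kernel \<alpha>)) L s x"
    unfolding op_conv_def[of _ L] by (rule integral_spike[of "{s}"]) (use s comm in auto)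
  also have "\<dots> = op_conv ?H (op_conv (rl_kernel \<alpha>) L) s x"
    by (rule op_conv_assoc[OF H G L(1) \<alpha>' \<alpha>(1) \<alpha>(1) s, symmetric])
  finally have e: "op_conv (rl_kernel \<alpha>) (op_conv ?H L) s x = op_conv ?H (op_conv (rl_kernel \<alpha>) L) s x" .
  note r = op_conv_resolvent[OF A H L(1) \<alpha>' \<alpha>(1) s L(3) marchaud_commutes_with[OF A S(1) b \<alpha>(1) S(2)], of x]
  show "op_conv (rl_kernel \<alpha>) (op_conv ?H L) s x \<in> D" unfolding e by (rule r(1))
  show "A (op_conv (rl_kernel \<alpha>) (op_conv ?H L) s x) = op_conv ?H L s x - op_conv (stieltjes_kernel \<alpha> s) S b x"
    unfolding e r(2) comm[OF s, symmetric] rl_marchaud[OF S(1) b \<alpha> s(1)] ..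
qed

text \<open>The kernel is evaluated beyond \<open>b\<close>, so \<open>E\<close> is not a
  convolution of \<open>g\<close> with \<open>S\<close> at a time where the equation for
  \<open>S\<close> is available. The Stieltjes kernel rewrites it through the convolution up to time
  \<open>b\<close>.\<close>

lemma rl_history:
  fixes x :: 'a
  assumes s: "0 < s"
  defines "E \<equiv> integral {0..b} (\<lambda>r. rl_kernel \<alpha> (b + s - r) (S r x))"
  shows "E \<in> D" and "A E = op_conv (stieltjes_kernel \<alpha> s) S b x - rl_kernel \<alpha> (b + s) x"
proof -
  let ?K = "stieltjes_kernel \<alpha> s :: real \<Rightarrow> 'a \<Rightarrow> 'a"
  have K: "op_fam (1 - \<alpha>) b ?K" by (rule op_fam_stieltjes[OF \<alpha> s])
  have G: "op_fam \<alpha> b (rl_kernel \<alpha> :: real \<Rightarrow> 'a \<Rightarrow> 'a)" by (rule op_fam_rl[OF \<alpha>(1)])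
  have \<alpha>': "1 - \<alpha> > 0" using \<alpha> by simp
  have comm: "commutes_with D A b ?K"
    using closed_operatorD(5,6)[OF A] by (simp add: commutes_with_def stieltjes_kernel_def)
  have "E = op_conv (op_conv ?K (rl_kernel \<alpha>)) S b x"
    unfolding E_def op_conv_def[of _ S]
  proof (rule integral_spike[of "{b}"])
    fix r assume "r \<in> {0..b} - {b}"
    then have "op_conv ?K (rl_kernel \<alpha>) (b - r) (S r x) = rl_kernel \<alpha> (s + (b - r)) (S r x)"
      by (intro op_conv_stieltjes_rl \<alpha> s) auto
    moreover have "s + (b - r) = b + s - r" by simp
    ultimately show "op_conv ?K (rl_kernel \<alpha>) (b - r) (S r x) = rl_kernel \<alpha> (b + s - r) (S r x)" by simp
  qed simp
  then have e: "E = op_conv ?K (op_conv (rl_kernel \<alpha>) S) b x"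
    by (simp add: op_conv_assoc[OF K G S(1) \<alpha>' \<alpha>(1) \<alpha>(1) b order_refl])
  note r = op_conv_resolvent[OF A K S(1) \<alpha>' \<alpha>(1) b order_refl S(3) comm, of x]
  show "E \<in> D" unfolding e by (rule r(1))
  show "A E = op_conv ?K S b x - rl_kernel \<alpha> (b + s) x"
    unfolding e r(2) op_conv_stieltjes_rl[OF \<alpha> s b] by (simp add: add.commute)
qed

lemma glued_resolvent_eq: "resolvent_eq \<alpha> D A (b + T) (glued \<alpha> b S L)"
  unfolding resolvent_eq_def
proof (intro ballI allI)
  fix t x assume t: "t \<in> {0<..b + T}"
  show "op_conv (rl_kernel \<alpha>) (glued \<alpha> b S L) t x \<in> D \<and> A (op_conv (rl_kernel \<alpha>) (glued \<alpha> b S L) t x) = glued \<alpha> b S L t x - rl_kernel \<alpha> t x"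
  proof (cases "t \<le> b")
    case True
    have "op_conv (rl_kernel \<alpha>) (glued \<alpha> b S L) t x = op_conv (rl_kernel \<alpha>) S t x"
      unfolding op_conv_def by (rule integral_cong) (use True in \<open>auto simp: glued_def\<close>)
    then show ?thesis using S(3) True t by (simp add: resolvent_eq_def glued_def)
  next
    case False
    define s where "s = t - b"
    have s: "0 < s" "s \<le> T" "t = b + s" using False t by (auto simp: s_def)
    let ?w = "op_conv (marchaud \<alpha> b S) L"
    let ?E = "integral {0..b} (\<lambda>r. rl_kernel \<alpha> (b + s - r) (S r x))"
    have int: "(\<lambda>r. rl_kernel \<alpha> (t - r) (glued \<alpha> b S L r x)) integrable_on {0..t}"
      using t by (intro op_conv_integrable(1)[OF op_fam_rl[OF \<alpha>(1)] op_fam_glued \<alpha>(1) \<alpha>(1)]) auto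
    have "op_conv (rl_kernel \<alpha>) (glued \<alpha> b S L) t x = integral {0..b} (\<lambda>r. rl_kernel \<alpha> (t - r) (glued \<alpha> b S L r x)) + integral {b..t} (\<lambda>r. rl_kernel \<alpha> (t - r) (glued \<alpha> b S L r x))"
      unfolding op_conv_def by (rule Henstock_Kurzweil_Integration.integral_combine[symmetric, OF _ _ int]) (use b False in auto)
    also have "integral {0..b} (\<lambda>r. rl_kernel \<alpha> (t - r) (glued \<alpha> b S L r x)) = ?E"
      by (rule integral_cong) (auto simp: glued_def s(3))
    \<comment> \<open>At r = b the glued family still takes its value from \<open>S\<close>, so this
      single point is discarded.\<close>
    also have "integral {b..t} (\<lambda>r. rl_kernel \<alpha> (t - r) (glued \<alpha> b S L r x)) = integral {b..t} (\<lambda>r. rl_kernel \<alpha> (s - (r - b)) (?w (r - b) x))"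
      by (rule integral_spike[of "{b}"]) (auto simp: glued_def s(3) diff_diff_eq2 add.commute)
    also have "\<dots> = op_conv (rl_kernel \<alpha>) ?w s x"
      unfolding integral_shift[of b t "\<lambda>r. rl_kernel \<alpha> (s - r) (?w r x)"] by (simp add: op_conv_def s(3))
    finally have e: "op_conv (rl_kernel \<alpha>) (glued \<alpha> b S L) t x = ?E + op_conv (rl_kernel \<alpha>) ?w s x" .
    note 1 = rl_history[OF s(1), of x] and 2 = op_conv_rl_step[OF s(1,2), of x]
    have "glued \<alpha> b S L t x = ?w s x" using False by (simp add: glued_def s_def)
    then show ?thesis
      unfolding e using closed_operatorD(3,4)[OF A 1(1) 2(1)] 1(2) 2(2) by (simp add: s(3))
  qed
qed

end

section \<open>Regularized resolvent families\<close>

text \<open>At t = 0 both sides are 0, since a power of 0 is 0 here. The integrands of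
  \<open>conv\<close> and \<open>op_conv\<close> thus agree on the whole closed interval.\<close>

lemma g_scaleC: "t \<ge> 0 \<Longrightarrow> g \<alpha> t *\<^sub>C x = rl_kernel \<alpha> t x"
  using scaleC_of_real[of 0 x]
  by (auto simp: g_def rl_kernel_def scaleC_of_real[symmetric] simp del: of_real_divide)

lemma conv_g: "conv (g \<alpha>) (\<lambda>s. S s x) t = op_conv (rl_kernel \<alpha>) S t x"
  unfolding conv_def op_conv_def by (rule integral_cong) (simp add: g_scaleC)

lemma inverse_g_scaleC:
  assumes "0 < \<alpha>" "t > 0"
  shows "inverse (g \<alpha> t) *\<^sub>C x = Gamma \<alpha> *\<^sub>R t powr (1 - \<alpha>) *\<^sub>R x"
proof -
  have "inverse (t powr (\<alpha> - 1) / Gamma \<alpha>) = Gamma \<alpha> * t powr (1 - \<alpha>)"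
    using powr_minus[of t "\<alpha> - 1"] by (simp add: inverse_eq_divide)
  then have "inverse (g \<alpha> t) = complex_of_real (Gamma \<alpha> * t powr (1 - \<alpha>))"
    using assms by (simp only: g_def if_True of_real_inverse[symmetric])
  then show ?thesis by (simp only: scaleC_of_real scaleR_scaleR)
qed

lemma g_regular:
  assumes "0 < \<alpha>"
  shows "g \<alpha> absolutely_integrable_on {0..b}" and "continuous_on {0<..} (g \<alpha>)"
    and "t > 0 \<Longrightarrow> g \<alpha> t \<noteq> 0"
proof -
  have G: "Gamma \<alpha> > 0" using assms by simp
  have eq: "g \<alpha> t = complex_of_real (t powr (\<alpha> - 1) / Gamma \<alpha>)" if "t \<ge> 0" for t
    using that by (auto simp: g_def)
  have int: "(\<lambda>t. t powr (\<alpha> - 1) / Gamma \<alpha>) integrable_on {0..b}"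
  proof (cases "b \<ge> 0")
    case True
    then show ?thesis using assms by (intro integrable_on_divide integrable_on_powr_from_0) auto
  qed (simp add: integrable_on_empty)
  have "(complex_of_real \<circ> (\<lambda>t. t powr (\<alpha> - 1) / Gamma \<alpha>)) integrable_on {0..b}"
    by (rule integrable_linear[OF int bounded_linear_of_real])
  then have 1: "g \<alpha> integrable_on {0..b}" by (rule integrable_eq) (simp add: eq)
  have 2: "(\<lambda>t. norm (g \<alpha> t)) integrable_on {0..b}"
    using int by (rule integrable_eq) (use G in \<open>simp add: eq norm_divide del: of_real_divide\<close>)
  show "g \<alpha> absolutely_integrable_on {0..b}" by (rule absolutely_integrable_onI[OF 1 2])
  have "continuous_on {0<..} (\<lambda>t. complex_of_real (t powr (\<alpha> - 1) / Gamma \<alpha>))"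
    by (intro continuous_intros) (use G in auto)
  then show "continuous_on {0<..} (g \<alpha>)" by (rule continuous_on_eq) (simp add: eq)
  show "g \<alpha> t \<noteq> 0" if "t > 0" using that G by (simp add: g_def)
qed

text \<open>The power bound in \<open>op_fam\<close> is the one item that the definition does not
  state. The hypothesis on \<open>I\<close> covers open and half-closed index intervals
  alike.\<close>

lemma regularized_resolvent_familyD:
  assumes R: "regularized_resolvent_family (g \<alpha>) (g \<alpha>) I D A S" and \<alpha>: "0 < \<alpha>"
    and b: "0 < b" "{0<..b} \<subseteq> I"
  shows "op_fam \<alpha> b S" and "commutes_with D A b S" and "resolvent_eq \<alpha> D A b S"
    and "\<And>x. ((\<lambda>t. t powr (1 - \<alpha>) *\<^sub>R S t x) \<longlongrightarrow> (1 / Gamma \<alpha>) *\<^sub>R x) (at_right 0)"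
proof -
  have G: "Gamma \<alpha> > 0" using \<alpha> by simp
  have lin: "\<And>t. t \<in> I \<Longrightarrow> bounded_clinear (S t)" and cont: "\<And>x. continuous_on I (\<lambda>t. S t x)"
    and lim: "\<And>x. ((\<lambda>t. inverse (g \<alpha> t) *\<^sub>C S t x) \<longlongrightarrow> x) (at_right 0)"
    and comm: "\<And>t x. t \<in> I \<Longrightarrow> x \<in> D \<Longrightarrow> S t x \<in> D \<and> A (S t x) = S t (A x)"
    and eq: "\<And>t x. t \<in> I \<Longrightarrow> conv (g \<alpha>) (\<lambda>s. S s x) t \<in> D \<and>
      A (conv (g \<alpha>) (\<lambda>s. S s x) t) = S t x - g \<alpha> t *\<^sub>C x"
    using R unfolding regularized_resolvent_family_def by blast+
  show lim': "((\<lambda>t. t powr (1 - \<alpha>) *\<^sub>R S t x) \<longlongrightarrow> (1 / Gamma \<alpha>) *\<^sub>R x) (at_right 0)" for x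
  proof -
    have "((\<lambda>t. (1 / Gamma \<alpha>) *\<^sub>R (inverse (g \<alpha> t) *\<^sub>C S t x)) \<longlongrightarrow> (1 / Gamma \<alpha>) *\<^sub>R x) (at_right 0)"
      by (intro tendsto_intros lim)
    then show ?thesis
    proof (rule Lim_transform_eventually)
      show "\<forall>\<^sub>F t in at_right 0. (1 / Gamma \<alpha>) *\<^sub>R (inverse (g \<alpha> t) *\<^sub>C S t x) = t powr (1 - \<alpha>) *\<^sub>R S t x"
        using eventually_at_right_less[of 0]
        by eventually_elim (use G \<alpha> in \<open>simp add: inverse_g_scaleC less_imp_neq[symmetric]\<close>)
    qed
  qed
  show "commutes_with D A b S" using comm b by (auto simp: commutes_with_def)
  show "resolvent_eq \<alpha> D A b S"
    unfolding resolvent_eq_def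
  proof (intro ballI allI)
    fix t x assume "t \<in> {0<..b}"
    then show "op_conv (rl_kernel \<alpha>) S t x \<in> D \<and> A (op_conv (rl_kernel \<alpha>) S t x) = S t x - rl_kernel \<alpha> t x"
      using eq[of t x] b by (auto simp: conv_g g_scaleC)
  qed
  \<comment> \<open>By condition (i) each normalized orbit extends continuously to [0,b] and is
    bounded. Uniform boundedness then makes the constant linear in \<open>norm x\<close>.\<close>
  have "\<exists>c. \<forall>t\<in>{0<..b}. norm (t powr (1 - \<alpha>) *\<^sub>R S t x) \<le> c" for x
  proof -
    have "continuous_on {0<..b} (\<lambda>t. t powr (1 - \<alpha>) *\<^sub>R S t x)"
      by (intro continuous_intros continuous_on_subset[OF cont b(2)]) auto
    from continuous_on_Icc_extend[OF b(1) this lim']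
    have "bounded ((\<lambda>t. if t = 0 then (1 / Gamma \<alpha>) *\<^sub>R x else t powr (1 - \<alpha>) *\<^sub>R S t x) ` {0..b})"
      by (intro compact_imp_bounded compact_continuous_image compact_Icc)
    then obtain c where c: "\<And>t. t \<in> {0..b} \<Longrightarrow>
        norm (if t = 0 then (1 / Gamma \<alpha>) *\<^sub>R x else t powr (1 - \<alpha>) *\<^sub>R S t x) \<le> c"
      unfolding bounded_iff ball_simps by blast
    have "norm (t powr (1 - \<alpha>) *\<^sub>R S t x) \<le> c" if "t \<in> {0<..b}" for t
      using c[of t] that by simp
    then show ?thesis by blast
  qed
  moreover have "bounded_linear (\<lambda>x. t powr (1 - \<alpha>) *\<^sub>R S t x)" if "t \<in> {0<..b}" for t
  proof -
    have "bounded_linear (S t)" using lin[of t] that b by (auto simp: bounded_clinear_def)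
    then show ?thesis by (rule bounded_linear_const_scaleR)
  qed
  ultimately obtain M where M: "M \<ge> 0"
    "\<And>t x. t \<in> {0<..b} \<Longrightarrow> norm (t powr (1 - \<alpha>) *\<^sub>R S t x) \<le> M * norm x"
    using uniform_boundedness[of "{0<..b}" "\<lambda>t x. t powr (1 - \<alpha>) *\<^sub>R S t x"] by blast
  have "norm (S t x) \<le> M * t powr (\<alpha> - 1) * norm x" if t: "t \<in> {0<..b}" for t x
  proof -
    have "t powr (\<alpha> - 1) * t powr (1 - \<alpha>) = 1" using t by (simp add: powr_add[symmetric])
    then have "norm (S t x) = t powr (\<alpha> - 1) * norm (t powr (1 - \<alpha>) *\<^sub>R S t x)"
      by (simp add: mult.assoc[symmetric])
    also have "\<dots> \<le> t powr (\<alpha> - 1) * (M * norm x)" using M(2)[OF t] by (rule mult_left_mono) simp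
    finally show ?thesis by (simp add: mult_ac)
  qed
  with M(1) show "op_fam \<alpha> b S"
    unfolding op_fam_def using lin cont b(2) by (blast intro: continuous_on_subset)
qed

lemma regularized_resolvent_familyI:
  assumes A: "closed_operator D A" and \<alpha>: "0 < \<alpha>" and b: "0 < b"
    and S: "op_fam \<alpha> b S" "commutes_with D A b S" "resolvent_eq \<alpha> D A b S"
    and lim: "\<And>x. ((\<lambda>t. inverse (g \<alpha> t) *\<^sub>C S t x) \<longlongrightarrow> x) (at_right 0)"
  shows "regularized_resolvent_family (g \<alpha>) (g \<alpha>) {0<..b} D A S"
  unfolding regularized_resolvent_family_def
proof (intro conjI ballI allI)
  show "g \<alpha> absolutely_integrable_on {0..c}" for c by (rule g_regular(1)[OF \<alpha>])
  then show "g \<alpha> absolutely_integrable_on {0..c}" for c .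
  show "continuous_on {0<..b} (g \<alpha>)" by (rule continuous_on_subset[OF g_regular(2)[OF \<alpha>]]) auto
  show "\<exists>\<sigma>>0. {0<..<\<sigma>} \<subseteq> {0<..b} \<and> (\<forall>t\<in>{0<..<\<sigma>}. g \<alpha> t \<noteq> 0)"
    using b g_regular(3)[OF \<alpha>] by (intro exI[of _ b]) auto
  fix t x assume t: "t \<in> {0<..b}"
  then have t': "0 \<le> t" "t \<le> b" by auto
  show "bounded_clinear (S t)" using op_famD(1)[OF S(1)] t by auto
  show "S t x \<in> D" "A (S t x) = S t (A x)" if "x \<in> D" using S(2) t that by (auto simp: commutes_with_def)
  note int = op_conv_integrable[OF op_fam_rl[OF \<alpha>] S(1) \<alpha> \<alpha> t', of x]
  show "conv_integrable (g \<alpha>) (\<lambda>s. S s x) t"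
    unfolding conv_integrable_def
  proof
    show "(\<lambda>s. g \<alpha> (t - s) *\<^sub>C S s x) integrable_on {0..t}"
      using int(1) by (rule integrable_eq) (simp add: g_scaleC)
    show "(\<lambda>s. norm (g \<alpha> (t - s) *\<^sub>C S s x)) integrable_on {0..t}"
      using int(2) by (rule integrable_eq) (simp add: g_scaleC)
  qed
  show "conv (g \<alpha>) (\<lambda>s. S s x) t \<in> D" "A (conv (g \<alpha>) (\<lambda>s. S s x) t) = S t x - g \<alpha> t *\<^sub>C x"
    using S(3) t by (auto simp: resolvent_eq_def conv_g g_scaleC)
qed (use A lim op_famD(4)[OF S(1)] in auto)

text \<open>Each pointwise clause at \<open>t\<close> involves the family only on [0,t], so it can
  be read off the local family with b = t. Agreement is demanded at 0 too, because the convolution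
  integrals run over closed intervals.\<close>

lemma regularized_resolvent_family_glue:
  assumes loc: "\<And>b. b > 0 \<Longrightarrow> \<exists>S'. regularized_resolvent_family a k {0<..b} D A S' \<and> (\<forall>t\<in>{0..b}. S t = S' t)"
  shows "regularized_resolvent_family a k {0<..} D A S"
proof -
  obtain R where R: "\<And>b. b > 0 \<Longrightarrow> regularized_resolvent_family a k {0<..b} D A (R b)"
    and eq: "\<And>b t. b > 0 \<Longrightarrow> 0 \<le> t \<Longrightarrow> t \<le> b \<Longrightarrow> S t = R b t"
    using loc by (metis atLeastAtMost_iff)
  note R' = R[unfolded regularized_resolvent_family_def]
  \<comment> \<open>Continuity is local only along open sets, so the half-closed intervals are
    replaced by open ones.\<close>
  have UN: "{0<..} = (\<Union>b\<in>{0<..}. {0<..<b::real})"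
    using gt_ex by fastforce
  have cont: "continuous_on {0<..} f" if "\<And>b. b > 0 \<Longrightarrow> continuous_on {0<..b} f" for f :: "real \<Rightarrow> 'b::topological_space"
  proof -
    have "continuous_on (\<Union>b\<in>{0<..}. {0<..<b::real}) f"
      by (rule continuous_on_open_UN) (auto intro: continuous_on_subset[OF that])
    then show ?thesis by (simp only: UN[symmetric])
  qed
  have conv_eq: "conv a (\<lambda>s. S s x) t = conv a (\<lambda>s. R t s x) t"
    "conv_integrable a (\<lambda>s. S s x) t \<longleftrightarrow> conv_integrable a (\<lambda>s. R t s x) t" if "t > 0" for t x
  proof -
    have e: "a (t - s) *\<^sub>C S s x = a (t - s) *\<^sub>C R t s x" if "s \<in> {0..t}" for s
      using eq[OF \<open>t > 0\<close>, of s] that by simp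
    show "conv a (\<lambda>s. S s x) t = conv a (\<lambda>s. R t s x) t"
      unfolding conv_def by (rule integral_cong) (rule e)
    show "conv_integrable a (\<lambda>s. S s x) t \<longleftrightarrow> conv_integrable a (\<lambda>s. R t s x) t"
      unfolding conv_integrable_def
      by (intro conj_cong integrable_cong) (simp_all only: e)
  qed
  show ?thesis
    unfolding regularized_resolvent_family_def
  proof (intro conjI ballI allI)
    show "continuous_on {0<..} k" by (rule cont) (use R' in blast)
    show "\<exists>\<sigma>>0. {0<..<\<sigma>} \<subseteq> {0<..} \<and> (\<forall>t\<in>{0<..<\<sigma>}. k t \<noteq> 0)"
      using R'[of 1] by auto
    show "closed_operator D A" using R'[of 1] by simp
    show "continuous_on {0<..} (\<lambda>t. S t x)" for x
    proof (rule cont)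
      fix b :: real assume b: "b > 0"
      have "continuous_on {0<..b} (\<lambda>t. R b t x)" using R'[OF b] by blast
      then show "continuous_on {0<..b} (\<lambda>t. S t x)"
        by (rule continuous_on_eq) (use eq[OF b] in auto)
    qed
    show "((\<lambda>t. inverse (k t) *\<^sub>C S t x) \<longlongrightarrow> x) (at_right 0)" for x
    proof -
      have "((\<lambda>t. inverse (k t) *\<^sub>C R 1 t x) \<longlongrightarrow> x) (at_right 0)" using R'[of 1] by simp
      then show ?thesis
      proof (rule Lim_transform_eventually)
        have "\<forall>\<^sub>F t in at_right 0. t \<in> {0<..<1::real}" by (rule eventually_at_right_real) simp
        then show "\<forall>\<^sub>F t in at_right 0. inverse (k t) *\<^sub>C R 1 t x = inverse (k t) *\<^sub>C S t x"
          by eventually_elim (use eq[of 1] in auto)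
      qed
    qed
    fix t x assume "t \<in> {0::real<..}"
    then have t: "t > 0" "t \<in> {0<..t}" by auto
    note r = R'[OF t(1)]
    have St: "S t = R t t" using eq[of t t] t by simp
    show "a absolutely_integrable_on {0..t}" "k absolutely_integrable_on {0..t}"
      using r t(2) by blast+
    show "bounded_clinear (S t)" unfolding St using r t(2) by blast
    show "S t x \<in> D" "A (S t x) = S t (A x)" if "x \<in> D" unfolding St using r t(2) that by blast+
    show "conv_integrable a (\<lambda>s. S s x) t" "conv a (\<lambda>s. S s x) t \<in> D"
      "A (conv a (\<lambda>s. S s x) t) = S t x - k t *\<^sub>C x"
      unfolding St conv_eq[OF t(1)] using r t(2) by blast+
  qed
qed

section \<open>Iteration and the global family\<close>

text \<open>The substitution s = t - b - r_2 identifies the inner integral with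
  \<open>marchaud\<close>, and the constant in front moves under the outer integral.\<close>

lemma extension_Suc: "extension \<alpha> T L (Suc n) = glued \<alpha> (real (n + 1) * T) (extension \<alpha> T L n) L"
proof (intro ext)
  fix t x
  let ?b = "real (n + 1) * T"
  have "1 / (t - r\<^sub>1 - r\<^sub>2) powr (1 + \<alpha>) = (?b + (t - ?b - r\<^sub>2) - r\<^sub>1) powr (-1 - \<alpha>)" for r\<^sub>1 r\<^sub>2
  proof -
    have "-1 - \<alpha> = - (1 + \<alpha>)" "?b + (t - ?b - r\<^sub>2) - r\<^sub>1 = t - r\<^sub>1 - r\<^sub>2" by simp_all
    then show ?thesis by (simp only: powr_minus_divide)
  qed
  then show "extension \<alpha> T L (Suc n) t x = glued \<alpha> ?b (extension \<alpha> T L n) L t x"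
    by (simp only: extension.simps glued_def op_conv_def marchaud_def integral_cmul)
qed

text \<open>The case split in \<open>extension\<close> hands older values through. This includes t =
  0, where the gluing of local families asks for agreement.\<close>

lemma extension_stable:
  assumes "t \<le> real (n + 1) * T" "n \<le> m" "T \<ge> 0"
  shows "extension \<alpha> T L m t = extension \<alpha> T L n t"
  using assms(2)
proof (induction m rule: dec_induct)
  case (step m)
  have "real (n + 1) * T \<le> real (m + 1) * T" using step assms(3) by (intro mult_right_mono) auto
  then show ?case using assms(1) step by (auto simp del: of_nat_add of_nat_Suc)
qed simp

text \<open>The induction carries the three properties of a step. The limit at 0 stays outside,
  since all stages coincide with \<open>L\<close> on (0,T].\<close>

lemma extension_regularized_resolvent_family:
  assumes \<alpha>: "0 < \<alpha>" "\<alpha> < 1" and T: "0 < T" and A: "closed_operator D A"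
    and R: "regularized_resolvent_family (g \<alpha>) (g \<alpha>) I D A L" and I: "{0<..T} \<subseteq> I"
  shows "regularized_resolvent_family (g \<alpha>) (g \<alpha>) {0<..real (n + 1) * T} D A (extension \<alpha> T L n)"
proof -
  note L = regularized_resolvent_familyD[OF R \<alpha>(1) T I]
  have "op_fam \<alpha> (real (n + 1) * T) (extension \<alpha> T L n) \<and>
      commutes_with D A (real (n + 1) * T) (extension \<alpha> T L n) \<and>
      resolvent_eq \<alpha> D A (real (n + 1) * T) (extension \<alpha> T L n)"
  proof (induction n)
    case 0
    then show ?case using L by simp
  next
    case (Suc n)
    let ?b = "real (n + 1) * T"
    have b: "0 < ?b" using T by simp
    have e: "real (Suc n + 1) * T = ?b + T" by (simp add: algebra_simps)
    note * = A \<alpha> b T conjunct1[OF Suc] conjunct1[OF conjunct2[OF Suc]] conjunct2[OF conjunct2[OF Suc]] L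
    show ?case unfolding extension_Suc e
      by (intro conjI op_fam_glued[OF *] glued_commutes_with[OF *] glued_resolvent_eq[OF *])
  qed
  moreover have "((\<lambda>t. inverse (g \<alpha> t) *\<^sub>C extension \<alpha> T L n t x) \<longlongrightarrow> x) (at_right 0)" for x
  proof -
    have "((\<lambda>t. inverse (g \<alpha> t) *\<^sub>C L t x) \<longlongrightarrow> x) (at_right 0)"
      using R unfolding regularized_resolvent_family_def by blast
    then show ?thesis
    proof (rule Lim_transform_eventually)
      have "\<forall>\<^sub>F t in at_right 0. t \<in> {0<..<T}" using T by (rule eventually_at_right_real)
      then show "\<forall>\<^sub>F t in at_right 0. inverse (g \<alpha> t) *\<^sub>C L t x
          = inverse (g \<alpha> t) *\<^sub>C extension \<alpha> T L n t x"
        by eventually_elim (use extension_stable[of _ 0 T n \<alpha> L] T in auto)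
    qed
  qed
  ultimately show ?thesis using T by (intro regularized_resolvent_familyI[OF A \<alpha>(1)]) auto
qed

theorem corollary2:
  fixes A :: "'a::complex_banach \<Rightarrow> 'a" and D :: "'a set"
    and S\<^sub>1 :: "real \<Rightarrow> 'a \<Rightarrow> 'a"
    and \<tau> :: ereal and \<alpha> :: real and n :: nat
  assumes "0 < \<tau>"
    and "0 < \<alpha>" and "\<alpha> < 1"
    and "closed_operator D A"
    and "regularized_resolvent_family (g \<alpha>) (g \<alpha>) (open_interval \<tau>) D A S\<^sub>1"
  shows "(\<forall>T. 0 < T \<and> ereal T < \<tau> \<longrightarrow>
      regularized_resolvent_family (g \<alpha>) (g \<alpha>) {0<..real (n + 1) * T} D A
        (extension \<alpha> T S\<^sub>1 n)) \<and>
    (\<exists>S. regularized_resolvent_family (g \<alpha>) (g \<alpha>) (open_interval \<infinity>) D A S)"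
proof -
  have local: "regularized_resolvent_family (g \<alpha>) (g \<alpha>) {0<..real (m + 1) * T} D A (extension \<alpha> T S\<^sub>1 m)"
    if T: "0 < T" "ereal T < \<tau>" for T m
  proof (rule extension_regularized_resolvent_family[OF assms(2,3) T(1) assms(4,5)])
    show "{0<..T} \<subseteq> open_interval \<tau>"
      unfolding open_interval_def using T(2) by (auto intro: le_less_trans[of "ereal _" "ereal T"])
  qed
  obtain T where T: "0 < T" "ereal T < \<tau>" using ereal_dense2[OF assms(1)] by auto
  \<comment> \<open>Any stage whose interval contains \<open>t\<close> would give the same value;
    the ceiling picks one, with a step to spare.\<close>
  define S where "S t = extension \<alpha> T S\<^sub>1 (nat \<lceil>t / T\<rceil>) t" for t
  have S: "S t = extension \<alpha> T S\<^sub>1 m t" if "t \<le> real (m + 1) * T" for t m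
  proof -
    define k where "k = nat \<lceil>t / T\<rceil>"
    have "t / T \<le> real (k + 1)" unfolding k_def by linarith
    then have "t \<le> real (k + 1) * T" using T by (simp add: divide_le_eq)
    then show ?thesis
      using extension_stable[of t k T "max k m" \<alpha> S\<^sub>1] extension_stable[of t m T "max k m" \<alpha> S\<^sub>1] that T
      by (simp add: S_def k_def[symmetric])
  qed
  have "regularized_resolvent_family (g \<alpha>) (g \<alpha>) {0<..} D A S"
  proof (rule regularized_resolvent_family_glue)
    fix b :: real assume b: "b > 0"
    obtain m :: nat where m: "b / T \<le> real m" using real_arch_simple by blast
    let ?c = "real (m + 1) * T"
    have bc: "b \<le> ?c" using m T by (simp add: divide_le_eq algebra_simps)
    note R = local[OF T, of m]
    have c: "0 < ?c" using T by simp
    note d = regularized_resolvent_familyD[OF R assms(2)]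
    have sub: "{0<..b} \<subseteq> {0<..?c}" using bc by auto
    \<comment> \<open>Restriction to a shorter interval passes through the three properties, which
      \<open>regularized_resolvent_familyD\<close> delivers on any initial piece of the index
      set.\<close>
    have "regularized_resolvent_family (g \<alpha>) (g \<alpha>) {0<..b} D A (extension \<alpha> T S\<^sub>1 m)"
      by (rule regularized_resolvent_familyI[OF assms(4,2) b d(1-3)[OF b sub]])
        (use R in \<open>unfold regularized_resolvent_family_def, blast\<close>)
    moreover have "\<forall>t\<in>{0..b}. S t = extension \<alpha> T S\<^sub>1 m t" using S bc by auto
    ultimately show "\<exists>S'. regularized_resolvent_family (g \<alpha>) (g \<alpha>) {0<..b} D A S' \<and> (\<forall>t\<in>{0..b}. S t = S' t)"
      by blast
  qed
  moreover have "open_interval \<infinity> = {0<..}" by (auto simp: open_interval_def)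
  ultimately show ?thesis using local by auto
qed

end
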